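(* Let $M$ be a closed connected smooth Riemannian manifold and let $G:T^*M\to\mathbb{R}$ be continuous, convex in $p$, and superlinear in $p$ ($G(x,p)/\|p\|_x\to+\infty$ as $\|p\|_x\to\infty$). For any viscosity solutions $u_1$ and $u_2$ of $G(x,d_xu)=c(G)$ in $M$, if $$\int_Mu_1(y)\,d\mu(y)\le\int_Mu_2(y)\,d\mu(y)$$ for all projected Mather measures $\mu$ of $L_G$, then $u_1\le u_2$ on $M$.
   Context: The critical value of $G$ is $c(G)=\inf_{f\in C^1(M)}\max_{x\in M}G(x,d_xf)$; it is the only constant $c$ for which $G(x,d_xu)=c$ admits viscosity solutions on $M$. The Lagrangian is $L_G(x,v)=\sup_{p\in T_x^*M}(p(v)-G(x,p))$ on $TM$. A Borel probability measure $\tilde\mu$ on $TM$ is closed if $\int_{TM}\|v\|_x\,d\tilde\mu<\infty$ and $\int_{TM}d_x\varphi(v)\,d\tilde\mu(x,v)=0$ for all $\varphi\in C^1(M)$. A Mather measure of $L_G$ is a closed probability measure $\tilde\mu$ with $\int_{TM}L_G\,d\tilde\mu=-c(G)$. A projected Mather measure is $\mu=\pi_\#\tilde\mu$ with $\tilde\mu$ a Mather measure and $\pi:TM\to M$ the canonical projection. *)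

theory Defs
  imports "HOL-Probability.Probability"
begin

section \<open>Smooth maps between normed spaces\<close>

text \<open>For open \<open>S\<close> in a finite-dimensional space, \<open>Ck_on k S f\<close> says that \<open>f\<close> is of class \<open>C^k\<close>
  on \<open>S\<close>: all iterated directional derivatives up to order \<open>k\<close> exist and are continuous.\<close>

primrec Ck_on ::
  "nat \<Rightarrow> 'a::real_normed_vector set \<Rightarrow> ('a \<Rightarrow> 'b::real_normed_vector) \<Rightarrow> bool" where
  "Ck_on 0 S f \<longleftrightarrow> continuous_on S f"
| "Ck_on (Suc k) S f \<longleftrightarrow> (\<forall>x\<in>S. f differentiable (at x)) \<and>
     (\<forall>h. Ck_on k S (\<lambda>x. frechet_derivative f (at x) h))"

definition smooth_on :: "'a::real_normed_vector set \<Rightarrow> ('a \<Rightarrow> 'b::real_normed_vector) \<Rightarrow> bool" where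
  "smooth_on S f \<longleftrightarrow> (\<forall>k. Ck_on k S f)"

section \<open>Smooth manifolds\<close>

text \<open>The manifold is the whole type \<open>'m\<close>; the model space is \<open>'e\<close>. A chart is a pair of
  its domain and its coordinate map (whose values outside the domain are irrelevant).\<close>

type_synonym ('m, 'e) chart = "'m set \<times> ('m \<Rightarrow> 'e)"

abbreviation chart_dom :: "('m, 'e) chart \<Rightarrow> 'm set" where "chart_dom \<equiv> fst"
abbreviation chart_map :: "('m, 'e) chart \<Rightarrow> 'm \<Rightarrow> 'e" where "chart_map \<equiv> snd"

definition chart_inv :: "('m, 'e) chart \<Rightarrow> 'e \<Rightarrow> 'm" where
  "chart_inv c = inv_into (chart_dom c) (chart_map c)"

definition chart_img :: "('m, 'e) chart \<Rightarrow> 'e set" where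
  "chart_img c = chart_map c ` chart_dom c"

definition transition :: "('m, 'e) chart \<Rightarrow> ('m, 'e) chart \<Rightarrow> 'e \<Rightarrow> 'e" where
  "transition c d = chart_map d \<circ> chart_inv c"

definition smooth_atlas :: "('m::t2_space, 'e::euclidean_space) chart set \<Rightarrow> bool" where
  "smooth_atlas A \<longleftrightarrow>
     (\<Union>c\<in>A. chart_dom c) = UNIV \<and>
     (\<forall>c\<in>A. open (chart_dom c) \<and> open (chart_img c) \<and>
        homeomorphism (chart_dom c) (chart_img c) (chart_map c) (chart_inv c)) \<and>
     (\<forall>c\<in>A. \<forall>d\<in>A. smooth_on (chart_map c ` (chart_dom c \<inter> chart_dom d)) (transition c d))"

definition C1_functions :: "('m::t2_space, 'e::euclidean_space) chart set \<Rightarrow> ('m \<Rightarrow> real) set" where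
  "C1_functions A = {f. \<forall>c\<in>A. Ck_on 1 (chart_img c) (f \<circ> chart_inv c)}"

section \<open>Tangent and cotangent bundle\<close>

text \<open>A tangent vector at \<open>x\<close> is the family of its components in all charts around \<open>x\<close>,
  which transform by the derivatives of the transition maps. Components in irrelevant charts are
  set to \<open>0\<close>, so that a tangent vector has exactly one representation. The vector space operations
  are pointwise.\<close>

type_synonym ('m, 'e) tvec = "('m, 'e) chart \<Rightarrow> 'e"

definition tangent_space ::
  "('m::t2_space, 'e::euclidean_space) chart set \<Rightarrow> 'm \<Rightarrow> ('m, 'e) tvec set" where
  "tangent_space A x = {v.
     (\<forall>c. c \<notin> A \<or> x \<notin> chart_dom c \<longrightarrow> v c = 0) \<and>
     (\<forall>c\<in>A. \<forall>d\<in>A. x \<in> chart_dom c \<inter> chart_dom d \<longrightarrow>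
        v d = frechet_derivative (transition c d) (at (chart_map c x)) (v c))}"

text \<open>The tangent vector at \<open>x\<close> whose component in the chart \<open>c\<close> is \<open>e\<close>.\<close>

definition coord_vector ::
  "('m::t2_space, 'e::euclidean_space) chart set \<Rightarrow> ('m, 'e) chart \<Rightarrow> 'm \<Rightarrow> 'e \<Rightarrow> ('m, 'e) tvec" where
  "coord_vector A c x e = (\<lambda>d. if d \<in> A \<and> x \<in> chart_dom d
     then frechet_derivative (transition c d) (at (chart_map c x)) e else 0)"

text \<open>The cotangent space is the dual of the tangent space; functionals are extended by \<open>0\<close>
  outside the tangent space.\<close>

type_synonym ('m, 'e) covec = "('m, 'e) tvec \<Rightarrow> real"

definition cotangent_space ::
  "('m::t2_space, 'e::euclidean_space) chart set \<Rightarrow> 'm \<Rightarrow> ('m, 'e) covec set" where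
  "cotangent_space A x = {p.
     (\<forall>v\<in>tangent_space A x. \<forall>w\<in>tangent_space A x. \<forall>a b.
        p (\<lambda>c. a *\<^sub>R v c + b *\<^sub>R w c) = a * p v + b * p w) \<and>
     (\<forall>v. v \<notin> tangent_space A x \<longrightarrow> p v = 0)}"

text \<open>The components of a covector at \<open>x\<close> in the chart \<open>c\<close>.\<close>

definition covec_coords ::
  "('m::t2_space, 'e::euclidean_space) chart set \<Rightarrow> ('m, 'e) chart \<Rightarrow> 'm \<Rightarrow> ('m, 'e) covec \<Rightarrow> 'e" where
  "covec_coords A c x p = (\<Sum>b\<in>Basis. p (coord_vector A c x b) *\<^sub>R b)"

definition tangent_bundle ::
  "('m::t2_space, 'e::euclidean_space) chart set \<Rightarrow> ('m \<times> ('m, 'e) tvec) set" where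
  "tangent_bundle A = Sigma UNIV (tangent_space A)"

definition cotangent_bundle ::
  "('m::t2_space, 'e::euclidean_space) chart set \<Rightarrow> ('m \<times> ('m, 'e) covec) set" where
  "cotangent_bundle A = Sigma UNIV (cotangent_space A)"

text \<open>Both bundles carry the topology for which the induced bundle charts
  are homeomorphisms onto \<open>chart_img c \<times> UNIV\<close>.\<close>

definition tangent_topology ::
  "('m::t2_space, 'e::euclidean_space) chart set \<Rightarrow> ('m \<times> ('m, 'e) tvec) topology" where
  "tangent_topology A = topology_generated_by
     {{(x, v) \<in> tangent_bundle A. x \<in> chart_dom c \<and> (chart_map c x, v c) \<in> W} | c W.
        c \<in> A \<and> open W}"

definition cotangent_topology ::
  "('m::t2_space, 'e::euclidean_space) chart set \<Rightarrow> ('m \<times> ('m, 'e) covec) topology" where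
  "cotangent_topology A = topology_generated_by
     {{(x, p) \<in> cotangent_bundle A. x \<in> chart_dom c \<and> (chart_map c x, covec_coords A c x p) \<in> W} | c W.
        c \<in> A \<and> open W}"

definition tangent_borel ::
  "('m::t2_space, 'e::euclidean_space) chart set \<Rightarrow> ('m \<times> ('m, 'e) tvec) measure" where
  "tangent_borel A = sigma (tangent_bundle A) {W. openin (tangent_topology A) W}"

text \<open>For \<open>C^1\<close> functions the value does not depend on the chosen chart around \<open>x\<close>.\<close>

definition differential ::
  "('m::t2_space, 'e::euclidean_space) chart set \<Rightarrow> ('m \<Rightarrow> real) \<Rightarrow> 'm \<Rightarrow> ('m, 'e) covec" where
  "differential A f x = (\<lambda>v. if v \<in> tangent_space A x
     then (let c = (SOME c. c \<in> A \<and> x \<in> chart_dom c)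
           in frechet_derivative (f \<circ> chart_inv c) (at (chart_map c x)) (v c))
     else 0)"

section \<open>Riemannian metrics\<close>

definition riemannian_metric ::
  "('m::t2_space, 'e::euclidean_space) chart set \<Rightarrow>
   ('m \<Rightarrow> ('m, 'e) tvec \<Rightarrow> ('m, 'e) tvec \<Rightarrow> real) \<Rightarrow> bool" where
  "riemannian_metric A g \<longleftrightarrow>
     (\<forall>x. \<forall>u\<in>tangent_space A x. \<forall>v\<in>tangent_space A x. \<forall>w\<in>tangent_space A x. \<forall>a b.
        g x (\<lambda>c. a *\<^sub>R u c + b *\<^sub>R v c) w = a * g x u w + b * g x v w) \<and>
     (\<forall>x. \<forall>v\<in>tangent_space A x. \<forall>w\<in>tangent_space A x. g x v w = g x w v) \<and>
     (\<forall>x. \<forall>v\<in>tangent_space A x. v \<noteq> (\<lambda>c. 0) \<longrightarrow> g x v v > 0) \<and>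
     (\<forall>c\<in>A. \<forall>a b. smooth_on (chart_img c)
        (\<lambda>y. g (chart_inv c y) (coord_vector A c (chart_inv c y) a)
                               (coord_vector A c (chart_inv c y) b)))"

definition closed_connected_riemannian_manifold ::
  "('m::t2_space, 'e::euclidean_space) chart set \<Rightarrow>
   ('m \<Rightarrow> ('m, 'e) tvec \<Rightarrow> ('m, 'e) tvec \<Rightarrow> real) \<Rightarrow> bool" where
  "closed_connected_riemannian_manifold A g \<longleftrightarrow>
     compact (UNIV :: 'm set) \<and> connected (UNIV :: 'm set) \<and> smooth_atlas A \<and> riemannian_metric A g"

definition tnorm ::
  "('m \<Rightarrow> ('m, 'e) tvec \<Rightarrow> ('m, 'e) tvec \<Rightarrow> real) \<Rightarrow> 'm \<Rightarrow> ('m, 'e) tvec \<Rightarrow> real" where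
  "tnorm g x v = sqrt (g x v v)"

definition conorm ::
  "('m::t2_space, 'e::euclidean_space) chart set \<Rightarrow>
   ('m \<Rightarrow> ('m, 'e) tvec \<Rightarrow> ('m, 'e) tvec \<Rightarrow> real) \<Rightarrow> 'm \<Rightarrow> ('m, 'e) covec \<Rightarrow> real" where
  "conorm A g x p = (SUP v\<in>{v \<in> tangent_space A x. tnorm g x v \<le> 1}. p v)"

section \<open>Hamiltonians and viscosity solutions\<close>

definition convex_in_p ::
  "('m::t2_space, 'e::euclidean_space) chart set \<Rightarrow> ('m \<times> ('m, 'e) covec \<Rightarrow> real) \<Rightarrow> bool" where
  "convex_in_p A G \<longleftrightarrow>
     (\<forall>x. \<forall>p\<in>cotangent_space A x. \<forall>q\<in>cotangent_space A x. \<forall>t\<in>{0..1}.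
        G (x, \<lambda>v. (1 - t) * p v + t * q v) \<le> (1 - t) * G (x, p) + t * G (x, q))"

definition superlinear_in_p ::
  "('m::t2_space, 'e::euclidean_space) chart set \<Rightarrow>
   ('m \<Rightarrow> ('m, 'e) tvec \<Rightarrow> ('m, 'e) tvec \<Rightarrow> real) \<Rightarrow> ('m \<times> ('m, 'e) covec \<Rightarrow> real) \<Rightarrow> bool" where
  "superlinear_in_p A g G \<longleftrightarrow>
     (\<forall>x. filterlim (\<lambda>p. G (x, p) / conorm A g x p) at_top
        (inf (filtercomap (conorm A g x) at_top) (principal (cotangent_space A x))))"

definition viscosity_solution ::
  "('m::t2_space, 'e::euclidean_space) chart set \<Rightarrow> ('m \<times> ('m, 'e) covec \<Rightarrow> real) \<Rightarrow>
   real \<Rightarrow> ('m \<Rightarrow> real) \<Rightarrow> bool" where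
  "viscosity_solution A G c u \<longleftrightarrow> continuous_on UNIV u \<and>
     (\<forall>\<phi>\<in>C1_functions A. \<forall>x.
        (\<forall>\<^sub>F y in nhds x. u y - \<phi> y \<le> u x - \<phi> x) \<longrightarrow> G (x, differential A \<phi> x) \<le> c) \<and>
     (\<forall>\<phi>\<in>C1_functions A. \<forall>x.
        (\<forall>\<^sub>F y in nhds x. u y - \<phi> y \<ge> u x - \<phi> x) \<longrightarrow> G (x, differential A \<phi> x) \<ge> c)"

text \<open>For continuous \<open>G\<close> the inner supremum is a maximum, by compactness.\<close>

definition critical_value ::
  "('m::t2_space, 'e::euclidean_space) chart set \<Rightarrow> ('m \<times> ('m, 'e) covec \<Rightarrow> real) \<Rightarrow> real" where
  "critical_value A G = (INF f\<in>C1_functions A. SUP x. G (x, differential A f x))"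

definition Lagrangian ::
  "('m::t2_space, 'e::euclidean_space) chart set \<Rightarrow> ('m \<times> ('m, 'e) covec \<Rightarrow> real) \<Rightarrow>
   'm \<times> ('m, 'e) tvec \<Rightarrow> real" where
  "Lagrangian A G = (\<lambda>(x, v). SUP p\<in>cotangent_space A x. p v - G (x, p))"

section \<open>Mather measures\<close>

definition closed_prob_measure ::
  "('m::t2_space, 'e::euclidean_space) chart set \<Rightarrow>
   ('m \<Rightarrow> ('m, 'e) tvec \<Rightarrow> ('m, 'e) tvec \<Rightarrow> real) \<Rightarrow> ('m \<times> ('m, 'e) tvec) measure \<Rightarrow> bool" where
  "closed_prob_measure A g \<nu> \<longleftrightarrow>
     prob_space \<nu> \<and> sets \<nu> = sets (tangent_borel A) \<and>
     (\<integral>\<^sup>+ (x, v). ennreal (tnorm g x v) \<partial>\<nu>) < \<infinity> \<and>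
     (\<forall>\<phi>\<in>C1_functions A. (\<integral>(x, v). differential A \<phi> x v \<partial>\<nu>) = 0)"

text \<open>Integrability is required explicitly because the Bochner integral of a non-integrable
  function is \<open>0\<close>; the Lagrangian is bounded below, so its integral always makes sense in
  \<open>(-\<infinity>, \<infinity>]\<close>, and it is finite exactly if the Lagrangian is integrable.\<close>

definition mather_measure ::
  "('m::t2_space, 'e::euclidean_space) chart set \<Rightarrow>
   ('m \<Rightarrow> ('m, 'e) tvec \<Rightarrow> ('m, 'e) tvec \<Rightarrow> real) \<Rightarrow> ('m \<times> ('m, 'e) covec \<Rightarrow> real) \<Rightarrow>
   ('m \<times> ('m, 'e) tvec) measure \<Rightarrow> bool" where
  "mather_measure A g G \<nu> \<longleftrightarrow> closed_prob_measure A g \<nu> \<and>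
     integrable \<nu> (Lagrangian A G) \<and> (\<integral>z. Lagrangian A G z \<partial>\<nu>) = - critical_value A G"

definition projected_mather_measure ::
  "('m::t2_space, 'e::euclidean_space) chart set \<Rightarrow>
   ('m \<Rightarrow> ('m, 'e) tvec \<Rightarrow> ('m, 'e) tvec \<Rightarrow> real) \<Rightarrow> ('m \<times> ('m, 'e) covec \<Rightarrow> real) \<Rightarrow>
   'm measure \<Rightarrow> bool" where
  "projected_mather_measure A g G \<mu> \<longleftrightarrow>
     (\<exists>\<nu>. mather_measure A g G \<nu> \<and> \<mu> = distr \<nu> borel fst)"

end

theory Submission
  imports Defs
begin

text \<open>Let \<open>Z\<close> be the set of maximum points of \<open>u1 - u2\<close> and \<open>c\<close> the critical value. It suffices to find a
  Mather measure supported over \<open>Z\<close>, since then \<open>max (u1 - u2) = \<integral> (u1 - u2) \<le> 0\<close>.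

  Doubling variables at a maximum point of \<open>(1 - s) * u1 + s * \<phi> - u2\<close>, for a \<open>C\<^sup>1\<close> function \<open>\<phi>\<close>, produces a
  covector \<open>q\<close> with \<open>G q \<le> c \<le> G ((1 - s) * q + s * d\<phi>)\<close>. By convexity \<open>c \<le> G\<close> on the rest of the segment up
  to \<open>d\<phi>\<close>, so \<open>s \<rightarrow> 0\<close> gives a point of \<open>Z\<close> and a \<open>q\<close> with \<open>G q \<le> c\<close> and \<open>c \<le> G\<close> on the whole segment
  from \<open>q\<close> to \<open>d\<phi>\<close>. Separating the segment from the epigraph of \<open>G\<close> yields a tangent vector \<open>v\<close>, bounded
  independently of \<open>\<phi>\<close>, with \<open>L v - d\<phi> v \<le> - c\<close>.

  Minimax duality turns this solvability for every single \<open>\<phi>\<close> into one probability measure \<open>\<nu>\<close> over \<open>Z\<close> with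
  \<open>\<integral> d\<phi> v = 0\<close> for all \<open>\<phi>\<close> and \<open>\<integral> L \<le> - c\<close>; the reverse inequality is the definition of \<open>c\<close>.\<close>

section \<open>Compact metric spaces as continuous images of the Cantor set\<close>

definition digit_series :: "real \<Rightarrow> (nat \<Rightarrow> bool) \<Rightarrow> real" where
  "digit_series q b = (\<Sum>i. of_bool (b i) * q ^ i)"

lemma summable_digits:
  fixes q :: real
  assumes "0 \<le> q" "q < 1"
  shows "summable (\<lambda>i. of_bool (b i) * q ^ i)"
proof (rule summable_comparison_test')
  show "summable (\<lambda>i. q ^ i)" using assms by simp
  show "norm (of_bool (b i) * q ^ i) \<le> q ^ i" for i using assms by simp
qed

lemma digit_series_nonneg: "0 \<le> q \<Longrightarrow> q < 1 \<Longrightarrow> 0 \<le> digit_series q b"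
  unfolding digit_series_def by (intro suminf_nonneg summable_digits) auto

lemma digit_series_le:
  assumes "0 \<le> q" "q < 1"
  shows "digit_series q b \<le> 1 / (1 - q)"
proof -
  have "digit_series q b \<le> (\<Sum>i. q ^ i)"
    unfolding digit_series_def using assms by (intro suminf_le summable_digits) auto
  also have "\<dots> = 1 / (1 - q)" using assms by (simp add: suminf_geometric)
  finally show ?thesis .
qed

lemma digit_series_split_head:
  assumes "0 \<le> q" "q < 1"
  shows "digit_series q b = of_bool (b 0) + q * digit_series q (\<lambda>i. b (Suc i))"
proof -
  have "digit_series q b = of_bool (b 0) + (\<Sum>i. of_bool (b (Suc i)) * q ^ Suc i)"
    unfolding digit_series_def using suminf_split_head[OF summable_digits[OF assms, of b]] by simp
  also have "(\<Sum>i. of_bool (b (Suc i)) * q ^ Suc i) = q * digit_series q (\<lambda>i. b (Suc i))"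
    unfolding digit_series_def using summable_digits[OF assms, of "\<lambda>i. b (Suc i)"]
    by (simp add: suminf_mult[symmetric] mult.left_commute)
  finally show ?thesis .
qed

lemma digit_series_eqD:
  assumes q: "0 < q" "q < 1/2" and eq: "digit_series q b = digit_series q b'"
  shows "b 0 = b' 0" and "digit_series q (\<lambda>i. b (Suc i)) = digit_series q (\<lambda>i. b' (Suc i))"
proof -
  have tail: "0 \<le> q * digit_series q d" "q * digit_series q d < 1" for d
  proof -
    have "q * digit_series q d \<le> q * (1 / (1 - q))" using q by (intro mult_left_mono digit_series_le) auto
    also have "\<dots> < 1" using q by (simp add: field_simps)
    finally show "q * digit_series q d < 1" .
    show "0 \<le> q * digit_series q d" using q by (intro mult_nonneg_nonneg digit_series_nonneg) auto
  qed
  have split: "of_bool (b 0) + q * digit_series q (\<lambda>i. b (Suc i)) =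
      of_bool (b' 0) + q * digit_series q (\<lambda>i. b' (Suc i))"
    using eq q by (simp flip: digit_series_split_head)
  then show head: "b 0 = b' 0"
    using tail[of "\<lambda>i. b (Suc i)"] tail[of "\<lambda>i. b' (Suc i)"] by (auto simp: of_bool_def split: if_splits)
  show "digit_series q (\<lambda>i. b (Suc i)) = digit_series q (\<lambda>i. b' (Suc i))"
    using split head q by simp
qed

lemma inj_digit_series:
  assumes "0 < q" "q < 1/2"
  shows "inj (digit_series q)"
proof (rule injI, rule ext)
  fix b b' n assume "digit_series q b = digit_series q b'"
  then show "b n = b' n"
  proof (induction n arbitrary: b b')
    case 0
    then show ?case by (rule digit_series_eqD(1)[OF assms])
  next
    case (Suc n)
    from Suc.IH[OF digit_series_eqD(2)[OF assms Suc.prems]] show ?case .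
  qed
qed

lemma ex_binary_expansion:
  assumes "0 \<le> t" "t \<le> 2"
  shows "\<exists>b. digit_series (1/2) b = t"
proof -
  define r where "r = rec_nat t (\<lambda>_ r. 2 * (r - of_bool (1 \<le> r)))"
  define b where "b n \<longleftrightarrow> 1 \<le> r n" for n
  have r_0: "r 0 = t" and r_Suc: "r (Suc n) = 2 * (r n - of_bool (b n))" for n
    by (simp_all add: r_def b_def)
  have r_bounds: "0 \<le> r n \<and> r n \<le> 2" for n
    by (induction n) (use assms in \<open>auto simp: r_0 r_Suc b_def\<close>)
  have partial_sum: "(\<Sum>i<n. of_bool (b i) * (1/2) ^ i) = t - r n * (1/2) ^ n" for n
    by (induction n) (simp_all add: r_0 r_Suc algebra_simps)
  have "(\<lambda>n. r n * (1/2) ^ n) \<longlonglongrightarrow> 0"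
  proof (rule Lim_null_comparison)
    show "\<forall>\<^sub>F n in sequentially. norm (r n * (1/2) ^ n) \<le> 2 * (1/2) ^ n"
      using r_bounds by (intro always_eventually) (simp add: abs_mult)
    show "(\<lambda>n. 2 * (1/2) ^ n :: real) \<longlonglongrightarrow> 0"
      by (intro tendsto_mult_right_zero LIMSEQ_realpow_zero) auto
  qed
  then have "(\<lambda>n. t - r n * (1/2) ^ n) \<longlonglongrightarrow> t - 0" by (intro tendsto_diff tendsto_const)
  then have "(\<lambda>i. of_bool (b i) * (1/2) ^ i) sums t" by (simp add: sums_def partial_sum)
  then show ?thesis unfolding digit_series_def by (blast dest: sums_unique)
qed

lemma continuous_on_digit_series:
  assumes "0 \<le> q" "q < 1"
  shows "continuous_on UNIV (digit_series q)"
proof (rule uniform_limit_theorem)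
  show "uniform_limit UNIV (\<lambda>n b. \<Sum>i<n. of_bool (b i) * q ^ i) (digit_series q) sequentially"
    unfolding digit_series_def
  proof (rule Weierstrass_m_test)
    show "norm (of_bool (b n) * q ^ n) \<le> q ^ n" for n and b :: "nat \<Rightarrow> bool" using assms by simp
    show "summable (\<lambda>n. q ^ n)" using assms by simp
  qed
  have "continuous_on UNIV (\<lambda>b :: nat \<Rightarrow> bool. of_bool (b i) :: real)" for i
    by (rule continuous_on_compose2[OF Topological_Spaces.continuous_on_discrete[of UNIV] continuous_on_product_coordinates]) simp
  then show "\<forall>\<^sub>F n in sequentially. continuous_on UNIV (\<lambda>b. \<Sum>i<n. of_bool (b i) * q ^ i)"
    by (intro always_eventually allI continuous_intros)
qed simp

lemma compact_UNIV_bool_fun: "compact (UNIV :: ('a \<Rightarrow> bool) set)"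
proof -
  have "compactin (product_topology (\<lambda>_::'a. euclidean :: bool topology) UNIV) (PiE UNIV (\<lambda>_. UNIV))"
    by (subst compactin_PiE) (auto simp: finite_imp_compact)
  then show ?thesis by (simp add: euclidean_product_topology)
qed

lemma compact_finite_nets:
  fixes K :: "'a::metric_space set"
  assumes K: "compact K"
  obtains net :: "nat \<Rightarrow> 'a list" and near :: "nat \<Rightarrow> 'a \<Rightarrow> nat"
  where "\<And>m. set (net m) \<subseteq> K" "\<And>m x. x \<in> K \<Longrightarrow> near m x < length (net m)"
    "\<And>m x. x \<in> K \<Longrightarrow> dist (net m ! near m x) x < inverse (Suc m)"
proof -
  have "\<exists>l. set l \<subseteq> K \<and> (\<forall>x\<in>K. \<exists>y\<in>set l. dist y x < inverse (Suc m))" for m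
  proof -
    have "K \<subseteq> (\<Union>y\<in>K. ball y (inverse (Suc m)))" by force
    then obtain T where T: "T \<subseteq> K" "finite T" "K \<subseteq> (\<Union>y\<in>T. ball y (inverse (Suc m)))"
      using compactE_image[OF K, of K "\<lambda>y. ball y (inverse (Suc m))"] by auto
    obtain l where "set l = T" using finite_list[OF T(2)] by blast
    moreover have "\<exists>y\<in>T. dist y x < inverse (Suc m)" if "x \<in> K" for x
      using subsetD[OF T(3) that] by auto
    ultimately show ?thesis using T(1) by blast
  qed
  then obtain net where net: "\<And>m. set (net m) \<subseteq> K"
    "\<And>m x. x \<in> K \<Longrightarrow> \<exists>y\<in>set (net m). dist y x < inverse (Suc m)" by metis
  define near where
    "near m x = (SOME i. i < length (net m) \<and> dist (net m ! i) x < inverse (Suc m))" for m x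
  have near: "near m x < length (net m) \<and> dist (net m ! near m x) x < inverse (Suc m)" if "x \<in> K" for m x
  proof -
    have "\<exists>i. i < length (net m) \<and> dist (net m ! i) x < inverse (Suc m)"
      using net(2)[OF that, of m] by (auto simp: in_set_conv_nth)
    then show ?thesis unfolding near_def by (rule someI_ex)
  qed
  show ?thesis
  proof (rule that)
    show "set (net m) \<subseteq> K" for m by (rule net(1))
    show "near m x < length (net m)" "dist (net m ! near m x) x < inverse (Suc m)" if "x \<in> K" for m x
      using near[OF that, of m] by simp_all
  qed
qed

lemma hilbert_cube_embedding:
  fixes K :: "'a::metric_space set"
  assumes K: "compact K"
  obtains e :: "'a \<Rightarrow> nat \<Rightarrow> real"
  where "continuous_on K e" "inj_on e K" "\<And>x i. 0 \<le> e x i \<and> e x i \<le> 1"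
proof -
  obtain net :: "nat \<Rightarrow> 'a list" and near :: "nat \<Rightarrow> 'a \<Rightarrow> nat"
    where near: "\<And>m x. x \<in> K \<Longrightarrow> near m x < length (net m)"
      "\<And>m x. x \<in> K \<Longrightarrow> dist (net m ! near m x) x < inverse (Suc m)"
    by (rule compact_finite_nets[OF K]) (rule that)
  define T where "T = (\<Union>m. set (net m))"
  have T: "countable T" by (simp add: T_def countable_finite)
  define a where "a = from_nat_into T"
  define e where "e x i = min 1 (dist x (a i))" for x and i :: nat
  show ?thesis
  proof (rule that)
    show "continuous_on K e"
      unfolding e_def by (intro continuous_on_coordinatewise_then_product continuous_intros)
    show "0 \<le> e x i \<and> e x i \<le> 1" for x i by (simp add: e_def)
    show "inj_on e K"
    proof (rule inj_onI, rule ccontr)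
      fix x y assume xy: "x \<in> K" "y \<in> K" "e x = e y" "x \<noteq> y"
      define \<epsilon> where "\<epsilon> = min 1 (dist x y / 2)"
      have "\<epsilon> > 0" using xy by (simp add: \<epsilon>_def)
      then obtain m where "inverse (real (Suc m)) < \<epsilon>" using reals_Archimedean by blast
      moreover have "net m ! near m x \<in> T" using nth_mem[OF near(1)[OF xy(1)]] by (auto simp: T_def)
      ultimately obtain z where z: "z \<in> T" "dist z x < \<epsilon>"
        using near(2)[OF xy(1), of m] less_trans by blast
      then obtain i where i: "a i = z"
        unfolding a_def using from_nat_into_surj[OF T] by blast
      have "min 1 (dist x z) = min 1 (dist y z)" using fun_cong[OF xy(3), of i] by (simp add: e_def i)
      then have "dist y z < \<epsilon>" using z(2) by (auto simp: \<epsilon>_def dist_commute min_def split: if_splits)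
      then have "dist x y < 2 * \<epsilon>" using z(2) dist_triangle2[of x y z] by (simp add: dist_commute)
      then show False by (simp add: \<epsilon>_def min_def split: if_splits)
    qed
  qed
qed

lemma compact_image_of_Cantor_space:
  fixes K :: "'a::metric_space set"
  assumes K: "compact K"
  obtains S :: "(nat \<Rightarrow> bool) set" and \<pi> :: "(nat \<Rightarrow> bool) \<Rightarrow> 'a"
  where "compact S" "continuous_on S \<pi>" "\<pi> ` S = K"
proof -
  obtain e :: "'a \<Rightarrow> nat \<Rightarrow> real" where e: "continuous_on K e" "inj_on e K"
    and e_bounds: "\<And>x i. 0 \<le> e x i \<and> e x i \<le> 1" by (rule hilbert_cube_embedding[OF K]) (rule that)
  obtain e' where e': "homeomorphism K (e ` K) e e'" using homeomorphism_compact[OF K e(1) refl e(2)] by blast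
  define \<delta> where "\<delta> b i = digit_series (1/2) (\<lambda>j. b (prod_encode (i, j)))" for b and i :: nat
  have \<delta>: "continuous_on UNIV \<delta>"
    unfolding \<delta>_def
    by (intro continuous_on_coordinatewise_then_product continuous_on_compose2[OF continuous_on_digit_series]
        continuous_on_product_coordinates) auto
  have "e ` K \<subseteq> range \<delta>"
  proof
    fix s assume "s \<in> e ` K"
    then obtain x where "s = e x" by blast
    then have "\<exists>b. digit_series (1/2) b = s i" for i
      using e_bounds[of x i] by (intro ex_binary_expansion) auto
    then obtain d where d: "\<And>i. digit_series (1/2) (d i) = s i" by metis
    have "\<delta> (\<lambda>n. case prod_decode n of (i, j) \<Rightarrow> d i j) = s" by (simp add: \<delta>_def d fun_eq_iff)
    then show "s \<in> range \<delta>" by blast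
  qed
  then have image: "\<delta> ` (\<delta> -` (e ` K)) = e ` K" by (simp add: image_vimage_eq inf_absorb1)
  show ?thesis
  proof (rule that)
    have "closed (e ` K)" using e K by (intro compact_imp_closed compact_continuous_image)
    then have "closed (\<delta> -` (e ` K))" using \<delta> by (simp add: continuous_on_closed_vimage)
    then show "compact (\<delta> -` (e ` K))"
      using compact_Int_closed[OF compact_UNIV_bool_fun] by fastforce
    show "continuous_on (\<delta> -` (e ` K)) (e' \<circ> \<delta>)"
      using e' \<delta> image by (intro continuous_on_compose) (auto simp: homeomorphism_def intro: continuous_on_subset)
    show "(e' \<circ> \<delta>) ` (\<delta> -` (e ` K)) = K"
      using e' image by (metis homeomorphism_def image_comp)
  qed
qed

text \<open>This transfers Helly's selection theorem from the real line to compact metric spaces.\<close>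

lemma compact_image_of_compact_real:
  fixes K :: "'a::metric_space set"
  assumes "compact K"
  obtains C :: "real set" and \<pi> :: "real \<Rightarrow> 'a"
  where "compact C" "continuous_on C \<pi>" "\<pi> ` C = K"
proof -
  obtain S :: "(nat \<Rightarrow> bool) set" and \<pi> :: "(nat \<Rightarrow> bool) \<Rightarrow> 'a"
    where S: "compact S" and \<pi>: "continuous_on S \<pi>" "\<pi> ` S = K"
    using compact_image_of_Cantor_space[OF assms] by blast
  let ?\<iota> = "digit_series (1/3)"
  have cont: "continuous_on S ?\<iota>" by (rule continuous_on_subset[OF continuous_on_digit_series]) auto
  moreover have "inj_on ?\<iota> S" by (rule inj_on_subset[OF inj_digit_series]) auto
  ultimately obtain \<kappa> where \<kappa>: "homeomorphism S (?\<iota> ` S) ?\<iota> \<kappa>"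
    using homeomorphism_compact[OF S _ refl] by blast
  show ?thesis
  proof (rule that)
    show "compact (?\<iota> ` S)" by (rule compact_continuous_image[OF cont S])
    show "continuous_on (?\<iota> ` S) (\<pi> \<circ> \<kappa>)"
      using \<kappa> \<pi>(1) by (intro continuous_on_compose) (auto simp: homeomorphism_def)
    show "(\<pi> \<circ> \<kappa>) ` (?\<iota> ` S) = K"
      using \<kappa> \<pi>(2) by (metis homeomorphism_def image_comp)
  qed
qed

section \<open>Probability measures on compact metric spaces\<close>

definition borel_probability_on :: "'a::topological_space set \<Rightarrow> 'a measure \<Rightarrow> bool" where
  "borel_probability_on K \<nu> \<longleftrightarrow> prob_space \<nu> \<and> sets \<nu> = sets (restrict_space borel K)"

lemma prob_space_borel_probability_on: "borel_probability_on K \<nu> \<Longrightarrow> prob_space \<nu>"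
  and sets_borel_probability_on: "borel_probability_on K \<nu> \<Longrightarrow> sets \<nu> = sets (restrict_space borel K)"
  by (simp_all add: borel_probability_on_def)

lemma space_borel_probability_on: "borel_probability_on K \<nu> \<Longrightarrow> space \<nu> = K"
  using sets_eq_imp_space_eq[OF sets_borel_probability_on] by (fastforce simp: space_restrict_space)

lemma borel_measurable_borel_probability_on:
  fixes f :: "'a::topological_space \<Rightarrow> 'b::topological_space"
  assumes "borel_probability_on K \<nu>" "continuous_on K f"
  shows "f \<in> borel_measurable \<nu>"
  using borel_measurable_continuous_on_restrict[OF assms(2)] sets_borel_probability_on[OF assms(1)]
  by (simp cong: measurable_cong_sets)

lemma continuous_on_compact_bounded:
  fixes f :: "'a::topological_space \<Rightarrow> 'b::real_normed_vector"
  assumes "compact K" "continuous_on K f"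
  obtains B where "0 \<le> B" "\<And>x. x \<in> K \<Longrightarrow> norm (f x) \<le> B"
  using compact_imp_bounded[OF compact_continuous_image[OF assms(2,1)]] unfolding bounded_pos
  by (metis image_eqI less_imp_le)

lemma integrable_borel_probability_on:
  fixes f :: "'a::topological_space \<Rightarrow> real"
  assumes \<nu>: "borel_probability_on K \<nu>" and "compact K" "continuous_on K f"
  shows "integrable \<nu> f"
proof -
  interpret prob_space \<nu> by (rule prob_space_borel_probability_on[OF \<nu>])
  obtain B where "\<And>x. x \<in> K \<Longrightarrow> norm (f x) \<le> B"
    using continuous_on_compact_bounded[OF assms(2,3)] by blast
  then show ?thesis
    using space_borel_probability_on[OF \<nu>] borel_measurable_borel_probability_on[OF \<nu> assms(3)]
    by (intro integrable_const_bound[where B=B] AE_I2) auto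
qed

lemma tight_if_AE_mem_compact:
  assumes \<mu>: "\<And>n. real_distribution (\<mu> n)" and C: "compact C" "\<And>n. AE x in \<mu> n. x \<in> C"
  shows "tight \<mu>"
  unfolding tight_def
proof (intro conjI allI impI \<mu>)
  fix \<epsilon> :: real assume "\<epsilon> > 0"
  obtain b where b: "b > 0" "\<And>x. x \<in> C \<Longrightarrow> \<bar>x\<bar> \<le> b"
    using compact_imp_bounded[OF C(1)] by (auto simp: bounded_pos)
  have "measure (\<mu> n) {-(b+1)<..b} = 1" for n
  proof -
    interpret real_distribution "\<mu> n" by (rule \<mu>)
    have "AE x in \<mu> n. x \<in> {-(b+1)<..b}"
      using C(2) by eventually_elim (use b in \<open>force simp: abs_le_iff\<close>)
    then show ?thesis by (simp add: prob_eq_1)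
  qed
  then show "\<exists>a b. a < b \<and> (\<forall>n. 1 - \<epsilon> < measure (\<mu> n) {a<..b})"
    using \<open>\<epsilon> > 0\<close> b(1) by (intro exI[of _ "-(b+1)"] exI[of _ b]) auto
qed

lemma weak_conv_imp_AE_mem_closed:
  assumes \<mu>: "\<And>n. real_distribution (\<mu> n)" and M: "real_distribution M" and conv: "weak_conv_m \<mu> M"
    and C: "closed C" "\<And>n. AE x in \<mu> n. x \<in> C"
  shows "AE x in M. x \<in> C"
proof -
  interpret real_distribution M by (rule M)
  have "C \<noteq> {}"
  proof
    assume "C = {}"
    then have "AE x in \<mu> 0. False" using C(2)[of 0] by simp
    then show False using prob_space.AE_False real_distribution.axioms(1)[OF \<mu>] by blast
  qed
  let ?d = "\<lambda>x. min 1 (infdist x C)"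
  have cont: "continuous_on UNIV ?d" by (intro continuous_intros)
  have bounded: "norm (?d x) \<le> 1" for x using infdist_nonneg[of x C] by auto
  have "(\<lambda>n. \<integral>x. ?d x \<partial>\<mu> n) \<longlonglongrightarrow> (\<integral>x. ?d x \<partial>M)"
    using cont bounded by (intro weak_conv_imp_integral_bdd_continuous_conv[OF \<mu> M conv])
      (auto simp: continuous_on_eq_continuous_at)
  moreover have "(\<integral>x. ?d x \<partial>\<mu> n) = 0" for n
    using C(2)[of n] by (intro integral_eq_zero_AE) (auto elim: eventually_mono)
  ultimately have "(\<integral>x. ?d x \<partial>M) = 0" by (simp add: LIMSEQ_const_iff)
  moreover have "integrable M ?d"
    using bounded borel_measurable_continuous_onI[OF cont] by (intro integrable_const_bound[where B=1] AE_I2) auto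
  moreover have "AE x in M. 0 \<le> ?d x" by (intro AE_I2) (auto simp: infdist_nonneg)
  ultimately have "AE x in M. ?d x = 0" by (simp only: integral_nonneg_eq_0_iff_AE)
  then show ?thesis
    by eventually_elim (use C(1) \<open>C \<noteq> {}\<close> in \<open>auto simp: in_closed_iff_infdist_zero min_def split: if_splits\<close>)
qed

lemma integral_restrict_space_AE_mem:
  fixes f g :: "'a \<Rightarrow> real"
  assumes C: "C \<in> sets M" "AE x in M. x \<in> C" and g: "g \<in> borel_measurable M" "\<And>x. x \<in> C \<Longrightarrow> f x = g x"
  shows "(\<integral>x. f x \<partial>restrict_space M C) = (\<integral>x. g x \<partial>M)"
proof -
  have "(\<integral>x. f x \<partial>restrict_space M C) = (\<integral>x. g x \<partial>restrict_space M C)"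
    using g(2) by (intro Bochner_Integration.integral_cong) (auto simp: space_restrict_space)
  also have "\<dots> = (\<integral>x. indicator C x *\<^sub>R g x \<partial>M)"
    using C(1) by (intro integral_restrict_space) (simp add: sets.Int_space_eq2)
  also have "\<dots> = (\<integral>x. g x \<partial>M)"
  proof (rule integral_cong_AE)
    show "(\<lambda>x. indicator C x *\<^sub>R g x) \<in> borel_measurable M"
      by (intro borel_measurable_scaleR borel_measurable_indicator C g)
    show "AE x in M. indicator C x *\<^sub>R g x = g x" using C(2) by eventually_elim simp
  qed (rule g)
  finally show ?thesis .
qed

lemma pmf_weak_conv_subsequence:
  fixes p :: "nat \<Rightarrow> real pmf"
  assumes C: "compact C" and p: "\<And>n. set_pmf (p n) \<subseteq> C"
  obtains r M where "strict_mono (r :: nat \<Rightarrow> nat)" "real_distribution M" "AE x in M. x \<in> C"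
    "\<And>f :: real \<Rightarrow> real. continuous_on UNIV f \<Longrightarrow> bounded (range f) \<Longrightarrow>
      (\<lambda>n. measure_pmf.expectation (p (r n)) f) \<longlonglongrightarrow> (\<integral>x. f x \<partial>M)"
proof -
  define \<mu> where "\<mu> n = distr (measure_pmf (p n)) borel (\<lambda>x. x)" for n
  have \<mu>: "real_distribution (\<mu> n)" for n
    unfolding \<mu>_def by (intro prob_space.real_distribution_distr measure_pmf.prob_space_axioms) simp
  have AE_\<mu>: "AE x in \<mu> n. x \<in> C" for n
    unfolding \<mu>_def using C p[of n] by (subst AE_distr_iff) (auto intro!: AE_pmfI simp: borel_compact)
  have tight: "tight \<mu>" by (rule tight_if_AE_mem_compact[OF \<mu> C AE_\<mu>])
  obtain r M where r: "strict_mono (r :: nat \<Rightarrow> nat)" and M: "real_distribution M"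
    and conv: "weak_conv_m (\<mu> \<circ> r) M"
    using tight_imp_convergent_subsubsequence[OF tight strict_mono_id] by auto
  show ?thesis
  proof (rule that[OF r M])
    show "AE x in M. x \<in> C"
    proof (rule weak_conv_imp_AE_mem_closed[OF _ M conv compact_imp_closed[OF C]])
      show "real_distribution ((\<mu> \<circ> r) n)" "AE x in (\<mu> \<circ> r) n. x \<in> C" for n
        unfolding o_apply by (rule \<mu> AE_\<mu>)+
    qed
    fix f :: "real \<Rightarrow> real" assume f: "continuous_on UNIV f" and "bounded (range f)"
    then obtain B where "\<And>x. norm (f x) \<le> B" unfolding bounded_iff by auto
    with f have "(\<lambda>n. \<integral>x. f x \<partial>(\<mu> \<circ> r) n) \<longlonglongrightarrow> (\<integral>x. f x \<partial>M)"
      by (intro weak_conv_imp_integral_bdd_continuous_conv[OF _ M conv])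
        (auto simp: \<mu> continuous_on_eq_continuous_at)
    then show "(\<lambda>n. measure_pmf.expectation (p (r n)) f) \<longlonglongrightarrow> (\<integral>x. f x \<partial>M)"
      using borel_measurable_continuous_onI[OF f] by (simp add: \<mu>_def integral_distr)
  qed
qed

lemma pmf_weak_limit_real:
  fixes p :: "nat \<Rightarrow> real pmf"
  assumes C: "compact C" and p: "\<And>n. set_pmf (p n) \<subseteq> C"
  obtains r \<nu> where "strict_mono (r :: nat \<Rightarrow> nat)" "borel_probability_on C \<nu>"
    "\<And>f :: real \<Rightarrow> real. continuous_on C f \<Longrightarrow>
      (\<lambda>n. measure_pmf.expectation (p (r n)) f) \<longlonglongrightarrow> (\<integral>x. f x \<partial>\<nu>)"
proof -
  obtain r M where r: "strict_mono (r :: nat \<Rightarrow> nat)" and M: "real_distribution M" and AE_M: "AE x in M. x \<in> C"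
    and lim: "\<And>f :: real \<Rightarrow> real. continuous_on UNIV f \<Longrightarrow> bounded (range f) \<Longrightarrow>
      (\<lambda>n. measure_pmf.expectation (p (r n)) f) \<longlonglongrightarrow> (\<integral>x. f x \<partial>M)"
    by (rule pmf_weak_conv_subsequence[where p = p, OF C p]) (assumption | rule that)+
  interpret M: real_distribution M by (rule M)
  have C_sets: "C \<in> sets M" using C by (simp add: borel_compact)
  show ?thesis
  proof (rule that[OF r, of "restrict_space M C"])
    show "borel_probability_on C (restrict_space M C)"
      unfolding borel_probability_on_def using AE_M C_sets
      by (intro conjI prob_space_restrict_space sets_restrict_space_cong) (simp_all add: M.emeasure_eq_1_AE)
    fix f :: "real \<Rightarrow> real" assume f: "continuous_on C f"
    obtain B where B: "0 \<le> B" "\<And>x. x \<in> C \<Longrightarrow> norm (f x) \<le> B"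
      using continuous_on_compact_bounded[OF C f] by blast
    obtain g where g: "continuous_on UNIV g" "\<And>x. x \<in> C \<Longrightarrow> g x = f x" "\<And>x. norm (g x) \<le> B"
      using Tietze[OF f _ B, of UNIV] C by (auto simp: compact_imp_closed)
    have "measure_pmf.expectation (p n) g = measure_pmf.expectation (p n) f" for n
      using g(2) p[of n] by (intro integral_cong_AE) (auto intro: AE_pmfI)
    moreover have "(\<integral>x. f x \<partial>restrict_space M C) = (\<integral>x. g x \<partial>M)"
      using C_sets AE_M g(2) borel_measurable_continuous_onI[OF g(1)]
      by (intro integral_restrict_space_AE_mem) simp_all
    ultimately show "(\<lambda>n. measure_pmf.expectation (p (r n)) f) \<longlonglongrightarrow> (\<integral>x. f x \<partial>restrict_space M C)"
      using lim[OF g(1)] g(3) by (simp add: bounded_iff) blast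
  qed
qed

lemma pmf_weak_limit:
  fixes K :: "'a::metric_space set" and p :: "nat \<Rightarrow> 'a pmf"
  assumes K: "compact K" and p: "\<And>n. set_pmf (p n) \<subseteq> K"
  obtains r \<nu> where "strict_mono (r :: nat \<Rightarrow> nat)" "borel_probability_on K \<nu>"
    "\<And>f :: 'a \<Rightarrow> real. continuous_on K f \<Longrightarrow>
      (\<lambda>n. measure_pmf.expectation (p (r n)) f) \<longlonglongrightarrow> (\<integral>x. f x \<partial>\<nu>)"
proof -
  obtain C :: "real set" and \<pi> :: "real \<Rightarrow> 'a"
    where C: "compact C" and \<pi>: "continuous_on C \<pi>" "\<pi> ` C = K"
    using compact_image_of_compact_real[OF K] by blast
  define \<sigma> where "\<sigma> = inv_into C \<pi>"
  have \<sigma>: "\<sigma> x \<in> C" "\<pi> (\<sigma> x) = x" if "x \<in> K" for x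
    using that \<pi>(2) unfolding \<sigma>_def by (auto simp: inv_into_into f_inv_into_f)
  have "set_pmf (map_pmf \<sigma> (p n)) \<subseteq> C" for n using p[of n] \<sigma> by auto
  then obtain r \<nu> where r: "strict_mono (r :: nat \<Rightarrow> nat)" and \<nu>: "borel_probability_on C \<nu>"
    and lim: "\<And>f :: real \<Rightarrow> real. continuous_on C f \<Longrightarrow>
      (\<lambda>n. measure_pmf.expectation (map_pmf \<sigma> (p (r n))) f) \<longlonglongrightarrow> (\<integral>x. f x \<partial>\<nu>)"
    using pmf_weak_limit_real[OF C, of "\<lambda>n. map_pmf \<sigma> (p n)"] by blast
  have \<pi>_meas: "\<pi> \<in> measurable \<nu> (restrict_space borel K)"
    using \<pi> space_borel_probability_on[OF \<nu>]
    by (intro measurable_restrict_space2 borel_measurable_borel_probability_on[OF \<nu>]) auto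
  show ?thesis
  proof (rule that[OF r, of "distr \<nu> (restrict_space borel K) \<pi>"])
    show "borel_probability_on K (distr \<nu> (restrict_space borel K) \<pi>)"
      unfolding borel_probability_on_def
      using prob_space.prob_space_distr[OF prob_space_borel_probability_on[OF \<nu>] \<pi>_meas] by simp
    fix f :: "'a \<Rightarrow> real" assume f: "continuous_on K f"
    have "(\<lambda>n. measure_pmf.expectation (map_pmf \<sigma> (p (r n))) (f \<circ> \<pi>)) \<longlonglongrightarrow> (\<integral>x. (f \<circ> \<pi>) x \<partial>\<nu>)"
      using f \<pi> by (intro lim continuous_on_compose) auto
    moreover have "measure_pmf.expectation (map_pmf \<sigma> (p (r n))) (f \<circ> \<pi>) = measure_pmf.expectation (p (r n)) f" for n
      unfolding integral_map_pmf using \<sigma> p[of "r n"] by (intro integral_cong_AE) (auto intro!: AE_pmfI)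
    moreover have "(\<integral>x. f x \<partial>distr \<nu> (restrict_space borel K) \<pi>) = (\<integral>x. (f \<circ> \<pi>) x \<partial>\<nu>)"
      using f \<pi>_meas by (simp add: integral_distr borel_measurable_continuous_on_restrict)
    ultimately show "(\<lambda>n. measure_pmf.expectation (p (r n)) f) \<longlonglongrightarrow>
        (\<integral>x. f x \<partial>distr \<nu> (restrict_space borel K) \<pi>)" by simp
  qed
qed

section \<open>Minimax duality\<close>

text \<open>Blackwell's approachability strategy: always answer the accumulated sums \<open>s\<close> by a point at which
  \<open>h\<close> is dominated by \<open>- t * (\<Sum>i<n. s i * f i)\<close>. This replaces a separation argument in
  dimension \<open>n\<close>.\<close>

lemma approachability:
  fixes f :: "nat \<Rightarrow> 'a \<Rightarrow> real" and h :: "'a \<Rightarrow> real" and b t :: real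
  assumes f_bound: "\<And>i x. i < n \<Longrightarrow> x \<in> K \<Longrightarrow> \<bar>f i x\<bar> \<le> b"
    and dom: "\<And>\<alpha>. \<exists>x\<in>K. h x \<le> (\<Sum>i<n. \<alpha> i * f i x)" and t: "t > 0"
  obtains k :: "nat \<Rightarrow> 'a" where "\<And>m. k m \<in> K"
    "\<And>N. (\<Sum>i<n. (\<Sum>m<N. f i (k m))\<^sup>2) + 2 / t * (\<Sum>m<N. h (k m)) \<le> real N * (n * b\<^sup>2)"
proof -
  obtain X where X: "\<And>\<alpha>. X \<alpha> \<in> K" "\<And>\<alpha>. h (X \<alpha>) \<le> (\<Sum>i<n. \<alpha> i * f i (X \<alpha>))"
    using dom by metis
  define S where "S = rec_nat (\<lambda>i. 0) (\<lambda>m s i. s i + f i (X (\<lambda>i. - t * s i)))"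
  define k where "k m = X (\<lambda>i. - t * S m i)" for m
  have S: "S N i = (\<Sum>m<N. f i (k m))" for N i
    by (induction N) (auto simp: S_def k_def)
  have k: "k m \<in> K" for m by (simp add: k_def X)
  have "(\<Sum>i<n. (S N i)\<^sup>2) + 2 / t * (\<Sum>m<N. h (k m)) \<le> real N * (n * b\<^sup>2)" for N
  proof (induction N)
    case 0
    show ?case by (simp add: S)
  next
    case (Suc N)
    let ?\<Delta> = "\<Sum>i<n. S N i * f i (k N)"
    have "h (k N) \<le> (\<Sum>i<n. - t * S N i * f i (k N))"
      using X(2)[of "\<lambda>i. - t * S N i"] by (simp add: k_def)
    also have "\<dots> = - t * ?\<Delta>" by (simp add: sum_distrib_left mult.assoc)
    finally have "2 / t * h (k N) \<le> 2 / t * (- t * ?\<Delta>)" using t by (intro mult_left_mono) auto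
    then have cross_term: "2 / t * h (k N) \<le> - 2 * ?\<Delta>" using t by simp
    have "(\<Sum>i<n. (f i (k N))\<^sup>2) \<le> (\<Sum>i<n. b\<^sup>2)"
      using f_bound[OF _ k[of N]] by (intro sum_mono) (metis abs_ge_zero lessThan_iff power2_abs power_mono)
    then have square_term: "(\<Sum>i<n. (f i (k N))\<^sup>2) \<le> n * b\<^sup>2" by simp
    have "(\<Sum>i<n. (S (Suc N) i)\<^sup>2) = (\<Sum>i<n. (S N i)\<^sup>2 + 2 * (S N i * f i (k N)) + (f i (k N))\<^sup>2)"
      by (intro sum.cong) (auto simp: S power2_eq_square algebra_simps)
    also have "\<dots> = (\<Sum>i<n. (S N i)\<^sup>2) + 2 * ?\<Delta> + (\<Sum>i<n. (f i (k N))\<^sup>2)"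
      by (simp add: sum.distrib sum_distrib_left)
    finally show ?case using Suc cross_term square_term by (simp add: algebra_simps)
  qed
  then show ?thesis using that[of k] k by (simp add: S)
qed

lemma expectation_empirical_pmf:
  fixes f :: "'a \<Rightarrow> real" and N :: nat
  assumes "N > 0"
  shows "measure_pmf.expectation (map_pmf k (pmf_of_set {..<N})) f = (\<Sum>m<N. f (k m)) / N"
  using assms by (simp add: integral_pmf_of_set lessThan_empty_iff)

lemma approximately_annihilating_pmf:
  fixes f :: "nat \<Rightarrow> 'a \<Rightarrow> real" and h :: "'a \<Rightarrow> real" and b B \<epsilon> :: real
  assumes f_bound: "\<And>i x. i < n \<Longrightarrow> x \<in> K \<Longrightarrow> \<bar>f i x\<bar> \<le> b"
    and h_bound: "\<And>x. x \<in> K \<Longrightarrow> \<bar>h x\<bar> \<le> B"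
    and dom: "\<And>\<alpha>. \<exists>x\<in>K. h x \<le> (\<Sum>i<n. \<alpha> i * f i x)" and \<epsilon>: "\<epsilon> > 0"
  obtains p where "set_pmf p \<subseteq> K" "measure_pmf.expectation p h \<le> \<epsilon>"
    "\<And>i. i < n \<Longrightarrow> \<bar>measure_pmf.expectation p (f i)\<bar> \<le> \<epsilon>"
proof -
  define Q where "Q = n * b\<^sup>2"
  define t where "t = \<epsilon> / (Q + 1)"
  have Q: "0 \<le> Q" by (simp add: Q_def)
  have t: "0 < t" "Q * t / 2 \<le> \<epsilon>" using \<epsilon> Q by (auto simp: t_def field_simps)
  obtain k where k: "\<And>m. k m \<in> K" and
    main: "\<And>N. (\<Sum>i<n. (\<Sum>m<N. f i (k m))\<^sup>2) + 2 / t * (\<Sum>m<N. h (k m)) \<le> real N * Q"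
    using approachability[of n K f b h t] f_bound dom t unfolding Q_def by blast
  obtain N :: nat where N: "real N > (Q + 2 / t * B) / \<epsilon>\<^sup>2" "N > 0"
    using reals_Archimedean2[of "max 0 ((Q + 2 / t * B) / \<epsilon>\<^sup>2)"] by auto
  let ?p = "map_pmf k (pmf_of_set {..<N})" and ?F = "\<lambda>i. \<Sum>m<N. f i (k m)" and ?H = "\<Sum>m<N. h (k m)"
  note average = expectation_empirical_pmf[OF N(2)]
  show ?thesis
  proof (rule that[of ?p])
    show "set_pmf ?p \<subseteq> K" using k by auto
    have "2 / t * ?H \<le> real N * Q"
      using main[of N] sum_nonneg[of "{..<n}" "\<lambda>i. (?F i)\<^sup>2"] by simp
    then have "?H / N \<le> Q * t / 2" using t(1) N(2) by (simp add: field_simps)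
    then show "measure_pmf.expectation ?p h \<le> \<epsilon>" using t(2) by (simp only: average)
    fix i assume "i < n"
    have "- ?H \<le> real N * B"
    proof -
      have "\<bar>?H\<bar> \<le> (\<Sum>m<N. B)" using h_bound[OF k] by (intro order.trans[OF sum_abs] sum_mono) auto
      then show ?thesis by (simp add: abs_le_iff)
    qed
    then have "2 / t * (- ?H) \<le> 2 / t * (real N * B)" using t(1) by (intro mult_left_mono) auto
    moreover have "(?F i)\<^sup>2 \<le> (\<Sum>i<n. (?F i)\<^sup>2)"
      using \<open>i < n\<close> by (intro member_le_sum[of i "{..<n}" "\<lambda>i. (?F i)\<^sup>2"]) auto
    ultimately have "(?F i)\<^sup>2 \<le> real N * (Q + 2 / t * B)" using main[of N] by (simp add: algebra_simps)
    also have "\<dots> \<le> real N * (real N * \<epsilon>\<^sup>2)"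
      using N \<epsilon> by (intro mult_left_mono) (auto simp: field_simps)
    also have "\<dots> = (real N * \<epsilon>)\<^sup>2" by (simp add: power2_eq_square algebra_simps)
    finally have "\<bar>?F i\<bar> \<le> real N * \<epsilon>" using \<epsilon> by (simp add: abs_le_square_iff[symmetric])
    then show "\<bar>measure_pmf.expectation ?p (f i)\<bar> \<le> \<epsilon>"
      unfolding average using N(2) by (simp add: field_simps)
  qed
qed

lemma countable_uniformly_dense_step_functions:
  fixes K :: "'a::metric_space set"
  assumes K: "compact K"
  obtains G :: "('a \<Rightarrow> real) set" where "countable G"
    "\<And>f \<epsilon>. continuous_on K f \<Longrightarrow> \<epsilon> > 0 \<Longrightarrow> \<exists>g\<in>G. \<forall>x\<in>K. \<bar>f x - g x\<bar> < \<epsilon>"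
proof -
  obtain net :: "nat \<Rightarrow> 'a list" and near :: "nat \<Rightarrow> 'a \<Rightarrow> nat" where net: "\<And>m. set (net m) \<subseteq> K"
    and near: "\<And>m x. x \<in> K \<Longrightarrow> near m x < length (net m)"
      "\<And>m x. x \<in> K \<Longrightarrow> dist (net m ! near m x) x < inverse (Suc m)"
    by (rule compact_finite_nets[OF K]) (rule that)
  define step :: "nat \<times> nat \<times> int list \<Rightarrow> 'a \<Rightarrow> real"
    where "step = (\<lambda>(m, n, l) x. real_of_int (l ! near m x) / Suc n)"
  show ?thesis
  proof (rule that)
    show "countable (range step)" by simp
    fix f :: "'a \<Rightarrow> real" and \<epsilon> :: real assume f: "continuous_on K f" and \<epsilon>: "\<epsilon> > 0"
    obtain n where n: "inverse (Suc n) < \<epsilon> / 2" using reals_Archimedean[of "\<epsilon> / 2"] \<epsilon> by auto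
    obtain d where d: "d > 0" "\<And>x y. x \<in> K \<Longrightarrow> y \<in> K \<Longrightarrow> dist y x < d \<Longrightarrow> dist (f y) (f x) < \<epsilon> / 2"
      using compact_uniformly_continuous[OF f K] \<epsilon> unfolding uniformly_continuous_on_def by (meson half_gt_zero)
    obtain m where m: "inverse (Suc m) < d" using reals_Archimedean[OF d(1)] by auto
    let ?g = "step (m, n, map (\<lambda>y. \<lfloor>Suc n * f y\<rfloor>) (net m))"
    have "\<bar>f x - ?g x\<bar> < \<epsilon>" if "x \<in> K" for x
    proof -
      define y where "y = net m ! near m x"
      have "y \<in> K" unfolding y_def using net nth_mem[OF near(1)[OF that]] by blast
      then have "\<bar>f y - f x\<bar> < \<epsilon> / 2"
        using d(2)[OF that, of y] near(2)[OF that, of m] m by (simp add: y_def dist_real_def)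
      moreover have "\<bar>f y - ?g x\<bar> \<le> inverse (Suc n)"
      proof -
        have "?g x = \<lfloor>Suc n * f y\<rfloor> / Suc n" using near(1)[OF that, of m] by (simp add: step_def y_def)
        then have "f y - ?g x = (Suc n * f y - \<lfloor>Suc n * f y\<rfloor>) / Suc n" by (simp add: diff_divide_distrib)
        moreover have "\<bar>Suc n * f y - \<lfloor>Suc n * f y\<rfloor>\<bar> \<le> 1" by linarith
        ultimately show ?thesis by (simp add: inverse_eq_divide divide_right_mono)
      qed
      ultimately show ?thesis using n by linarith
    qed
    then show "\<exists>g\<in>range step. \<forall>x\<in>K. \<bar>f x - g x\<bar> < \<epsilon>" by blast
  qed
qed

lemma countable_uniformly_dense_subfamily:
  fixes K :: "'a::metric_space set" and V :: "('a \<Rightarrow> real) set"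
  assumes K: "compact K" and V: "\<And>f. f \<in> V \<Longrightarrow> continuous_on K f"
  obtains D where "countable D" "D \<subseteq> V"
    "\<And>f \<epsilon>. f \<in> V \<Longrightarrow> \<epsilon> > 0 \<Longrightarrow> \<exists>d\<in>D. \<forall>x\<in>K. \<bar>f x - d x\<bar> < \<epsilon>"
proof -
  obtain G :: "('a \<Rightarrow> real) set" where G: "countable G"
    "\<And>f \<epsilon>. continuous_on K f \<Longrightarrow> \<epsilon> > 0 \<Longrightarrow> \<exists>g\<in>G. \<forall>x\<in>K. \<bar>f x - g x\<bar> < \<epsilon>"
    using countable_uniformly_dense_step_functions[OF K] by blast
  define near where "near = (\<lambda>(g, n) f. f \<in> V \<and> (\<forall>x\<in>K. \<bar>f x - g x\<bar> < inverse (real (Suc n))))"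
  define I where "I = {i \<in> G \<times> UNIV. \<exists>f. near i f}"
  have pick: "near i (Eps (near i))" if i: "i \<in> I" for i
  proof -
    obtain f where "near i f" using i by (auto simp: I_def)
    then show ?thesis by (rule someI[of "near i"])
  qed
  show ?thesis
  proof (rule that)
    have "countable I" unfolding I_def by (rule countable_subset[OF _ countable_SIGMA[OF G(1)]]) auto
    then show "countable ((\<lambda>i. Eps (near i)) ` I)" by simp
    show "(\<lambda>i. Eps (near i)) ` I \<subseteq> V" using pick by (force simp: near_def)
    fix f \<epsilon> assume f: "f \<in> V" and \<epsilon>: "(\<epsilon> :: real) > 0"
    obtain n where n: "inverse (Suc n) < \<epsilon> / 2" using reals_Archimedean[of "\<epsilon> / 2"] \<epsilon> by auto
    obtain g where g: "g \<in> G" "\<And>x. x \<in> K \<Longrightarrow> \<bar>f x - g x\<bar> < inverse (Suc n)"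
      using G(2)[OF V[OF f], of "inverse (Suc n)"] by auto
    then have I: "(g, n) \<in> I" using f by (auto simp: I_def near_def)
    have "\<bar>f x - Eps (near (g, n)) x\<bar> < \<epsilon>" if "x \<in> K" for x
    proof -
      have "\<bar>Eps (near (g, n)) x - g x\<bar> < inverse (Suc n)" using pick[OF I] that by (simp add: near_def)
      then show ?thesis using g(2)[OF that] n by linarith
    qed
    with I show "\<exists>d\<in>(\<lambda>i. Eps (near i)) ` I. \<forall>x\<in>K. \<bar>f x - d x\<bar> < \<epsilon>" by blast
  qed
qed

lemma integral_eq_0_if_uniform_limit:
  fixes f :: "'a::topological_space \<Rightarrow> real"
  assumes \<nu>: "borel_probability_on K \<nu>" and K: "compact K" and f: "continuous_on K f"
    and approx: "\<And>\<epsilon>. \<epsilon> > 0 \<Longrightarrow> \<exists>d. continuous_on K d \<and> (\<integral>x. d x \<partial>\<nu>) = 0 \<and> (\<forall>x\<in>K. \<bar>f x - d x\<bar> < \<epsilon>)"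
  shows "(\<integral>x. f x \<partial>\<nu>) = 0"
proof -
  interpret prob_space \<nu> by (rule prob_space_borel_probability_on[OF \<nu>])
  note intg = integrable_borel_probability_on[OF \<nu> K]
  have "\<bar>\<integral>x. f x \<partial>\<nu>\<bar> \<le> \<epsilon>" if \<epsilon>: "\<epsilon> > 0" for \<epsilon>
  proof -
    obtain d where d: "continuous_on K d" "(\<integral>x. d x \<partial>\<nu>) = 0" "\<forall>x\<in>K. \<bar>f x - d x\<bar> < \<epsilon>"
      using approx[OF \<epsilon>] by blast
    have "\<bar>\<integral>x. f x \<partial>\<nu>\<bar> = \<bar>\<integral>x. f x - d x \<partial>\<nu>\<bar>"
      using d(2) by (simp add: Bochner_Integration.integral_diff intg f d(1))
    also have "\<dots> \<le> (\<integral>x. \<bar>f x - d x\<bar> \<partial>\<nu>)" by (rule integral_abs_bound)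
    also have "\<dots> \<le> \<epsilon>"
      using d(3) space_borel_probability_on[OF \<nu>]
      by (intro integral_le_const AE_I2 intg continuous_intros f d(1)) auto
    finally show ?thesis .
  qed
  from this[of "\<bar>\<integral>x. f x \<partial>\<nu>\<bar> / 2"] show ?thesis by linarith
qed

lemma annihilating_probability_sequence:
  fixes K :: "'a::metric_space set" and F :: "nat \<Rightarrow> 'a \<Rightarrow> real"
  assumes K: "compact K" and F: "\<And>i. continuous_on K (F i)" and h: "continuous_on K h"
    and dom: "\<And>n \<alpha>. \<exists>x\<in>K. h x \<le> (\<Sum>i<n. \<alpha> i * F i x)"
  obtains \<nu> where "borel_probability_on K \<nu>" "\<And>i. (\<integral>x. F i x \<partial>\<nu>) = 0" "(\<integral>x. h x \<partial>\<nu>) \<le> 0"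
proof -
  have "\<forall>n. \<exists>p. set_pmf p \<subseteq> K \<and> measure_pmf.expectation p h \<le> inverse (Suc n) \<and>
      (\<forall>i<n. \<bar>measure_pmf.expectation p (F i)\<bar> \<le> inverse (Suc n))"
  proof
    fix n
    have "\<exists>B. \<forall>x\<in>K. norm (F i x) \<le> B" for i
      using continuous_on_compact_bounded[OF K F[of i]] by metis
    then obtain b where b: "\<And>i x. x \<in> K \<Longrightarrow> norm (F i x) \<le> b i" by metis
    have F_bound: "\<bar>F i x\<bar> \<le> (\<Sum>i<n. \<bar>b i\<bar>)" if "i < n" "x \<in> K" for i x
      using b[OF that(2), of i] member_le_sum[of i "{..<n}" "\<lambda>i. \<bar>b i\<bar>"] that by simp
    obtain B where "\<And>x. x \<in> K \<Longrightarrow> norm (h x) \<le> B" using continuous_on_compact_bounded[OF K h] by blast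
    then have h_bound: "\<bar>h x\<bar> \<le> B" if "x \<in> K" for x using that by simp
    obtain p where "set_pmf p \<subseteq> K" "measure_pmf.expectation p h \<le> inverse (Suc n)"
      "\<And>i. i < n \<Longrightarrow> \<bar>measure_pmf.expectation p (F i)\<bar> \<le> inverse (Suc n)"
      using approximately_annihilating_pmf[of n K F _ h B "inverse (Suc n)"] F_bound h_bound dom by auto
    then show "\<exists>p. set_pmf p \<subseteq> K \<and> measure_pmf.expectation p h \<le> inverse (Suc n) \<and>
        (\<forall>i<n. \<bar>measure_pmf.expectation p (F i)\<bar> \<le> inverse (Suc n))"
      by (intro exI conjI) auto
  qed
  from choice[OF this] obtain p where p: "\<And>n. set_pmf (p n) \<subseteq> K" "\<And>n. measure_pmf.expectation (p n) h \<le> inverse (Suc n)"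
    "\<And>n i. i < n \<Longrightarrow> \<bar>measure_pmf.expectation (p n) (F i)\<bar> \<le> inverse (Suc n)" by blast
  obtain r \<nu> where r: "strict_mono (r :: nat \<Rightarrow> nat)" and \<nu>: "borel_probability_on K \<nu>"
    and lim: "\<And>f :: 'a \<Rightarrow> real. continuous_on K f \<Longrightarrow>
      (\<lambda>n. measure_pmf.expectation (p (r n)) f) \<longlonglongrightarrow> (\<integral>x. f x \<partial>\<nu>)"
    by (rule pmf_weak_limit[OF K p(1)]) (rule that)
  have null: "(\<lambda>n. inverse (real (Suc (r n)))) \<longlonglongrightarrow> 0"
    using LIMSEQ_subseq_LIMSEQ[OF LIMSEQ_inverse_real_of_nat r] by (simp add: o_def)
  show ?thesis
  proof (rule that[OF \<nu>])
    show "(\<integral>x. h x \<partial>\<nu>) \<le> 0" by (rule LIMSEQ_le[OF lim[OF h] null]) (use p(2) in blast)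
    fix i
    have "i < n \<Longrightarrow> norm (measure_pmf.expectation (p (r n)) (F i)) \<le> inverse (real (Suc (r n)))" for n
      using p(3)[of i "r n"] seq_suble[OF r, of n] by simp
    then have "\<forall>\<^sub>F n in sequentially. norm (measure_pmf.expectation (p (r n)) (F i)) \<le> inverse (real (Suc (r n)))"
      by (rule eventually_mono[OF eventually_gt_at_top])
    from Lim_null_comparison[OF this null] show "(\<integral>x. F i x \<partial>\<nu>) = 0"
      by (rule LIMSEQ_unique[OF lim[OF F]])
  qed
qed

lemma annihilating_probability:
  fixes K :: "'a::metric_space set" and V :: "('a \<Rightarrow> real) set"
  assumes K: "compact K" and V: "V \<noteq> {}" "\<And>f. f \<in> V \<Longrightarrow> continuous_on K f"
      "\<And>f g a b. f \<in> V \<Longrightarrow> g \<in> V \<Longrightarrow> \<exists>k\<in>V. \<forall>x\<in>K. k x = a * f x + b * g x"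
    and h: "continuous_on K h" and dom: "\<And>f. f \<in> V \<Longrightarrow> \<exists>x\<in>K. h x \<le> f x"
  obtains \<nu> where "borel_probability_on K \<nu>" "\<And>f. f \<in> V \<Longrightarrow> (\<integral>x. f x \<partial>\<nu>) = 0" "(\<integral>x. h x \<partial>\<nu>) \<le> 0"
proof -
  obtain D where D: "countable D" "D \<subseteq> V" and
    dense: "\<And>f \<epsilon>. f \<in> V \<Longrightarrow> \<epsilon> > 0 \<Longrightarrow> \<exists>d\<in>D. \<forall>x\<in>K. \<bar>f x - d x\<bar> < \<epsilon>"
    using countable_uniformly_dense_subfamily[OF K V(2)] by blast
  have "D \<noteq> {}" using dense[OF _ zero_less_one] V(1) by blast
  define F where "F = from_nat_into D"
  have F: "F i \<in> V" for i unfolding F_def using from_nat_into[OF \<open>D \<noteq> {}\<close>] D(2) by blast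
  have "\<exists>k\<in>V. \<forall>x\<in>K. k x = (\<Sum>i<n. \<alpha> i * F i x)" for \<alpha> and n :: nat
  proof (induction n)
    case 0
    show ?case using V(3)[OF F F, of 0 _ 0] by simp
  next
    case (Suc n)
    then obtain k where k: "k \<in> V" "\<And>x. x \<in> K \<Longrightarrow> k x = (\<Sum>i<n. \<alpha> i * F i x)" by blast
    then show ?case using V(3)[OF k(1) F, of 1 "\<alpha> n" n] by simp
  qed
  then have "\<exists>x\<in>K. h x \<le> (\<Sum>i<n. \<alpha> i * F i x)" for \<alpha> and n :: nat using dom by metis
  then obtain \<nu> where \<nu>: "borel_probability_on K \<nu>" and F_0: "\<And>i. (\<integral>x. F i x \<partial>\<nu>) = 0"
    and h_le: "(\<integral>x. h x \<partial>\<nu>) \<le> 0"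
    by (rule annihilating_probability_sequence[OF K V(2)[OF F] h]) (rule that)
  have "(\<integral>x. f x \<partial>\<nu>) = 0" if f: "f \<in> V" for f
  proof (rule integral_eq_0_if_uniform_limit[OF \<nu> K V(2)[OF f]])
    fix \<epsilon> :: real assume "\<epsilon> > 0"
    then obtain d where d: "d \<in> D" "\<forall>x\<in>K. \<bar>f x - d x\<bar> < \<epsilon>" using dense[OF f] by blast
    obtain i where "d = F i" using from_nat_into_surj[OF D(1) d(1)] by (auto simp: F_def)
    then show "\<exists>d. continuous_on K d \<and> (\<integral>x. d x \<partial>\<nu>) = 0 \<and> (\<forall>x\<in>K. \<bar>f x - d x\<bar> < \<epsilon>)"
      using V(2)[OF F] F_0 d(2) by blast
  qed
  from \<nu> this h_le show ?thesis by (rule that)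
qed

section \<open>Functions of class \<open>C\<^sup>1\<close>\<close>

lemma linear_eq_sum_Basis:
  fixes f :: "'a::euclidean_space \<Rightarrow> 'b::real_vector"
  assumes "linear f"
  shows "f v = (\<Sum>b\<in>Basis. (v \<bullet> b) *\<^sub>R f b)"
proof -
  have "f v = f (\<Sum>b\<in>Basis. (v \<bullet> b) *\<^sub>R b)" by (simp add: euclidean_representation)
  then show ?thesis using assms by (simp add: linear_sum linear_scale)
qed

definition gradient :: "('a::euclidean_space \<Rightarrow> real) \<Rightarrow> 'a \<Rightarrow> 'a" where
  "gradient f x = (\<Sum>b\<in>Basis. frechet_derivative f (at x) b *\<^sub>R b)"

lemma has_derivative_gradient:
  assumes "f differentiable (at x)"
  shows "(f has_derivative (\<lambda>h. gradient f x \<bullet> h)) (at x)"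
proof -
  have D: "(f has_derivative frechet_derivative f (at x)) (at x)"
    using assms by (simp add: frechet_derivative_works)
  have "frechet_derivative f (at x) h = gradient f x \<bullet> h" for h
    unfolding linear_eq_sum_Basis[OF has_derivative_linear[OF D], of h]
    by (simp add: gradient_def inner_sum_left inner_commute[of h] mult.commute)
  then have "frechet_derivative f (at x) = (\<lambda>h. gradient f x \<bullet> h)" by blast
  with D show ?thesis by (simp only:)
qed

lemma gradient_eqI:
  assumes "(f has_derivative (\<lambda>h. p \<bullet> h)) (at x)"
  shows "gradient f x = p"
  unfolding gradient_def frechet_derivative_at[OF assms, symmetric] by (rule euclidean_representation)

lemma Ck_on_1I:
  fixes f :: "'a::real_normed_vector \<Rightarrow> 'b::real_normed_vector"
  assumes D: "\<And>x. x \<in> S \<Longrightarrow> (f has_derivative f' x) (at x)" and cont: "\<And>h. continuous_on S (\<lambda>x. f' x h)"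
  shows "Ck_on 1 S f"
proof -
  have "continuous_on S (\<lambda>x. frechet_derivative f (at x) h)" for h
    using cont[of h] by (rule continuous_on_eq) (simp add: frechet_derivative_at[OF D, symmetric])
  then show ?thesis using D by (auto simp: differentiable_def)
qed

lemma Ck_on_1_differentiable: "Ck_on 1 S f \<Longrightarrow> x \<in> S \<Longrightarrow> f differentiable (at x)"
  and continuous_on_frechet_derivative_const: "Ck_on 1 S f \<Longrightarrow> continuous_on S (\<lambda>x. frechet_derivative f (at x) h)"
  by simp_all

lemma Ck_on_1_has_derivative:
  "Ck_on 1 S f \<Longrightarrow> x \<in> S \<Longrightarrow> (f has_derivative frechet_derivative f (at x)) (at x)"
  by (simp add: frechet_derivative_works)

lemmas Ck_on_1_has_gradient = has_derivative_gradient[OF Ck_on_1_differentiable]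

lemma continuous_on_frechet_derivative:
  fixes f :: "'a::euclidean_space \<Rightarrow> 'b::real_normed_vector"
  assumes f: "Ck_on 1 S f" and x: "continuous_on T x" "x ` T \<subseteq> S" and v: "continuous_on T v"
  shows "continuous_on T (\<lambda>t. frechet_derivative f (at (x t)) (v t))"
proof -
  have "continuous_on T (\<lambda>t. \<Sum>b\<in>Basis. (v t \<bullet> b) *\<^sub>R frechet_derivative f (at (x t)) b)"
    by (intro continuous_intros v continuous_on_compose2[OF continuous_on_frechet_derivative_const[OF f] x])
  then show ?thesis
  proof (rule continuous_on_eq)
    fix t assume "t \<in> T"
    then have "linear (frechet_derivative f (at (x t)))"
      using Ck_on_1_has_derivative[OF f] x(2) by (blast intro: has_derivative_linear)
    from linear_eq_sum_Basis[OF this, of "v t"]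
    show "(\<Sum>b\<in>Basis. (v t \<bullet> b) *\<^sub>R frechet_derivative f (at (x t)) b) = frechet_derivative f (at (x t)) (v t)"
      by (rule sym)
  qed
qed

lemma continuous_on_gradient: "Ck_on 1 S f \<Longrightarrow> continuous_on S (gradient f)"
  unfolding gradient_def[abs_def] by (intro continuous_intros continuous_on_frechet_derivative_const)

lemma Ck_on_1_imp_continuous_on: "Ck_on 1 S f \<Longrightarrow> continuous_on S f"
  by (intro continuous_at_imp_continuous_on ballI differentiable_imp_continuous_within Ck_on_1_differentiable)

lemma Ck_on_1_subset: "Ck_on 1 T f \<Longrightarrow> S \<subseteq> T \<Longrightarrow> Ck_on 1 S f"
  by (auto intro: continuous_on_subset)

lemma Ck_on_1_cong:
  assumes g: "Ck_on 1 U g" and U: "open U" and eq: "\<And>x. x \<in> U \<Longrightarrow> f x = g x"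
  shows "Ck_on 1 U f"
proof (rule Ck_on_1I)
  show "(f has_derivative frechet_derivative g (at x)) (at x)" if "x \<in> U" for x
    by (rule has_derivative_transform_within_open[OF Ck_on_1_has_derivative[OF g that] U that]) (simp add: eq)
  show "continuous_on U (\<lambda>x. frechet_derivative g (at x) h)" for h
    by (rule continuous_on_frechet_derivative_const[OF g])
qed

lemma Ck_on_1_locally:
  assumes local: "\<And>x. x \<in> S \<Longrightarrow> \<exists>U. open U \<and> x \<in> U \<and> Ck_on 1 U f"
  shows "Ck_on 1 S f"
proof (rule Ck_on_1I)
  show "(f has_derivative frechet_derivative f (at x)) (at x)" if "x \<in> S" for x
    using local[OF that] Ck_on_1_has_derivative by blast
  show "continuous_on S (\<lambda>x. frechet_derivative f (at x) h)" for h
  proof (intro continuous_at_imp_continuous_on ballI)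
    fix x assume "x \<in> S"
    then obtain U where "open U" "x \<in> U" "Ck_on 1 U f" using local by blast
    then show "isCont (\<lambda>x. frechet_derivative f (at x) h) x"
      using continuous_on_frechet_derivative_const continuous_on_eq_continuous_at by blast
  qed
qed

lemma Ck_on_1_compose:
  fixes f :: "'b::euclidean_space \<Rightarrow> 'c::real_normed_vector" and \<tau> :: "'a::euclidean_space \<Rightarrow> 'b"
  assumes f: "Ck_on 1 T f" and \<tau>: "Ck_on 1 S \<tau>" "\<tau> ` S \<subseteq> T"
  shows "Ck_on 1 S (\<lambda>x. f (\<tau> x))"
proof (rule Ck_on_1I)
  show "((\<lambda>x. f (\<tau> x)) has_derivative
      (\<lambda>h. frechet_derivative f (at (\<tau> x)) (frechet_derivative \<tau> (at x) h))) (at x)" if "x \<in> S" for x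
    using that \<tau>(2)
    by (intro has_derivative_compose[OF Ck_on_1_has_derivative[OF \<tau>(1)] Ck_on_1_has_derivative[OF f]]) auto
  show "continuous_on S (\<lambda>x. frechet_derivative f (at (\<tau> x)) (frechet_derivative \<tau> (at x) h))" for h
    by (intro continuous_on_frechet_derivative[OF f] Ck_on_1_imp_continuous_on \<tau>
        continuous_on_frechet_derivative_const[OF \<tau>(1)])
qed

lemma Ck_on_1_const: "Ck_on 1 S (\<lambda>x. k)"
  by (rule Ck_on_1I[where f' = "\<lambda>x h. 0"]) auto

lemma has_gradient_combination:
  assumes "f differentiable (at x)" "g differentiable (at x)"
  shows "((\<lambda>x. a * f x + b * g x) has_derivative (\<lambda>h. (a *\<^sub>R gradient f x + b *\<^sub>R gradient g x) \<bullet> h)) (at x)"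
proof -
  have "((\<lambda>x. a * f x + b * g x) has_derivative (\<lambda>h. a * (gradient f x \<bullet> h) + b * (gradient g x \<bullet> h))) (at x)"
    by (intro has_derivative_add has_derivative_mult_right has_derivative_gradient assms)
  then show ?thesis by (simp add: inner_add_left)
qed

lemmas gradient_combination = gradient_eqI[OF has_gradient_combination]

lemma Ck_on_1_combination:
  fixes f g :: "'a::euclidean_space \<Rightarrow> real"
  assumes "Ck_on 1 S f" "Ck_on 1 S g"
  shows "Ck_on 1 S (\<lambda>x. a * f x + b * g x)"
proof (rule Ck_on_1I)
  show "((\<lambda>x. a * f x + b * g x) has_derivative (\<lambda>h. (a *\<^sub>R gradient f x + b *\<^sub>R gradient g x) \<bullet> h)) (at x)"
    if "x \<in> S" for x
    using that by (intro has_gradient_combination Ck_on_1_differentiable[OF assms(1)] Ck_on_1_differentiable[OF assms(2)])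
  show "continuous_on S (\<lambda>x. (a *\<^sub>R gradient f x + b *\<^sub>R gradient g x) \<bullet> h)" for h
    by (intro continuous_intros continuous_on_gradient assms)
qed

lemma Ck_on_1_mult:
  assumes f: "Ck_on 1 S f" and g: "Ck_on 1 S g"
  shows "Ck_on 1 S (\<lambda>x. f x * g x :: real)"
proof (rule Ck_on_1I)
  show "((\<lambda>x. f x * g x) has_derivative
      (\<lambda>h. f x * frechet_derivative g (at x) h + frechet_derivative f (at x) h * g x)) (at x)" if "x \<in> S" for x
    by (rule has_derivative_mult[OF Ck_on_1_has_derivative[OF f that] Ck_on_1_has_derivative[OF g that]])
  show "continuous_on S (\<lambda>x. f x * frechet_derivative g (at x) h + frechet_derivative f (at x) h * g x)" for h
    by (intro continuous_intros Ck_on_1_imp_continuous_on continuous_on_frechet_derivative_const f g)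
qed

lemma has_gradient_dist_squared:
  fixes z :: "'a::real_inner"
  shows "((\<lambda>x. (dist x z)\<^sup>2) has_derivative (\<lambda>h. (2 *\<^sub>R (x - z)) \<bullet> h)) (at x)"
  unfolding dist_norm power2_norm_eq_inner by (auto intro!: derivative_eq_intros simp: inner_commute)

lemmas gradient_dist_squared = gradient_eqI[OF has_gradient_dist_squared]

lemma Ck_on_1_dist_squared:
  fixes z :: "'a::real_inner"
  shows "Ck_on 1 S (\<lambda>x. (dist x z)\<^sup>2)"
  by (rule Ck_on_1I[OF has_gradient_dist_squared]) (intro continuous_intros)

lemma has_derivative_pos_part_squared:
  "((\<lambda>t::real. (max 0 t)\<^sup>2) has_real_derivative 2 * max 0 t) (at t)"
proof (cases t "0 :: real" rule: linorder_cases)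
  case less
  have "((\<lambda>t::real. 0) has_real_derivative 2 * max 0 t) (at t)"
    using less by (simp add: max_def)
  then show ?thesis
    by (rule has_field_derivative_transform_within_open[of _ _ _ "{..<0}"]) (use less in \<open>auto simp: max_def\<close>)
next
  case equal
  have "(\<lambda>h::real. (max 0 h)\<^sup>2 / h) \<midarrow>0\<rightarrow> 0"
  proof (rule Lim_null_comparison)
    show "\<forall>\<^sub>F h in at 0. norm ((max 0 h)\<^sup>2 / h) \<le> \<bar>h::real\<bar>"
      by (intro always_eventually allI) (auto simp: max_def power2_eq_square)
    show "(\<lambda>h. \<bar>h::real\<bar>) \<midarrow>0\<rightarrow> 0" by (intro tendsto_rabs_zero tendsto_ident_at)
  qed
  then show ?thesis using equal by (simp add: DERIV_def)
next
  case greater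
  have "((\<lambda>t::real. t\<^sup>2) has_real_derivative 2 * max 0 t) (at t)"
    using greater by (auto intro!: derivative_eq_intros simp: max_def)
  then show ?thesis
    by (rule has_field_derivative_transform_within_open[of _ _ _ "{0<..}"]) (use greater in \<open>auto simp: max_def\<close>)
qed

lemma Ck_on_1_pos_part_squared:
  fixes f :: "'a::euclidean_space \<Rightarrow> real"
  assumes "Ck_on 1 S f"
  shows "Ck_on 1 S (\<lambda>x. (max 0 (f x))\<^sup>2)"
proof (rule Ck_on_1_compose[OF _ assms subset_UNIV])
  show "Ck_on 1 UNIV (\<lambda>t::real. (max 0 t)\<^sup>2)"
  proof (rule Ck_on_1I)
    show "((\<lambda>t::real. (max 0 t)\<^sup>2) has_derivative (\<lambda>h. 2 * max 0 t * h)) (at t)" for t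
      using has_derivative_pos_part_squared[of t] by (simp add: has_field_derivative_def)
    show "continuous_on UNIV (\<lambda>t::real. 2 * max 0 t * h)" for h by (intro continuous_intros)
  qed
qed

lemma C1_bump_function:
  fixes z :: "'a::euclidean_space"
  assumes r: "r > 0"
  obtains \<eta> :: "'a \<Rightarrow> real" where "Ck_on 1 UNIV \<eta>"
    "\<And>x. dist x z \<le> r \<Longrightarrow> \<eta> x = 1" "\<And>x. 2 * r \<le> dist x z \<Longrightarrow> \<eta> x = 0"
proof
  define \<tau> where "\<tau> x = 1 / r\<^sup>2 * (dist x z)\<^sup>2 + - 1 * 1" for x
  define \<sigma> where "\<sigma> x = 1 * 1 + - 1 * (max 0 (\<tau> x))\<^sup>2" for x
  show "Ck_on 1 UNIV (\<lambda>x. (max 0 (\<sigma> x))\<^sup>2)"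
    unfolding \<sigma>_def \<tau>_def
    by (intro Ck_on_1_pos_part_squared Ck_on_1_combination Ck_on_1_const Ck_on_1_dist_squared)
  fix x
  have \<tau>: "\<tau> x = (dist x z / r)\<^sup>2 - 1" by (simp add: \<tau>_def power_divide)
  show "(max 0 (\<sigma> x))\<^sup>2 = 1" if "dist x z \<le> r"
  proof -
    have "(dist x z / r)\<^sup>2 \<le> 1" using that r by (intro power_le_one) auto
    then show ?thesis by (simp add: \<sigma>_def \<tau>)
  qed
  show "(max 0 (\<sigma> x))\<^sup>2 = 0" if "2 * r \<le> dist x z"
  proof -
    have "2\<^sup>2 \<le> (dist x z / r)\<^sup>2" using that r by (intro power_mono) (auto simp: field_simps)
    then have "1 \<le> (max 0 (\<tau> x))\<^sup>2" by (intro one_le_power) (simp add: \<tau>)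
    then show ?thesis by (simp add: \<sigma>_def)
  qed
qed

section \<open>Families of convex superlinear functions\<close>

lemma convex_on_scaleR_le_max:
  fixes h :: "'e::real_vector \<Rightarrow> real"
  assumes "convex_on UNIV h" "0 \<le> s" "s \<le> 1"
  shows "h (s *\<^sub>R p) \<le> max (h 0) (h p)"
proof -
  have "h ((1 - s) *\<^sub>R 0 + s *\<^sub>R p) \<le> (1 - s) * h 0 + s * h p"
    using assms by (intro convex_onD) auto
  also have "\<dots> \<le> max (h 0) (h p)" using assms by (intro convex_bound_le) auto
  finally show ?thesis by simp
qed

lemma sublevels_uniformly_bounded:
  fixes H :: "'a::metric_space \<Rightarrow> 'e::euclidean_space \<Rightarrow> real"
  assumes P: "compact P" and cont: "continuous_on (P \<times> UNIV) (\<lambda>(z, p). H z p)"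
    and cvx: "\<And>z. z \<in> P \<Longrightarrow> convex_on UNIV (H z)"
    and ray: "\<And>z q C. z \<in> P \<Longrightarrow> q \<noteq> 0 \<Longrightarrow> \<exists>t\<ge>0. C < H z (t *\<^sub>R q)"
  shows "\<exists>B. \<forall>z\<in>P. \<forall>p. H z p \<le> a \<longrightarrow> norm p \<le> B"
proof (rule ccontr)
  assume "\<not> ?thesis"
  then have "\<forall>n. \<exists>z p. z \<in> P \<and> H z p \<le> a \<and> real n < norm p" by (meson not_le)
  then obtain z p where z: "\<And>n. z n \<in> P" and p: "\<And>n. H (z n) (p n) \<le> a" "\<And>n. real n < norm (p n)"
    by metis
  have "continuous_on P (\<lambda>z. case (z, 0) of (z, p) \<Rightarrow> H z p)"
    by (rule continuous_on_compose2[OF cont]) (auto intro!: continuous_intros)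
  then obtain M where M: "\<And>z. z \<in> P \<Longrightarrow> norm (H z 0) \<le> M"
    using continuous_on_compact_bounded[OF P, of "\<lambda>z. H z 0"] by auto
  have ray_bound: "H (z n) (t *\<^sub>R sgn (p n)) \<le> max M a" if "0 \<le> t" "t \<le> real n" for n t
  proof -
    have "H (z n) ((t / norm (p n)) *\<^sub>R p n) \<le> max (H (z n) 0) (H (z n) (p n))"
      using that p(2)[of n] by (intro convex_on_scaleR_le_max cvx z) (auto simp: divide_le_eq_1)
    then show ?thesis using M[OF z[of n]] p(1)[of n] by (simp add: sgn_div_norm divide_inverse)
  qed
  have "p n \<noteq> 0" for n using p(2)[of n] by auto
  then have "\<forall>n. (z n, sgn (p n)) \<in> P \<times> sphere 0 1" using z by (simp add: norm_sgn)
  with compact_imp_seq_compact[OF compact_Times[OF P compact_sphere[of 0 1]]]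
  obtain l r where l: "l \<in> P \<times> sphere 0 1" and r: "strict_mono (r :: nat \<Rightarrow> nat)"
    and lim: "((\<lambda>n. (z n, sgn (p n))) \<circ> r) \<longlonglongrightarrow> l"
    by (rule seq_compactE)
  obtain z' e where l_eq: "l = (z', e)" by (cases l)
  have z': "z' \<in> P" and e: "e \<noteq> 0" using l by (auto simp: l_eq)
  have "H z' (t *\<^sub>R e) \<le> max M a" if "t \<ge> 0" for t
  proof (rule LIMSEQ_le_const2)
    have "(\<lambda>n. (z (r n), t *\<^sub>R sgn (p (r n)))) \<longlonglongrightarrow> (z', t *\<^sub>R e)"
      using tendsto_fst[OF lim] tendsto_snd[OF lim] by (intro tendsto_intros) (simp_all add: l_eq o_def)
    from continuous_on_tendsto_compose[OF cont this]
    show "(\<lambda>n. H (z (r n)) (t *\<^sub>R sgn (p (r n)))) \<longlonglongrightarrow> H z' (t *\<^sub>R e)" using z z' by simp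
    have "t \<le> real (r n)" if "n \<ge> nat \<lceil>t\<rceil>" for n
      using that seq_suble[OF r, of n] by linarith
    then show "\<exists>N. \<forall>n\<ge>N. H (z (r n)) (t *\<^sub>R sgn (p (r n))) \<le> max M a"
      using ray_bound[OF \<open>0 \<le> t\<close>] by blast
  qed
  then show False using ray[OF z' e, of "max M a"] by force
qed

definition ray_superlinear :: "('e::real_vector \<Rightarrow> real) \<Rightarrow> bool" where
  "ray_superlinear h \<longleftrightarrow> (\<forall>q C. q \<noteq> 0 \<longrightarrow> (\<exists>t\<ge>1. C * t < h (t *\<^sub>R q)))"

lemma ray_superlinear_diff_inner:
  fixes h :: "'e::real_inner \<Rightarrow> real"
  assumes "ray_superlinear h" "q \<noteq> 0"
  shows "\<exists>t\<ge>0. C < h (t *\<^sub>R q) - (t *\<^sub>R q) \<bullet> v"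
proof -
  obtain t where t: "t \<ge> 1" "(\<bar>C\<bar> + q \<bullet> v) * t < h (t *\<^sub>R q)"
    using assms unfolding ray_superlinear_def by blast
  have "C \<le> \<bar>C\<bar> * 1" by simp
  also have "\<dots> \<le> \<bar>C\<bar> * t" using t(1) by (intro mult_left_mono) auto
  finally show ?thesis using t by (intro exI[of _ t]) (auto simp: algebra_simps)
qed

lemma ray_superlinear_sublevels_bounded:
  fixes H :: "'a::metric_space \<Rightarrow> 'e::euclidean_space \<Rightarrow> real"
  assumes "compact P" "continuous_on (P \<times> UNIV) (\<lambda>(z, p). H z p)"
    "\<And>z. z \<in> P \<Longrightarrow> convex_on UNIV (H z)" "\<And>z. z \<in> P \<Longrightarrow> ray_superlinear (H z)"
  shows "\<exists>B. \<forall>z\<in>P. \<forall>p. H z p \<le> a \<longrightarrow> norm p \<le> B"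
  using assms(1-3)
proof (rule sublevels_uniformly_bounded)
  show "\<exists>t\<ge>0. C < H z (t *\<^sub>R q)" if "z \<in> P" "q \<noteq> 0" for z q C
    using ray_superlinear_diff_inner[OF assms(4)[OF that(1)] that(2), of C 0] by simp
qed

definition fenchel_conjugate :: "('e::real_inner \<Rightarrow> real) \<Rightarrow> 'e \<Rightarrow> real" where
  "fenchel_conjugate h v = (SUP p. p \<bullet> v - h p)"

lemma fenchel_conjugate_maximizers_bounded:
  fixes H :: "'a::metric_space \<Rightarrow> 'e::euclidean_space \<Rightarrow> real"
  assumes P: "compact P" and W: "compact W" and cont: "continuous_on (P \<times> UNIV) (\<lambda>(z, p). H z p)"
    and cvx: "\<And>z. z \<in> P \<Longrightarrow> convex_on UNIV (H z)" and superlin: "\<And>z. z \<in> P \<Longrightarrow> ray_superlinear (H z)"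
  obtains B where "0 \<le> B" "\<And>z v p. z \<in> P \<Longrightarrow> v \<in> W \<Longrightarrow> H z p - p \<bullet> v \<le> H z 0 \<Longrightarrow> norm p \<le> B"
proof -
  have "continuous_on P (\<lambda>z. case (z, 0) of (z, p) \<Rightarrow> H z p)"
    by (rule continuous_on_compose2[OF cont]) (auto intro!: continuous_intros)
  then obtain M where M: "\<And>z. z \<in> P \<Longrightarrow> norm (H z 0) \<le> M"
    using continuous_on_compact_bounded[OF P, of "\<lambda>z. H z 0"] by auto
  have "\<exists>B. \<forall>w\<in>P \<times> W. \<forall>p. H (fst w) p - p \<bullet> snd w \<le> M \<longrightarrow> norm p \<le> B"
  proof (rule sublevels_uniformly_bounded)
    show "compact (P \<times> W)" using P W by (rule compact_Times)
    have "continuous_on ((P \<times> W) \<times> UNIV) (\<lambda>x. case (fst (fst x), snd x) of (z, p) \<Rightarrow> H z p)"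
      by (rule continuous_on_compose2[OF cont]) (auto intro!: continuous_intros)
    then show "continuous_on ((P \<times> W) \<times> UNIV) (\<lambda>(w, p). H (fst w) p - p \<bullet> snd w)"
      unfolding case_prod_beta by (intro continuous_intros) simp
    show "convex_on UNIV (\<lambda>p. H (fst w) p - p \<bullet> snd w)" if "w \<in> P \<times> W" for w
    proof (rule convex_onI)
      fix t :: real and p q :: 'e assume "0 < t" "t < 1"
      then have "H (fst w) ((1 - t) *\<^sub>R p + t *\<^sub>R q) \<le> (1 - t) * H (fst w) p + t * H (fst w) q"
        using that by (intro convex_onD[OF cvx]) auto
      then show "H (fst w) ((1 - t) *\<^sub>R p + t *\<^sub>R q) - ((1 - t) *\<^sub>R p + t *\<^sub>R q) \<bullet> snd w
          \<le> (1 - t) * (H (fst w) p - p \<bullet> snd w) + t * (H (fst w) q - q \<bullet> snd w)"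
        by (simp add: inner_add_left algebra_simps)
    qed simp
    show "\<exists>t\<ge>0. C < H (fst w) (t *\<^sub>R q) - (t *\<^sub>R q) \<bullet> snd w" if "w \<in> P \<times> W" "q \<noteq> 0" for w q C
      using that by (intro ray_superlinear_diff_inner superlin) auto
  qed
  then obtain B where B: "\<And>z v p. z \<in> P \<Longrightarrow> v \<in> W \<Longrightarrow> H z p - p \<bullet> v \<le> M \<Longrightarrow> norm p \<le> B"
    by (metis SigmaI fst_conv snd_conv)
  show ?thesis
  proof (rule that[of "\<bar>B\<bar>"])
    fix z v p assume z: "z \<in> P" and v: "v \<in> W" and sublevel: "H z p - p \<bullet> v \<le> H z 0"
    have "H z p - p \<bullet> v \<le> M" using sublevel M[OF z] by simp
    then show "norm p \<le> \<bar>B\<bar>" using B[OF z v] by fastforce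
  qed simp
qed

lemma
  fixes h :: "'e::euclidean_space \<Rightarrow> real"
  assumes cont: "continuous_on UNIV h" and B: "0 \<le> B" "\<And>p. h p - p \<bullet> v \<le> h 0 \<Longrightarrow> norm p \<le> B"
  shows bdd_above_fenchel_conjugate_if: "bdd_above (range (\<lambda>p. p \<bullet> v - h p))"
    and fenchel_conjugate_eq_SUP_cball: "fenchel_conjugate h v = (SUP p\<in>cball 0 B. p \<bullet> v - h p)"
proof -
  let ?S = "SUP p\<in>cball 0 B. p \<bullet> v - h p"
  have "compact ((\<lambda>p. p \<bullet> v - h p) ` cball 0 B)"
    by (intro compact_continuous_image continuous_intros continuous_on_subset[OF cont]) auto
  then have bdd: "bdd_above ((\<lambda>p. p \<bullet> v - h p) ` cball 0 B)"
    by (intro bounded_imp_bdd_above compact_imp_bounded)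
  have on_ball: "p \<bullet> v - h p \<le> ?S" if "norm p \<le> B" for p
    using that by (intro cSUP_upper bdd) simp
  have global: "p \<bullet> v - h p \<le> ?S" for p
  proof (cases "norm p \<le> B")
    case False
    then have "\<not> h p - p \<bullet> v \<le> h 0" using B(2) by blast
    then show ?thesis using on_ball[of 0] B(1) by simp
  qed (rule on_ball)
  then show bdd': "bdd_above (range (\<lambda>p. p \<bullet> v - h p))" by (intro bdd_aboveI[of _ ?S]) auto
  have "?S \<le> fenchel_conjugate h v"
    unfolding fenchel_conjugate_def using B(1) by (intro cSUP_subset_mono bdd') auto
  moreover have "fenchel_conjugate h v \<le> ?S" unfolding fenchel_conjugate_def by (intro cSUP_least global) auto
  ultimately show "fenchel_conjugate h v = ?S" by simp
qed

lemma bdd_above_fenchel_conjugate: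
  fixes h :: "'e::euclidean_space \<Rightarrow> real"
  assumes cont: "continuous_on UNIV h" and "convex_on UNIV h" "ray_superlinear h"
  shows "bdd_above (range (\<lambda>p. p \<bullet> v - h p))"
proof -
  have "continuous_on ({0::real} \<times> UNIV) (\<lambda>(z, p). h p)"
    unfolding case_prod_beta by (intro continuous_on_compose2[OF cont] continuous_intros) auto
  then obtain B where "0 \<le> B"
    "\<And>z w p. z \<in> {0::real} \<Longrightarrow> w \<in> {v} \<Longrightarrow> h p - p \<bullet> w \<le> h 0 \<Longrightarrow> norm p \<le> B"
    by (rule fenchel_conjugate_maximizers_bounded[OF compact_sing compact_sing]) (rule assms that)+
  then show ?thesis by (intro bdd_above_fenchel_conjugate_if[OF cont]) auto
qed

lemma fenchel_young:
  fixes h :: "'e::euclidean_space \<Rightarrow> real"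
  assumes "continuous_on UNIV h" "convex_on UNIV h" "ray_superlinear h"
  shows "p \<bullet> v - h p \<le> fenchel_conjugate h v"
  unfolding fenchel_conjugate_def by (intro cSUP_upper bdd_above_fenchel_conjugate assms) auto

lemma continuous_on_SUP_compact:
  fixes f :: "'a::metric_space \<times> 'b::metric_space \<Rightarrow> real"
  assumes P: "compact P" and K: "compact K" "K \<noteq> {}" and f: "continuous_on (P \<times> K) f"
  shows "continuous_on P (\<lambda>x. SUP y\<in>K. f (x, y))"
  unfolding continuous_on_iff
proof (intro ballI allI impI)
  fix x and \<epsilon> :: real assume x: "x \<in> P" and \<epsilon>: "\<epsilon> > 0"
  have bdd: "bdd_above ((\<lambda>y. f (x, y)) ` K)" if "x \<in> P" for x
  proof -
    have "continuous_on K (\<lambda>y. f (x, y))"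
      using that by (intro continuous_on_compose2[OF f] continuous_intros) auto
    then show ?thesis using K(1) by (intro bounded_imp_bdd_above compact_imp_bounded compact_continuous_image)
  qed
  have "uniformly_continuous_on (P \<times> K) f" using P K f by (intro compact_uniformly_continuous compact_Times)
  then obtain d where d: "d > 0"
    "\<And>w w'. w \<in> P \<times> K \<Longrightarrow> w' \<in> P \<times> K \<Longrightarrow> dist w' w < d \<Longrightarrow> dist (f w') (f w) < \<epsilon> / 2"
    unfolding uniformly_continuous_on_def using \<epsilon> by (meson half_gt_zero)
  have close: "(SUP y\<in>K. f (x, y)) \<le> (SUP y\<in>K. f (x', y)) + \<epsilon> / 2"
    if "x \<in> P" "x' \<in> P" "dist x' x < d" for x x'
  proof (rule cSUP_least[OF K(2)])
    fix y assume y: "y \<in> K"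
    have "dist (f (x', y)) (f (x, y)) < \<epsilon> / 2" using that y by (intro d(2)) (auto simp: dist_Pair_Pair)
    moreover have "f (x', y) \<le> (SUP y\<in>K. f (x', y))" by (rule cSUP_upper[OF y bdd[OF that(2)]])
    ultimately show "f (x, y) \<le> (SUP y\<in>K. f (x', y)) + \<epsilon> / 2"
      unfolding dist_real_def by linarith
  qed
  have "dist (SUP y\<in>K. f (x', y)) (SUP y\<in>K. f (x, y)) < \<epsilon>" if "x' \<in> P" "dist x' x < d" for x'
    using close[OF x that] close[OF that(1) x] that(2) \<epsilon> by (simp add: dist_real_def dist_commute abs_le_iff)
  then show "\<exists>d>0. \<forall>x'\<in>P. dist x' x < d \<longrightarrow> dist (SUP y\<in>K. f (x', y)) (SUP y\<in>K. f (x, y)) < \<epsilon>"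
    using d(1) by blast
qed

lemma continuous_on_fenchel_conjugate:
  fixes H :: "'a::metric_space \<Rightarrow> 'e::euclidean_space \<Rightarrow> real"
  assumes P: "compact P" and W: "compact W" and cont: "continuous_on (P \<times> UNIV) (\<lambda>(z, p). H z p)"
    and cvx: "\<And>z. z \<in> P \<Longrightarrow> convex_on UNIV (H z)" and superlin: "\<And>z. z \<in> P \<Longrightarrow> ray_superlinear (H z)"
  shows "continuous_on (P \<times> W) (\<lambda>(z, v). fenchel_conjugate (H z) v)"
proof -
  obtain B where B: "0 \<le> B" "\<And>z v p. z \<in> P \<Longrightarrow> v \<in> W \<Longrightarrow> H z p - p \<bullet> v \<le> H z 0 \<Longrightarrow> norm p \<le> B"
    by (rule fenchel_conjugate_maximizers_bounded[OF assms]) (assumption | rule that)+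
  have "continuous_on ((P \<times> W) \<times> cball 0 B) (\<lambda>w. case (fst (fst w), snd w) of (z, p) \<Rightarrow> H z p)"
    by (rule continuous_on_compose2[OF cont]) (auto intro!: continuous_intros)
  then have "continuous_on ((P \<times> W) \<times> cball 0 B) (\<lambda>w. snd w \<bullet> snd (fst w) - H (fst (fst w)) (snd w))"
    by (intro continuous_intros) simp
  from continuous_on_SUP_compact[OF compact_Times[OF P W] compact_cball _ this] B(1)
  have "continuous_on (P \<times> W) (\<lambda>w. SUP p\<in>cball 0 B. p \<bullet> snd w - H (fst w) p)" by simp
  then show ?thesis
  proof (rule continuous_on_eq)
    fix w assume w: "w \<in> P \<times> W"
    have "continuous_on UNIV (\<lambda>p. case (fst w, p) of (z, p) \<Rightarrow> H z p)"
      by (rule continuous_on_compose2[OF cont]) (use w in \<open>auto intro!: continuous_intros\<close>)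
    then have "continuous_on UNIV (H (fst w))" by simp
    from fenchel_conjugate_eq_SUP_cball[OF this B(1), of "snd w"] B(2) w
    show "(SUP p\<in>cball 0 B. p \<bullet> snd w - H (fst w) p) = (case w of (z, v) \<Rightarrow> fenchel_conjugate (H z) v)"
      by (auto simp: case_prod_beta)
  qed
qed

section \<open>Subgradients along a segment\<close>

lemma separating_slope:
  fixes h :: "'e::euclidean_space \<Rightarrow> real"
  assumes cvx: "convex_on UNIV h" and S: "convex S" "q \<in> S" and q: "h q \<le> c"
    and above: "\<And>x. x \<in> S \<Longrightarrow> c \<le> h x"
  obtains v where "\<And>x p. x \<in> S \<Longrightarrow> c + v \<bullet> (p - x) \<le> h p"
proof -
  have "convex (S \<times> {..<c})" "convex (epigraph UNIV h)"
    using S cvx by (auto intro: convex_Times convex_epigraphI)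
  moreover have "S \<times> {..<c} \<noteq> {}" "epigraph UNIV h \<noteq> {}" "(S \<times> {..<c}) \<inter> epigraph UNIV h = {}"
    using S above lt_ex[of c] by (fastforce simp: epigraph_def)+
  ultimately obtain a b where a: "a \<noteq> 0" and below: "\<And>w. w \<in> S \<times> {..<c} \<Longrightarrow> a \<bullet> w \<le> b"
    and epigraph: "\<And>w. w \<in> epigraph UNIV h \<Longrightarrow> b \<le> a \<bullet> w"
    using separating_hyperplane_sets[of "S \<times> {..<c}" "epigraph UNIV h"] by blast
  obtain a1 a2 where a_eq: "a = (a1, a2)" by (cases a)
  have sep: "a1 \<bullet> x + a2 * \<sigma> \<le> a1 \<bullet> p + a2 * h p" if "x \<in> S" "\<sigma> < c" for x \<sigma> p
    using below[of "(x, \<sigma>)"] epigraph[of "(p, h p)"] that by (simp add: a_eq epigraph_def)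
  have "a2 * (c - 1) \<le> a2 * h q" using sep[OF S(2), of "c - 1" q] by simp
  moreover have "c \<le> h q" by (rule above[OF S(2)])
  ultimately have "0 \<le> a2" using q by (simp add: algebra_simps)
  moreover have "a2 \<noteq> 0"
  proof
    assume "a2 = 0"
    then have "a1 \<bullet> a1 \<le> 0" using sep[OF S(2), of "c - 1" "q - a1"] by (simp add: inner_diff_right)
    then have "a1 = 0" by (metis inner_eq_zero_iff inner_ge_zero order.antisym)
    with \<open>a2 = 0\<close> a show False by (simp add: a_eq zero_prod_def)
  qed
  ultimately have a2: "a2 > 0" by simp
  define v where "v = - a1 /\<^sub>R a2"
  have inner_a1: "a1 \<bullet> x = - a2 * (v \<bullet> x)" for x using a2 by (simp add: v_def)
  show ?thesis
  proof (rule that, rule field_le_epsilon)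
    fix x p and \<epsilon> :: real assume x: "x \<in> S" and \<epsilon>: "\<epsilon> > 0"
    have "a2 * (c + v \<bullet> (p - x)) \<le> a2 * (h p + \<epsilon>)"
      using sep[OF x, of "c - \<epsilon>" p] \<epsilon> by (simp add: inner_a1 inner_diff_right algebra_simps)
    then show "c + v \<bullet> (p - x) \<le> h p + \<epsilon>" using a2 by simp
  qed
qed

lemma subgradient_along_segment:
  fixes h :: "'e::euclidean_space \<Rightarrow> real"
  assumes cvx: "convex_on UNIV h" and q: "h q \<le> c"
    and seg: "\<And>t. 0 \<le> t \<Longrightarrow> t \<le> 1 \<Longrightarrow> c \<le> h ((1 - t) *\<^sub>R q + t *\<^sub>R e)"
  obtains v where "0 \<le> v \<bullet> (e - q)" "\<And>p. c + v \<bullet> (p - q) \<le> h p"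
proof -
  obtain v where v: "\<And>x p. x \<in> closed_segment q e \<Longrightarrow> c + v \<bullet> (p - x) \<le> h p"
    using separating_slope[OF cvx convex_closed_segment ends_in_segment(1) q] seg by (auto simp: in_segment)
  show ?thesis
  proof (rule that)
    show "0 \<le> v \<bullet> (e - q)" using v[of e q] q by (simp add: inner_diff_right)
    show "c + v \<bullet> (p - q) \<le> h p" for p using v by simp
  qed
qed

lemma fenchel_conjugate_le_if_subgradient:
  assumes "\<And>p. c + v \<bullet> (p - q) \<le> h p"
  shows "fenchel_conjugate h v \<le> v \<bullet> q - c"
  unfolding fenchel_conjugate_def
proof (rule cSUP_least)
  show "p \<bullet> v - h p \<le> v \<bullet> q - c" for p
    using assms[of p] by (simp add: inner_diff_right inner_commute)
qed simp

lemma subgradients_uniformly_bounded: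
  fixes H :: "'a::metric_space \<Rightarrow> 'e::euclidean_space \<Rightarrow> real"
  assumes P: "compact P" and cont: "continuous_on (P \<times> UNIV) (\<lambda>(z, p). H z p)"
    and cvx: "\<And>z. z \<in> P \<Longrightarrow> convex_on UNIV (H z)" and superlin: "\<And>z. z \<in> P \<Longrightarrow> ray_superlinear (H z)"
  shows "\<exists>R. \<forall>z\<in>P. \<forall>q v. H z q \<le> c \<longrightarrow> (\<forall>p. c + v \<bullet> (p - q) \<le> H z p) \<longrightarrow> norm v \<le> R"
proof -
  obtain B where B: "\<And>z p. z \<in> P \<Longrightarrow> H z p \<le> c \<Longrightarrow> norm p \<le> B"
    using ray_superlinear_sublevels_bounded[OF P cont cvx superlin] by blast
  have "continuous_on (P \<times> cball 0 (B + 1)) (\<lambda>(z, p). H z p)"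
    by (rule continuous_on_subset[OF cont]) auto
  from continuous_on_compact_bounded[OF compact_Times[OF P compact_cball] this]
  obtain M where "\<And>w. w \<in> P \<times> cball 0 (B + 1) \<Longrightarrow> norm (case w of (z, p) \<Rightarrow> H z p) \<le> M" by metis
  then have M: "\<bar>H z p\<bar> \<le> M" if "z \<in> P" "norm p \<le> B + 1" for z p
    using that by fastforce
  show ?thesis
  proof (intro exI ballI allI impI)
    fix z q v assume z: "z \<in> P" and q: "H z q \<le> c" and v: "\<forall>p. c + v \<bullet> (p - q) \<le> H z p"
    have "norm (q + sgn v) \<le> B + 1"
      using norm_triangle_ineq[of q "sgn v"] B[OF z q] by (simp add: norm_sgn split: if_splits)
    then have "H z (q + sgn v) \<le> M" using M[OF z] by fastforce
    moreover have "v \<bullet> sgn v = norm v"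
      by (cases "v = 0") (simp_all add: sgn_div_norm dot_square_norm power2_eq_square)
    then have "c + norm v \<le> H z (q + sgn v)" using v[rule_format, of "q + sgn v"] by simp
    ultimately show "norm v \<le> M - c" by simp
  qed
qed

section \<open>Contact segments\<close>

lemma convex_on_ge_beyond:
  fixes h :: "'e::real_vector \<Rightarrow> real"
  assumes cvx: "convex_on UNIV h" and q: "h q \<le> c" and s: "0 < s" "s \<le> t"
    and ge: "c \<le> h ((1 - s) *\<^sub>R q + s *\<^sub>R e)"
  shows "c \<le> h ((1 - t) *\<^sub>R q + t *\<^sub>R e)"
proof -
  let ?x = "(1 - t) *\<^sub>R q + t *\<^sub>R e"
  define a where "a = s / t"
  have a: "0 < a" "a \<le> 1" "a * t = s" using s by (auto simp: a_def)
  have "(1 - s) *\<^sub>R q + s *\<^sub>R e = (1 - a) *\<^sub>R q + a *\<^sub>R ?x"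
    by (simp add: algebra_simps flip: a(3))
  then have "c \<le> h ((1 - a) *\<^sub>R q + a *\<^sub>R ?x)" using ge by simp
  also have "\<dots> \<le> (1 - a) * h q + a * h ?x" using a by (intro convex_onD[OF cvx]) auto
  also have "\<dots> \<le> (1 - a) * c + a * h ?x" using a q by (intro add_right_mono mult_left_mono) auto
  finally have "a * c \<le> a * h ?x" by (simp add: algebra_simps)
  then show ?thesis using a(1) by simp
qed

lemma sublevel_convergent_subsequence:
  fixes H :: "'a::metric_space \<Rightarrow> 'e::euclidean_space \<Rightarrow> real"
  assumes P: "compact P" and H: "continuous_on (P \<times> UNIV) (\<lambda>(z, p). H z p)"
      "\<And>z. z \<in> P \<Longrightarrow> convex_on UNIV (H z)" "\<And>z. z \<in> P \<Longrightarrow> ray_superlinear (H z)"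
    and z: "\<And>n. z n \<in> P" and q: "\<And>n. H (z n) (q n) \<le> c"
  obtains r z' q' where "strict_mono (r :: nat \<Rightarrow> nat)" "z' \<in> P"
    "(\<lambda>n. z (r n)) \<longlonglongrightarrow> z'" "(\<lambda>n. q (r n)) \<longlonglongrightarrow> q'"
proof -
  obtain B where B: "\<And>z p. z \<in> P \<Longrightarrow> H z p \<le> c \<Longrightarrow> norm p \<le> B"
    using ray_superlinear_sublevels_bounded[OF P H] by blast
  have "\<forall>n. (z n, q n) \<in> P \<times> cball 0 B" using z B[OF z q] by simp
  with compact_imp_seq_compact[OF compact_Times[OF P compact_cball[of 0 B]]]
  obtain l r where l: "l \<in> P \<times> cball 0 B" and r: "strict_mono (r :: nat \<Rightarrow> nat)"
    and lim: "((\<lambda>n. (z n, q n)) \<circ> r) \<longlonglongrightarrow> l" by (rule seq_compactE)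
  have "fst l \<in> P" using l by auto
  then show ?thesis
    using r tendsto_fst[OF lim] tendsto_snd[OF lim] by (intro that[of r "fst l" "snd l"]) (simp_all add: o_def)
qed

lemma contact_segment_limit:
  fixes H :: "'a::metric_space \<Rightarrow> 'e::euclidean_space \<Rightarrow> real" and D :: "'a \<Rightarrow> 'e"
  assumes P: "compact P" and H: "continuous_on (P \<times> UNIV) (\<lambda>(z, p). H z p)"
      "\<And>z. z \<in> P \<Longrightarrow> convex_on UNIV (H z)" "\<And>z. z \<in> P \<Longrightarrow> ray_superlinear (H z)"
    and \<alpha>: "continuous_on P \<alpha>" and \<beta>: "continuous_on P \<beta>" and D: "continuous_on P D"
    and contact: "\<And>s. 0 < s \<Longrightarrow> s < 1 \<Longrightarrow> \<exists>z\<in>P. \<exists>q. (\<forall>y\<in>P. \<alpha> y + s * \<beta> y \<le> \<alpha> z + s * \<beta> z) \<and>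
      H z q \<le> c \<and> c \<le> H z ((1 - s) *\<^sub>R q + s *\<^sub>R D z)"
  obtains z q where "z \<in> P" "\<And>y. y \<in> P \<Longrightarrow> \<alpha> y \<le> \<alpha> z" "H z q \<le> c"
    "\<And>t. 0 \<le> t \<Longrightarrow> t \<le> 1 \<Longrightarrow> c \<le> H z ((1 - t) *\<^sub>R q + t *\<^sub>R D z)"
proof -
  define s where "s n = inverse (real (Suc (Suc n)))" for n
  have s: "0 < s n" "s n < 1" for n by (auto simp: s_def field_simps)
  have lim_s: "s \<longlonglongrightarrow> 0" unfolding s_def by (rule LIMSEQ_Suc[OF LIMSEQ_inverse_real_of_nat])
  obtain z q where z: "\<And>n. z n \<in> P"
    and max: "\<And>n y. y \<in> P \<Longrightarrow> \<alpha> y + s n * \<beta> y \<le> \<alpha> (z n) + s n * \<beta> (z n)"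
    and q: "\<And>n. H (z n) (q n) \<le> c" "\<And>n. c \<le> H (z n) ((1 - s n) *\<^sub>R q n + s n *\<^sub>R D (z n))"
    using contact[OF s] by metis
  obtain r z' q' where r: "strict_mono (r :: nat \<Rightarrow> nat)" and z': "z' \<in> P"
    and lim_z: "(\<lambda>n. z (r n)) \<longlonglongrightarrow> z'" and lim_q: "(\<lambda>n. q (r n)) \<longlonglongrightarrow> q'"
    by (rule sublevel_convergent_subsequence[OF P H z q(1)]) (assumption | rule that)+
  have lim_sr: "(\<lambda>n. s (r n)) \<longlonglongrightarrow> 0" using LIMSEQ_subseq_LIMSEQ[OF lim_s r] by (simp add: o_def)
  have lim_comp: "(\<lambda>n. f (z (r n))) \<longlonglongrightarrow> f z'" if "continuous_on P f" for f :: "'a \<Rightarrow> 'b::topological_space"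
    using continuous_on_tendsto_compose[OF that lim_z z'] z by simp
  have lim_H: "(\<lambda>n. H (z (r n)) (p n)) \<longlonglongrightarrow> H z' p'" if "p \<longlonglongrightarrow> p'" for p p'
    using continuous_on_tendsto_compose[OF H(1) tendsto_Pair[OF lim_z that]] z z' by simp
  show ?thesis
  proof (rule that[OF z'])
    fix y assume y: "y \<in> P"
    have "(\<lambda>n. \<alpha> y + s (r n) * \<beta> y) \<longlonglongrightarrow> \<alpha> y + 0 * \<beta> y"
      "(\<lambda>n. \<alpha> (z (r n)) + s (r n) * \<beta> (z (r n))) \<longlonglongrightarrow> \<alpha> z' + 0 * \<beta> z'"
      by (intro tendsto_intros lim_sr lim_comp[OF \<alpha>] lim_comp[OF \<beta>])+
    then show "\<alpha> y \<le> \<alpha> z'" using LIMSEQ_le max[OF y] by fastforce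
  next
    show "H z' q' \<le> c" by (rule LIMSEQ_le_const2[OF lim_H[OF lim_q]]) (use q(1) in blast)
  next
    fix t :: real assume t: "0 \<le> t" "t \<le> 1"
    define T where "T n = max t (s (r n))" for n
    have "T \<longlonglongrightarrow> t" using tendsto_max[OF tendsto_const lim_sr, of t] t by (simp add: T_def[abs_def])
    then have "(\<lambda>n. (1 - T n) *\<^sub>R q (r n) + T n *\<^sub>R D (z (r n))) \<longlonglongrightarrow> (1 - t) *\<^sub>R q' + t *\<^sub>R D z'"
      by (intro tendsto_intros lim_q lim_comp[OF D])
    moreover have "c \<le> H (z (r n)) ((1 - T n) *\<^sub>R q (r n) + T n *\<^sub>R D (z (r n)))" for n
      by (rule convex_on_ge_beyond[OF H(2)[OF z] q(1) s(1) _ q(2)]) (simp add: T_def)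
    ultimately show "c \<le> H z' ((1 - t) *\<^sub>R q' + t *\<^sub>R D z')"
      by (intro LIMSEQ_le_const[OF lim_H]) auto
  qed
qed

section \<open>Doubling of variables\<close>

definition viscosity_subsolution_on ::
  "'e::euclidean_space set \<Rightarrow> ('e \<Rightarrow> 'e \<Rightarrow> real) \<Rightarrow> real \<Rightarrow> ('e \<Rightarrow> real) \<Rightarrow> bool" where
  "viscosity_subsolution_on \<Omega> H c u \<longleftrightarrow> (\<forall>f. Ck_on 1 \<Omega> f \<longrightarrow>
     (\<forall>y\<in>\<Omega>. (\<forall>\<^sub>F x in nhds y. u x - f x \<le> u y - f y) \<longrightarrow> H y (gradient f y) \<le> c))"

definition viscosity_supersolution_on ::
  "'e::euclidean_space set \<Rightarrow> ('e \<Rightarrow> 'e \<Rightarrow> real) \<Rightarrow> real \<Rightarrow> ('e \<Rightarrow> real) \<Rightarrow> bool" where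
  "viscosity_supersolution_on \<Omega> H c u \<longleftrightarrow> (\<forall>f. Ck_on 1 \<Omega> f \<longrightarrow>
     (\<forall>y\<in>\<Omega>. (\<forall>\<^sub>F x in nhds y. u y - f y \<le> u x - f x) \<longrightarrow> c \<le> H y (gradient f y)))"

text \<open>The term \<open>(dist x z)\<^sup>2\<close> turns a maximum point \<open>z\<close> of \<open>W - U\<close> into a strict one.\<close>

definition doubled :: "('a::metric_space \<Rightarrow> real) \<Rightarrow> ('a \<Rightarrow> real) \<Rightarrow> 'a \<Rightarrow> nat \<Rightarrow> 'a \<Rightarrow> 'a \<Rightarrow> real" where
  "doubled W U z n x y = W x - U y - (dist x z)\<^sup>2 - real n * (dist x y)\<^sup>2"

lemma doubled_maxima_converge:
  fixes x y :: "nat \<Rightarrow> 'a::metric_space"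
  assumes K: "compact K" and z: "z \<in> K" and U: "continuous_on K U"
    and max: "\<And>x. x \<in> K \<Longrightarrow> W x - U x \<le> W z - U z"
    and xy: "\<And>n. x n \<in> K" "\<And>n. y n \<in> K"
    and doubled_max: "\<And>n x' y'. x' \<in> K \<Longrightarrow> y' \<in> K \<Longrightarrow> doubled W U z n x' y' \<le> doubled W U z n (x n) (y n)"
  shows "x \<longlonglongrightarrow> z" "y \<longlonglongrightarrow> z"
proof -
  have penalty: "(dist (x n) z)\<^sup>2 + real n * (dist (x n) (y n))\<^sup>2 \<le> U (x n) - U (y n)" for n
    using doubled_max[OF z z, of n] max[OF xy(1)[of n]] by (simp add: doubled_def)
  obtain M where M: "\<And>x. x \<in> K \<Longrightarrow> norm (U x) \<le> M" using continuous_on_compact_bounded[OF K U] by blast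
  have dist_bound: "(dist (x n) (y n))\<^sup>2 \<le> 2 * M * inverse (real n)" if "n > 0" for n
  proof -
    have "real n * (dist (x n) (y n))\<^sup>2 \<le> 2 * M"
      using penalty[of n] M[OF xy(1)[of n]] M[OF xy(2)[of n]] zero_le_power2[of "dist (x n) z"]
      unfolding real_norm_def by linarith
    then show ?thesis using that by (simp add: field_simps)
  qed
  have "(\<lambda>n. (dist (x n) (y n))\<^sup>2) \<longlonglongrightarrow> 0"
  proof (rule Lim_null_comparison)
    show "\<forall>\<^sub>F n in sequentially. norm ((dist (x n) (y n))\<^sup>2) \<le> 2 * M * inverse (real n)"
      using eventually_gt_at_top[of 0] by eventually_elim (simp add: dist_bound)
    show "(\<lambda>n. 2 * M * inverse (real n)) \<longlonglongrightarrow> 0"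
      by (intro tendsto_mult_right_zero tendsto_inverse_0_at_top filterlim_real_sequentially)
  qed
  then have dist_xy: "(\<lambda>n. dist (x n) (y n)) \<longlonglongrightarrow> 0" by (simp add: power_tendsto_0_iff)
  have "uniformly_continuous_on K U" by (rule compact_uniformly_continuous[OF U K])
  then have "(\<lambda>n. dist (U (x n)) (U (y n))) \<longlonglongrightarrow> 0"
    unfolding uniformly_continuous_on_sequentially using xy dist_xy by blast
  then have "(\<lambda>n. (dist (x n) z)\<^sup>2) \<longlonglongrightarrow> 0"
  proof (rule Lim_null_comparison[rotated])
    have "norm ((dist (x n) z)\<^sup>2) \<le> dist (U (x n)) (U (y n))" for n
    proof -
      have "0 \<le> real n * (dist (x n) (y n))\<^sup>2" by simp
      then have "(dist (x n) z)\<^sup>2 \<le> U (x n) - U (y n)" using penalty[of n] by linarith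
      then show ?thesis by (simp add: dist_real_def)
    qed
    then show "\<forall>\<^sub>F n in sequentially. norm ((dist (x n) z)\<^sup>2) \<le> dist (U (x n)) (U (y n))" by simp
  qed
  then have dist_xz: "(\<lambda>n. dist (x n) z) \<longlonglongrightarrow> 0" by (simp add: power_tendsto_0_iff)
  then show "x \<longlonglongrightarrow> z" by (rule tendsto_dist_iff[THEN iffD2])
  have "(\<lambda>n. dist (x n) (y n) + dist (x n) z) \<longlonglongrightarrow> 0 + 0" by (intro tendsto_add dist_xy dist_xz)
  moreover have "norm (dist (y n) z) \<le> dist (x n) (y n) + dist (x n) z" for n
    using dist_triangle3[of "y n" z "x n"] by simp
  ultimately have "(\<lambda>n. dist (y n) z) \<longlonglongrightarrow> 0" by (intro Lim_null_comparison[of "\<lambda>n. dist (y n) z"]) auto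
  then show "y \<longlonglongrightarrow> z" by (rule tendsto_dist_iff[THEN iffD2])
qed

lemma subsolution_at_doubled_maximum:
  fixes u \<phi> :: "'e::euclidean_space \<Rightarrow> real"
  assumes u: "viscosity_subsolution_on \<Omega> H c u" and \<phi>: "Ck_on 1 \<Omega> \<phi>" and s: "0 < s" "s < 1"
    and U: "open U" "U \<subseteq> \<Omega>" "x \<in> U"
    and max: "\<And>x'. x' \<in> U \<Longrightarrow>
      doubled (\<lambda>x. (1 - s) * u x + s * \<phi> x) w z n x' y \<le> doubled (\<lambda>x. (1 - s) * u x + s * \<phi> x) w z n x y"
  obtains q where "H x q \<le> c"
    "(1 - s) *\<^sub>R q + s *\<^sub>R gradient \<phi> x - 2 *\<^sub>R (x - z) = (2 * real n) *\<^sub>R (x - y)"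
proof -
  let ?W = "\<lambda>x. (1 - s) * u x + s * \<phi> x"
  define \<rho> where "\<rho> x' = 1 * (dist x' z)\<^sup>2 + real n * (dist x' y)\<^sup>2" for x'
  define f where "f x' = - s / (1 - s) * \<phi> x' + 1 / (1 - s) * \<rho> x'" for x'
  have \<rho>: "Ck_on 1 S \<rho>" for S unfolding \<rho>_def by (intro Ck_on_1_combination Ck_on_1_dist_squared)
  have f: "Ck_on 1 \<Omega> f" unfolding f_def by (intro Ck_on_1_combination \<phi> \<rho>)
  have x: "x \<in> \<Omega>" using U by auto
  have \<rho>_gradient: "gradient \<rho> x = 1 *\<^sub>R (2 *\<^sub>R (x - z)) + real n *\<^sub>R (2 *\<^sub>R (x - y))"
    unfolding \<rho>_def gradient_dist_squared[symmetric]
    by (intro gradient_combination Ck_on_1_differentiable[OF Ck_on_1_dist_squared UNIV_I])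
  have f_gradient: "gradient f x = (- s / (1 - s)) *\<^sub>R gradient \<phi> x + (1 / (1 - s)) *\<^sub>R gradient \<rho> x"
    unfolding f_def by (intro gradient_combination Ck_on_1_differentiable[OF \<phi> x] Ck_on_1_differentiable[OF \<rho> UNIV_I])
  have "(1 - s) *\<^sub>R gradient f x = (- s) *\<^sub>R gradient \<phi> x + gradient \<rho> x"
    unfolding f_gradient scaleR_add_right scaleR_scaleR using s by simp
  then have "(1 - s) *\<^sub>R gradient f x + s *\<^sub>R gradient \<phi> x - 2 *\<^sub>R (x - z) = (2 * real n) *\<^sub>R (x - y)"
    by (simp add: \<rho>_gradient)
  moreover have "H x (gradient f x) \<le> c"
  proof -
    have touch: "u x - f x = 1 / (1 - s) * (?W x - \<rho> x)" for x
      using s by (simp add: f_def diff_divide_distrib add_divide_distrib)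
    have "u x' - f x' \<le> u x - f x" if "x' \<in> U" for x'
      unfolding touch using max[OF that] s by (intro mult_left_mono) (auto simp: doubled_def \<rho>_def)
    then have "\<forall>\<^sub>F x' in nhds x. u x' - f x' \<le> u x - f x"
      by (rule eventually_mono[OF eventually_nhds_in_open[OF U(1,3)]])
    then show ?thesis using u f x unfolding viscosity_subsolution_on_def by blast
  qed
  ultimately show ?thesis by (intro that[of "gradient f x"])
qed

lemma supersolution_at_doubled_maximum:
  fixes u :: "'e::euclidean_space \<Rightarrow> real"
  assumes u: "viscosity_supersolution_on \<Omega> H c u" and U: "open U" "U \<subseteq> \<Omega>" "y \<in> U"
    and max: "\<And>y'. y' \<in> U \<Longrightarrow> doubled W u z n x y' \<le> doubled W u z n x y"
  shows "c \<le> H y ((2 * real n) *\<^sub>R (x - y))"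
proof -
  define f where "f y' = - real n * (dist y' x)\<^sup>2 + 0 * (dist y' x)\<^sup>2" for y'
  have f: "Ck_on 1 \<Omega> f" unfolding f_def by (intro Ck_on_1_combination Ck_on_1_dist_squared)
  have "gradient f y = - real n *\<^sub>R (2 *\<^sub>R (y - x)) + 0 *\<^sub>R (2 *\<^sub>R (y - x))"
    unfolding f_def gradient_dist_squared[symmetric]
    by (intro gradient_combination Ck_on_1_differentiable[OF Ck_on_1_dist_squared UNIV_I])
  then have gradient: "gradient f y = (2 * real n) *\<^sub>R (x - y)" by (simp add: algebra_simps)
  have "u y - f y \<le> u y' - f y'" if "y' \<in> U" for y'
    using max[OF that] by (simp add: doubled_def f_def dist_commute)
  then have "\<forall>\<^sub>F y' in nhds y. u y - f y \<le> u y' - f y'"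
    by (rule eventually_mono[OF eventually_nhds_in_open[OF U(1,3)]])
  then have "c \<le> H y (gradient f y)"
    using u f U(2,3) unfolding viscosity_supersolution_on_def by blast
  then show ?thesis by (simp only: gradient)
qed

lemma ex_convergent_doubled_maxima:
  fixes W U :: "'a::metric_space \<Rightarrow> real"
  assumes K: "compact K" and z: "z \<in> K" and W: "continuous_on K W" and U: "continuous_on K U"
    and max: "\<And>x. x \<in> K \<Longrightarrow> W x - U x \<le> W z - U z"
  obtains x y where "\<And>n. x n \<in> K" "\<And>n. y n \<in> K" "x \<longlonglongrightarrow> z" "y \<longlonglongrightarrow> z"
    "\<And>n x' y'. x' \<in> K \<Longrightarrow> y' \<in> K \<Longrightarrow> doubled W U z n x' y' \<le> doubled W U z n (x n) (y n)"
proof -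
  have "\<exists>w\<in>K \<times> K. \<forall>w'\<in>K \<times> K. doubled W U z n (fst w') (snd w') \<le> doubled W U z n (fst w) (snd w)" for n
  proof (rule continuous_attains_sup)
    show "compact (K \<times> K)" "K \<times> K \<noteq> {}" using K z by (auto intro!: compact_Times)
    show "continuous_on (K \<times> K) (\<lambda>w. doubled W U z n (fst w) (snd w))"
      unfolding doubled_def
      by (intro continuous_intros continuous_on_compose2[OF W] continuous_on_compose2[OF U]) auto
  qed
  then obtain w where w: "\<And>n. w n \<in> K \<times> K" and w_max: "\<And>n w'. w' \<in> K \<times> K \<Longrightarrow>
      doubled W U z n (fst w') (snd w') \<le> doubled W U z n (fst (w n)) (snd (w n))" by metis
  define x y where "x n = fst (w n)" and "y n = snd (w n)" for n
  have xy: "x n \<in> K" "y n \<in> K" for n using w[of n] by (auto simp: x_def y_def mem_Times_iff)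
  have doubled_max: "doubled W U z n x' y' \<le> doubled W U z n (x n) (y n)" if "x' \<in> K" "y' \<in> K" for n x' y'
    using w_max[of "(x', y')" n] that by (simp add: x_def y_def)
  from xy doubled_maxima_converge[OF K z U max xy doubled_max] doubled_max show ?thesis by (rule that)
qed

lemma viscosity_inequalities_limit:
  fixes \<phi> :: "'e::euclidean_space \<Rightarrow> real" and H :: "'e \<Rightarrow> 'e \<Rightarrow> real"
  assumes \<Omega>: "z \<in> \<Omega>" and \<phi>: "Ck_on 1 \<Omega> \<phi>" and H: "continuous_on (\<Omega> \<times> UNIV) (\<lambda>(y, p). H y p)"
    and x: "x \<longlonglongrightarrow> z" "\<And>n. x n \<in> \<Omega>" and y: "y \<longlonglongrightarrow> z" "\<And>n. y n \<in> \<Omega>"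
    and bounded: "\<And>n. norm (q n) \<le> B" and sub: "\<And>n. H (x n) (q n) \<le> c"
    and super: "\<And>n. c \<le> H (y n) ((1 - s) *\<^sub>R q n + s *\<^sub>R gradient \<phi> (x n) - 2 *\<^sub>R (x n - z))"
  obtains q' where "H z q' \<le> c" "c \<le> H z ((1 - s) *\<^sub>R q' + s *\<^sub>R gradient \<phi> z)"
proof -
  have "\<forall>n. q n \<in> cball 0 B" using bounded by simp
  with compact_imp_seq_compact[OF compact_cball] obtain q' j where j: "strict_mono (j :: nat \<Rightarrow> nat)"
    and lim_q: "(q \<circ> j) \<longlonglongrightarrow> q'" by (rule seq_compactE)
  have lim_x: "(x \<circ> j) \<longlonglongrightarrow> z" and lim_y: "(y \<circ> j) \<longlonglongrightarrow> z"
    by (intro LIMSEQ_subseq_LIMSEQ x y j)+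
  have lim_H: "(\<lambda>n. H ((w \<circ> j) n) (p n)) \<longlonglongrightarrow> H z p'"
    if "(w \<circ> j) \<longlonglongrightarrow> z" "p \<longlonglongrightarrow> p'" "\<And>n. w n \<in> \<Omega>" for w p p'
    using continuous_on_tendsto_compose[OF H tendsto_Pair[OF that(1,2)]] that(3) \<Omega> by simp
  have "(\<lambda>n. gradient \<phi> ((x \<circ> j) n)) \<longlonglongrightarrow> gradient \<phi> z"
    using x(2) by (intro continuous_on_tendsto_compose[OF continuous_on_gradient[OF \<phi>] lim_x \<Omega>]) simp
  then have "(\<lambda>n. (1 - s) *\<^sub>R (q \<circ> j) n + s *\<^sub>R gradient \<phi> ((x \<circ> j) n) - 2 *\<^sub>R ((x \<circ> j) n - z))
      \<longlonglongrightarrow> (1 - s) *\<^sub>R q' + s *\<^sub>R gradient \<phi> z - 2 *\<^sub>R (z - z)"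
    by (intro tendsto_intros lim_q lim_x)
  from LIMSEQ_le_const[OF lim_H[OF lim_y this y(2)], of c] super
  have "c \<le> H z ((1 - s) *\<^sub>R q' + s *\<^sub>R gradient \<phi> z)" by simp
  moreover have "H z q' \<le> c" using LIMSEQ_le_const2[OF lim_H[OF lim_x lim_q x(2)], of c] sub by simp
  ultimately show ?thesis by (rule that[rotated])
qed

lemma doubling_of_variables:
  fixes u1 u2 \<phi> :: "'e::euclidean_space \<Rightarrow> real"
  assumes \<Omega>: "open \<Omega>" "z \<in> \<Omega>" and s: "0 < s" "s < 1"
    and u1: "viscosity_subsolution_on \<Omega> H c u1" "continuous_on \<Omega> u1"
    and u2: "viscosity_supersolution_on \<Omega> H c u2" "continuous_on \<Omega> u2"
    and \<phi>: "Ck_on 1 \<Omega> \<phi>" and H: "continuous_on (\<Omega> \<times> UNIV) (\<lambda>(y, p). H y p)"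
    and coercive: "\<And>Q. compact Q \<Longrightarrow> Q \<subseteq> \<Omega> \<Longrightarrow> \<exists>B. \<forall>y\<in>Q. \<forall>p. H y p \<le> c \<longrightarrow> norm p \<le> B"
    and max: "\<And>y. y \<in> \<Omega> \<Longrightarrow> (1 - s) * u1 y + s * \<phi> y - u2 y \<le> (1 - s) * u1 z + s * \<phi> z - u2 z"
  obtains q where "H z q \<le> c" "c \<le> H z ((1 - s) *\<^sub>R q + s *\<^sub>R gradient \<phi> z)"
proof -
  obtain r where r: "r > 0" "cball z r \<subseteq> \<Omega>" using \<Omega> open_contains_cball by blast
  let ?B = "cball z r" and ?W = "\<lambda>x. (1 - s) * u1 x + s * \<phi> x"
  have z: "z \<in> ?B" using r(1) by simp
  have "continuous_on ?B ?W" "continuous_on ?B u2"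
    by (intro continuous_on_subset[OF _ r(2)] continuous_intros u1 u2 Ck_on_1_imp_continuous_on \<phi>)+
  moreover have "?W x - u2 x \<le> ?W z - u2 z" if "x \<in> ?B" for x using max that r(2) by blast
  ultimately obtain x y where xy: "\<And>n. x n \<in> ?B" "\<And>n. y n \<in> ?B" and lim: "x \<longlonglongrightarrow> z" "y \<longlonglongrightarrow> z"
    and doubled_max: "\<And>n x' y'. x' \<in> ?B \<Longrightarrow> y' \<in> ?B \<Longrightarrow> doubled ?W u2 z n x' y' \<le> doubled ?W u2 z n (x n) (y n)"
    by (rule ex_convergent_doubled_maxima[OF compact_cball z]) (assumption | rule that)+
  have "\<forall>\<^sub>F n in sequentially. x n \<in> ball z r \<and> y n \<in> ball z r"
    using topological_tendstoD[OF lim(1), of "ball z r"] topological_tendstoD[OF lim(2), of "ball z r"] r(1)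
    by (auto intro: eventually_conj)
  then obtain N where N: "\<And>n. n \<ge> N \<Longrightarrow> x n \<in> ball z r \<and> y n \<in> ball z r"
    by (auto simp: eventually_sequentially)
  have "\<exists>q. H (x (n + N)) q \<le> c \<and>
      c \<le> H (y (n + N)) ((1 - s) *\<^sub>R q + s *\<^sub>R gradient \<phi> (x (n + N)) - 2 *\<^sub>R (x (n + N) - z))" for n
  proof -
    have ball: "ball z r \<subseteq> \<Omega>" "x (n + N) \<in> ball z r" "y (n + N) \<in> ball z r" using r(2) N[of "n + N"] by auto
    have "c \<le> H (y (n + N)) ((2 * real (n + N)) *\<^sub>R (x (n + N) - y (n + N)))"
      by (rule supersolution_at_doubled_maximum[OF u2(1) open_ball ball(1,3)])
        (rule doubled_max[OF xy(1) subsetD[OF ball_subset_cball]])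
    moreover have "doubled ?W u2 z (n + N) x' (y (n + N)) \<le> doubled ?W u2 z (n + N) (x (n + N)) (y (n + N))"
      if "x' \<in> ball z r" for x'
      using doubled_max[OF subsetD[OF ball_subset_cball that] xy(2)] .
    then obtain q where "H (x (n + N)) q \<le> c" "(1 - s) *\<^sub>R q + s *\<^sub>R gradient \<phi> (x (n + N)) - 2 *\<^sub>R (x (n + N) - z)
        = (2 * real (n + N)) *\<^sub>R (x (n + N) - y (n + N))"
      by (rule subsolution_at_doubled_maximum[OF u1(1) \<phi> s open_ball ball(1,2)]) (assumption | rule that)+
    ultimately show ?thesis by auto
  qed
  then obtain q where q: "\<And>n. H (x (n + N)) (q n) \<le> c"
    "\<And>n. c \<le> H (y (n + N)) ((1 - s) *\<^sub>R q n + s *\<^sub>R gradient \<phi> (x (n + N)) - 2 *\<^sub>R (x (n + N) - z))" by metis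
  obtain B where B: "\<And>y p. y \<in> ?B \<Longrightarrow> H y p \<le> c \<Longrightarrow> norm p \<le> B"
    using coercive[OF compact_cball r(2)] by blast
  have "x (n + N) \<in> \<Omega>" "y (n + N) \<in> \<Omega>" "norm (q n) \<le> B" for n using xy r(2) B[OF xy(1) q(1)] by auto
  with lim[THEN LIMSEQ_ignore_initial_segment, of N] q show ?thesis
    by (intro viscosity_inequalities_limit[OF \<Omega>(2) \<phi> H _ _ _ _ _ _ _ that])
qed

section \<open>Charts and bundles\<close>

definition covec_of ::
  "('m::t2_space, 'e::euclidean_space) chart set \<Rightarrow> ('m, 'e) chart \<Rightarrow> 'm \<Rightarrow> 'e \<Rightarrow> ('m, 'e) covec" where
  "covec_of A c x p = (\<lambda>v. if v \<in> tangent_space A x then p \<bullet> v c else 0)"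

definition overlap :: "('m, 'e) chart \<Rightarrow> ('m, 'e) chart \<Rightarrow> 'e set" where
  "overlap c d = chart_map c ` (chart_dom c \<inter> chart_dom d)"

abbreviation transition_derivative ::
  "('m, 'e::euclidean_space) chart \<Rightarrow> ('m, 'e) chart \<Rightarrow> 'm \<Rightarrow> 'e \<Rightarrow> 'e" where
  "transition_derivative c d x \<equiv> frechet_derivative (transition c d) (at (chart_map c x))"

abbreviation chart_gradient :: "('m, 'e::euclidean_space) chart \<Rightarrow> ('m \<Rightarrow> real) \<Rightarrow> 'e \<Rightarrow> 'e" where
  "chart_gradient c f \<equiv> gradient (f \<circ> chart_inv c)"

text \<open>The generators are those of the topologies of both bundles; \<open>\<kappa>\<close> is the fibre coordinate.\<close>

lemma continuous_map_bundle_topology: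
  fixes A :: "('m, 'e::topological_space) chart set" and \<theta> :: "'b::topological_space \<Rightarrow> 'm \<times> 'f"
    and \<kappa> :: "('m, 'e) chart \<Rightarrow> 'm \<Rightarrow> 'f \<Rightarrow> 'e"
  assumes E: "\<And>z. z \<in> T \<Longrightarrow> \<theta> z \<in> E" and cover: "\<And>x. \<exists>d\<in>A. x \<in> chart_dom d"
    and dom: "\<And>d. d \<in> A \<Longrightarrow> open {z \<in> T. fst (\<theta> z) \<in> chart_dom d}"
    and cont: "\<And>d. d \<in> A \<Longrightarrow> continuous_on {z \<in> T. fst (\<theta> z) \<in> chart_dom d}
      (\<lambda>z. (chart_map d (fst (\<theta> z)), \<kappa> d (fst (\<theta> z)) (snd (\<theta> z))))"
  shows "continuous_map (top_of_set T) (topology_generated_by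
    {{(x, \<xi>) \<in> E. x \<in> chart_dom d \<and> (chart_map d x, \<kappa> d x \<xi>) \<in> W} | d W. d \<in> A \<and> open W}) \<theta>"
proof (rule continuous_on_generated_topo)
  let ?gens = "{{(x, \<xi>) \<in> E. x \<in> chart_dom d \<and> (chart_map d x, \<kappa> d x \<xi>) \<in> W} | d W. d \<in> A \<and> open W}"
  show "\<theta> ` topspace (top_of_set T) \<subseteq> \<Union> ?gens"
  proof
    fix w assume "w \<in> \<theta> ` topspace (top_of_set T)"
    then have "w \<in> E" using E by auto
    moreover obtain d where d: "d \<in> A" "fst w \<in> chart_dom d" using cover by blast
    ultimately have "w \<in> {(x, \<xi>) \<in> E. x \<in> chart_dom d \<and> (chart_map d x, \<kappa> d x \<xi>) \<in> UNIV}" by auto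
    then show "w \<in> \<Union> ?gens" using d(1) open_UNIV by blast
  qed
  fix U assume "U \<in> ?gens"
  then obtain d W where d: "d \<in> A" and W: "open W"
    and U: "U = {(x, \<xi>) \<in> E. x \<in> chart_dom d \<and> (chart_map d x, \<kappa> d x \<xi>) \<in> W}" by blast
  let ?T = "{z \<in> T. fst (\<theta> z) \<in> chart_dom d}"
  have "open (?T \<inter> (\<lambda>z. (chart_map d (fst (\<theta> z)), \<kappa> d (fst (\<theta> z)) (snd (\<theta> z)))) -` W)"
    by (rule continuous_open_preimage[OF cont[OF d] dom[OF d] W])
  moreover have "?T \<inter> (\<lambda>z. (chart_map d (fst (\<theta> z)), \<kappa> d (fst (\<theta> z)) (snd (\<theta> z)))) -` W
      = \<theta> -` U \<inter> topspace (top_of_set T)"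
    using E by (auto simp: U case_prod_beta)
  ultimately have "open (\<theta> -` U \<inter> topspace (top_of_set T))" by (simp only:)
  then show "openin (top_of_set T) (\<theta> -` U \<inter> topspace (top_of_set T))"
    by (rule open_subset[rotated]) simp
qed

locale atlas =
  fixes A :: "('m::t2_space, 'e::euclidean_space) chart set"
  assumes atlas: "smooth_atlas A"
begin

lemma chart_cover: "\<exists>c\<in>A. x \<in> chart_dom c"
  using atlas unfolding smooth_atlas_def by blast

lemma open_chart_dom: "c \<in> A \<Longrightarrow> open (chart_dom c)"
  and open_chart_img: "c \<in> A \<Longrightarrow> open (chart_img c)"
  and homeomorphism_chart: "c \<in> A \<Longrightarrow> homeomorphism (chart_dom c) (chart_img c) (chart_map c) (chart_inv c)"
  using atlas by (auto simp: smooth_atlas_def)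

lemma chart_inv_map [simp]: "c \<in> A \<Longrightarrow> x \<in> chart_dom c \<Longrightarrow> chart_inv c (chart_map c x) = x"
  and chart_map_inv [simp]: "c \<in> A \<Longrightarrow> y \<in> chart_img c \<Longrightarrow> chart_map c (chart_inv c y) = y"
  and chart_map_img [simp]: "c \<in> A \<Longrightarrow> x \<in> chart_dom c \<Longrightarrow> chart_map c x \<in> chart_img c"
  and chart_inv_dom [simp]: "c \<in> A \<Longrightarrow> y \<in> chart_img c \<Longrightarrow> chart_inv c y \<in> chart_dom c"
  using homeomorphism_chart[of c] by (auto simp: homeomorphism_def chart_img_def)

lemma continuous_on_chart_map: "c \<in> A \<Longrightarrow> continuous_on (chart_dom c) (chart_map c)"
  and continuous_on_chart_inv: "c \<in> A \<Longrightarrow> continuous_on (chart_img c) (chart_inv c)"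
  using homeomorphism_chart[of c] by (auto simp: homeomorphism_def)

lemma continuous_on_in_chart:
  assumes "continuous_on UNIV u" "c \<in> A"
  shows "continuous_on (chart_img c) (\<lambda>y. u (chart_inv c y))"
  by (rule continuous_on_compose2[OF assms(1) continuous_on_chart_inv[OF assms(2)]]) simp

lemma eventually_nhds_chart_inv:
  assumes c: "c \<in> A" "y \<in> chart_img c" and P: "\<forall>\<^sub>F x in nhds y. P (chart_inv c x)"
  shows "\<forall>\<^sub>F x in nhds (chart_inv c y). P x"
proof -
  have "isCont (chart_map c) (chart_inv c y)"
    using continuous_on_chart_map[OF c(1)] open_chart_dom[OF c(1)] c by (simp add: continuous_on_eq_continuous_at)
  then have "filterlim (chart_map c) (nhds (chart_map c (chart_inv c y))) (nhds (chart_inv c y))"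
    by (simp only: isCont_def tendsto_at_iff_tendsto_nhds)
  then have "filterlim (chart_map c) (nhds y) (nhds (chart_inv c y))" using c by simp
  with P have "\<forall>\<^sub>F x in nhds (chart_inv c y). P (chart_inv c (chart_map c x))"
    by (rule eventually_compose_filterlim)
  moreover have "\<forall>\<^sub>F x in nhds (chart_inv c y). x \<in> chart_dom c"
    using c open_chart_dom by (intro eventually_nhds_in_open) auto
  ultimately show ?thesis by eventually_elim (use c in simp)
qed

lemma mem_overlap_iff: "c \<in> A \<Longrightarrow> y \<in> overlap c d \<longleftrightarrow> y \<in> chart_img c \<and> chart_inv c y \<in> chart_dom d"
  by (force simp: overlap_def chart_img_def)

lemma open_chart_vimage:
  assumes "c \<in> A" "open U"
  shows "open {y \<in> chart_img c. chart_inv c y \<in> U}"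
  using continuous_open_preimage[OF continuous_on_chart_inv open_chart_img assms(2), OF assms(1) assms(1)]
  by (simp add: vimage_def Int_def)

lemma open_overlap: "c \<in> A \<Longrightarrow> d \<in> A \<Longrightarrow> open (overlap c d)"
  using open_chart_vimage[of c "chart_dom d"] open_chart_dom[of d]
  by (simp add: mem_overlap_iff[symmetric] cong: conj_cong)

lemma transition_in_overlap: "c \<in> A \<Longrightarrow> d \<in> A \<Longrightarrow> y \<in> overlap c d \<Longrightarrow> transition c d y \<in> overlap d c"
  by (auto simp: overlap_def transition_def)

lemma Ck_on_1_transition: "c \<in> A \<Longrightarrow> d \<in> A \<Longrightarrow> Ck_on 1 (overlap c d) (transition c d)"
  using atlas by (auto simp: smooth_atlas_def smooth_on_def overlap_def simp del: Ck_on.simps)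

lemma transition_has_derivative:
  assumes "c \<in> A" "d \<in> A" "x \<in> chart_dom c" "x \<in> chart_dom d"
  shows "(transition c d has_derivative transition_derivative c d x) (at (chart_map c x))"
  using assms by (intro Ck_on_1_has_derivative[OF Ck_on_1_transition]) (auto simp: overlap_def)

lemma transition_derivative_combination:
  assumes "c \<in> A" "d \<in> A" "x \<in> chart_dom c" "x \<in> chart_dom d"
  shows "transition_derivative c d x (a *\<^sub>R v + b *\<^sub>R w) =
    a *\<^sub>R transition_derivative c d x v + b *\<^sub>R transition_derivative c d x w"
  using has_derivative_linear[OF transition_has_derivative[OF assms]] by (simp add: linear_add linear_scale)

lemma transition_derivative_self:
  assumes "c \<in> A" "x \<in> chart_dom c"
  shows "transition_derivative c c x h = h"
proof -
  have "((\<lambda>y. y) has_derivative (\<lambda>h. h)) (at (chart_map c x))" by (rule has_derivative_ident)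
  then have "(transition c c has_derivative (\<lambda>h. h)) (at (chart_map c x))"
    by (rule has_derivative_transform_within_open[OF _ open_chart_img[OF assms(1)]])
      (use assms in \<open>auto simp: transition_def\<close>)
  from frechet_derivative_at[OF this] show ?thesis by metis
qed

lemma transition_derivative_trans:
  assumes "c \<in> A" "d \<in> A" "e \<in> A" "x \<in> chart_dom c" "x \<in> chart_dom d" "x \<in> chart_dom e"
  shows "transition_derivative d e x (transition_derivative c d x h) = transition_derivative c e x h"
proof -
  have x: "transition c d (chart_map c x) = chart_map d x" using assms by (simp add: transition_def)
  have "((\<lambda>y. transition d e (transition c d y)) has_derivative
      (\<lambda>h. transition_derivative d e x (transition_derivative c d x h))) (at (chart_map c x))"
    using transition_has_derivative[of d e x] assms x
    by (intro has_derivative_compose[OF transition_has_derivative[of c d x]]) auto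
  then have "(transition c e has_derivative
      (\<lambda>h. transition_derivative d e x (transition_derivative c d x h))) (at (chart_map c x))"
    by (rule has_derivative_transform_within_open[OF _ open_overlap[OF assms(1,2)]])
      (use assms in \<open>auto simp: transition_def overlap_def\<close>)
  from frechet_derivative_at[OF this] show ?thesis by metis
qed

subsection \<open>Tangent and cotangent vectors in coordinates\<close>

lemma tangent_space_component:
  assumes "v \<in> tangent_space A x" "c \<in> A" "d \<in> A" "x \<in> chart_dom c" "x \<in> chart_dom d"
  shows "transition_derivative c d x (v c) = v d"
proof (rule sym)
  note transforms = assms(1)[unfolded tangent_space_def mem_Collect_eq, THEN conjunct2]
  show "v d = transition_derivative c d x (v c)" by (rule transforms[rule_format]) (use assms in auto)
qed

lemma tangent_space_eq_0:
  assumes "v \<in> tangent_space A x" "c \<notin> A \<or> x \<notin> chart_dom c"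
  shows "v c = 0"
  by (rule assms(1)[unfolded tangent_space_def mem_Collect_eq, THEN conjunct1, rule_format]) fact

lemma tangent_spaceI:
  assumes "\<And>c. c \<notin> A \<or> x \<notin> chart_dom c \<Longrightarrow> v c = 0"
    and "\<And>c d. c \<in> A \<Longrightarrow> d \<in> A \<Longrightarrow> x \<in> chart_dom c \<Longrightarrow> x \<in> chart_dom d \<Longrightarrow>
      v d = transition_derivative c d x (v c)"
  shows "v \<in> tangent_space A x"
  unfolding tangent_space_def
  by (intro CollectI conjI allI impI ballI) (use assms(1) in simp, rule assms(2), auto)

lemma tangent_space_combination:
  assumes "v \<in> tangent_space A x" "w \<in> tangent_space A x"
  shows "(\<lambda>c. a *\<^sub>R v c + b *\<^sub>R w c) \<in> tangent_space A x"
  by (rule tangent_spaceI)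
    (simp_all add: tangent_space_eq_0[OF assms(1)] tangent_space_eq_0[OF assms(2)]
      transition_derivative_combination tangent_space_component[OF assms(1)] tangent_space_component[OF assms(2)])

lemma coord_vector_in_tangent_space:
  assumes "c \<in> A" "x \<in> chart_dom c"
  shows "coord_vector A c x e \<in> tangent_space A x"
  using assms by (intro tangent_spaceI) (auto simp: coord_vector_def transition_derivative_trans)

lemma coord_vector_self: "c \<in> A \<Longrightarrow> x \<in> chart_dom c \<Longrightarrow> coord_vector A c x e c = e"
  by (simp add: coord_vector_def transition_derivative_self)

lemma coord_vector_component:
  assumes "v \<in> tangent_space A x" "c \<in> A" "x \<in> chart_dom c"
  shows "coord_vector A c x (v c) = v"
proof
  fix d
  show "coord_vector A c x (v c) d = v d"
    using tangent_space_component[OF assms(1,2) _ assms(3), of d] tangent_space_eq_0[OF assms(1), of d]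
    by (auto simp: coord_vector_def)
qed

lemma coord_vector_combination:
  assumes "c \<in> A" "x \<in> chart_dom c"
  shows "coord_vector A c x (a *\<^sub>R v + b *\<^sub>R w) = (\<lambda>d. a *\<^sub>R coord_vector A c x v d + b *\<^sub>R coord_vector A c x w d)"
  using assms by (auto simp: coord_vector_def fun_eq_iff transition_derivative_combination)

lemma covec_of_in_cotangent_space: "covec_of A c x p \<in> cotangent_space A x"
  unfolding cotangent_space_def covec_of_def
  by (auto simp: tangent_space_combination inner_add_right)

lemma covec_of_apply: "v \<in> tangent_space A x \<Longrightarrow> covec_of A c x p v = p \<bullet> v c"
  by (simp add: covec_of_def)

lemma covec_of_covec_coords:
  assumes P: "P \<in> cotangent_space A x" and c: "c \<in> A" "x \<in> chart_dom c"
  shows "covec_of A c x (covec_coords A c x P) = P"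
proof
  fix v
  show "covec_of A c x (covec_coords A c x P) v = P v"
  proof (cases "v \<in> tangent_space A x")
    case True
    define f where "f e = P (coord_vector A c x e)" for e
    have combination: "f (a *\<^sub>R e + b *\<^sub>R e') = a * f e + b * f e'" for a b e e'
      using P coord_vector_in_tangent_space[OF c] unfolding cotangent_space_def f_def
      by (simp add: coord_vector_combination[OF c])
    have "linear f" using combination[of 1 _ 1] combination[of _ _ 0 0] by (intro linearI) auto
    from linear_eq_sum_Basis[OF this, of "v c"] have "f (v c) = covec_coords A c x P \<bullet> v c"
      unfolding covec_coords_def inner_sum_left by (simp add: f_def inner_commute[of "v c"] mult.commute)
    then show ?thesis using True c by (simp add: covec_of_apply f_def coord_vector_component)
  next
    case False
    then show ?thesis using P by (simp add: covec_of_def cotangent_space_def)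
  qed
qed

lemma cotangent_space_eq_range_covec_of:
  assumes "c \<in> A" "x \<in> chart_dom c"
  shows "cotangent_space A x = range (covec_of A c x)"
proof
  show "cotangent_space A x \<subseteq> range (covec_of A c x)"
    using covec_of_covec_coords[OF _ assms] by (metis rangeI subsetI)
  show "range (covec_of A c x) \<subseteq> cotangent_space A x" using covec_of_in_cotangent_space by blast
qed

lemma covec_coords_covec_of:
  assumes "c \<in> A" "d \<in> A" "x \<in> chart_dom c" "x \<in> chart_dom d"
  shows "covec_coords A d x (covec_of A c x p) = (\<Sum>b\<in>Basis. (p \<bullet> transition_derivative d c x b) *\<^sub>R b)"
  using assms by (simp add: covec_coords_def covec_of_apply coord_vector_in_tangent_space)
    (simp add: coord_vector_def)

lemma covec_of_combination:
  "(\<lambda>v. a * covec_of A c x p v + b * covec_of A c x q v) = covec_of A c x (a *\<^sub>R p + b *\<^sub>R q)"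
  by (auto simp: covec_of_def fun_eq_iff inner_add_left)

definition tangent_param :: "('m, 'e) chart \<Rightarrow> 'e \<times> 'e \<Rightarrow> 'm \<times> ('m, 'e) tvec" where
  "tangent_param c = (\<lambda>(y, w). (chart_inv c y, coord_vector A c (chart_inv c y) w))"

definition cotangent_param :: "('m, 'e) chart \<Rightarrow> 'e \<times> 'e \<Rightarrow> 'm \<times> ('m, 'e) covec" where
  "cotangent_param c = (\<lambda>(y, p). (chart_inv c y, covec_of A c (chart_inv c y) p))"

lemma fst_tangent_param: "fst (tangent_param c z) = chart_inv c (fst z)"
  and fst_cotangent_param: "fst (cotangent_param c z) = chart_inv c (fst z)"
  by (simp_all add: tangent_param_def cotangent_param_def case_prod_beta)

lemma tangent_param_in_bundle:
  "c \<in> A \<Longrightarrow> z \<in> chart_img c \<times> UNIV \<Longrightarrow> tangent_param c z \<in> tangent_bundle A"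
  by (auto simp: tangent_param_def tangent_bundle_def coord_vector_in_tangent_space)

lemma tangent_param_component:
  "(x, v) \<in> tangent_bundle A \<Longrightarrow> c \<in> A \<Longrightarrow> x \<in> chart_dom c \<Longrightarrow> tangent_param c (chart_map c x, v c) = (x, v)"
  by (simp add: tangent_param_def tangent_bundle_def coord_vector_component)

lemma overlap_Times_UNIV:
  assumes "c \<in> A"
  shows "{z \<in> chart_img c \<times> UNIV. chart_inv c (fst z) \<in> chart_dom d} = overlap c d \<times> UNIV"
  using assms by (auto simp: mem_overlap_iff)

lemma continuous_map_tangent_param:
  assumes c: "c \<in> A"
  shows "continuous_map (top_of_set (chart_img c \<times> UNIV)) (tangent_topology A) (tangent_param c)"
  unfolding tangent_topology_def
proof (rule continuous_map_bundle_topology[where \<kappa> = "\<lambda>d x v. v d"])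
  fix d assume d: "d \<in> A"
  show "open {z \<in> chart_img c \<times> UNIV. fst (tangent_param c z) \<in> chart_dom d}"
    unfolding fst_tangent_param overlap_Times_UNIV[OF c] by (intro open_Times open_overlap c d open_UNIV)
  have "continuous_on (overlap c d \<times> UNIV)
      (\<lambda>z. (transition c d (fst z), frechet_derivative (transition c d) (at (fst z)) (snd z)))"
    by (intro continuous_intros continuous_on_frechet_derivative[OF Ck_on_1_transition[OF c d]]
        continuous_on_compose2[OF Ck_on_1_imp_continuous_on[OF Ck_on_1_transition[OF c d]]]) auto
  then show "continuous_on {z \<in> chart_img c \<times> UNIV. fst (tangent_param c z) \<in> chart_dom d}
      (\<lambda>z. (chart_map d (fst (tangent_param c z)), snd (tangent_param c z) d))"
    unfolding fst_tangent_param overlap_Times_UNIV[OF c]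
    by (rule continuous_on_eq)
      (use c d in \<open>auto simp: tangent_param_def coord_vector_def transition_def mem_overlap_iff\<close>)
qed (rule tangent_param_in_bundle[OF c] chart_cover; assumption)+

lemma continuous_map_cotangent_param:
  assumes c: "c \<in> A"
  shows "continuous_map (top_of_set (chart_img c \<times> UNIV)) (cotangent_topology A) (cotangent_param c)"
  unfolding cotangent_topology_def
proof (rule continuous_map_bundle_topology[where \<kappa> = "covec_coords A"])
  fix d assume d: "d \<in> A"
  show "open {z \<in> chart_img c \<times> UNIV. fst (cotangent_param c z) \<in> chart_dom d}"
    unfolding fst_cotangent_param overlap_Times_UNIV[OF c] by (intro open_Times open_overlap c d open_UNIV)
  have transition: "continuous_on (overlap c d \<times> UNIV) (\<lambda>z :: 'e \<times> 'e. transition c d (fst z))"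
    by (rule continuous_on_compose2[OF Ck_on_1_imp_continuous_on[OF Ck_on_1_transition[OF c d]]])
      (auto intro!: continuous_intros)
  have "continuous_on (overlap c d \<times> UNIV) (\<lambda>z. (transition c d (fst z),
      \<Sum>b\<in>Basis. (snd z \<bullet> frechet_derivative (transition d c) (at (transition c d (fst z))) b) *\<^sub>R b))"
    by (intro continuous_intros transition continuous_on_frechet_derivative[OF Ck_on_1_transition[OF d c]])
      (auto simp: transition_in_overlap c d)
  then show "continuous_on {z \<in> chart_img c \<times> UNIV. fst (cotangent_param c z) \<in> chart_dom d}
      (\<lambda>z. (chart_map d (fst (cotangent_param c z)), covec_coords A d (fst (cotangent_param c z)) (snd (cotangent_param c z))))"
    unfolding fst_cotangent_param overlap_Times_UNIV[OF c]
    by (rule continuous_on_eq)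
      (use c d in \<open>auto simp: cotangent_param_def covec_coords_covec_of transition_def mem_overlap_iff\<close>)
qed (use chart_cover in \<open>auto simp: cotangent_param_def cotangent_bundle_def covec_of_in_cotangent_space\<close>)

subsection \<open>Functions of class \<open>C\<^sup>1\<close> on the manifold\<close>

lemma Ck_on_1_chart: "f \<in> C1_functions A \<Longrightarrow> c \<in> A \<Longrightarrow> Ck_on 1 (chart_img c) (f \<circ> chart_inv c)"
  unfolding C1_functions_def by blast

lemmas differentiable_in_chart = Ck_on_1_differentiable[OF Ck_on_1_chart]

lemma differential_eq_covec_of:
  assumes c: "c \<in> A" "x \<in> chart_dom c" and f: "f \<in> C1_functions A"
  shows "differential A f x = covec_of A c x (chart_gradient c f (chart_map c x))"
proof
  fix v
  define d where "d = (SOME d. d \<in> A \<and> x \<in> chart_dom d)"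
  have d: "d \<in> A" "x \<in> chart_dom d"
    using someI[of "\<lambda>d. d \<in> A \<and> x \<in> chart_dom d" c] c by (auto simp: d_def)
  let ?p = "chart_gradient c f (chart_map c x)"
  show "differential A f x v = covec_of A c x ?p v"
  proof (cases "v \<in> tangent_space A x")
    case True
    have x: "transition d c (chart_map d x) = chart_map c x" using c d by (simp add: transition_def)
    have "(f \<circ> chart_inv c has_derivative (\<lambda>h. ?p \<bullet> h)) (at (transition d c (chart_map d x)))"
      unfolding x using c by (intro has_derivative_gradient differentiable_in_chart f) auto
    from has_derivative_compose[OF transition_has_derivative[OF d(1) c(1) d(2) c(2)] this]
    have "(f \<circ> chart_inv d has_derivative (\<lambda>h. ?p \<bullet> transition_derivative d c x h)) (at (chart_map d x))"
      by (rule has_derivative_transform_within_open[OF _ open_overlap[OF d(1) c(1)]])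
        (use c d in \<open>auto simp: transition_def overlap_def\<close>)
    from frechet_derivative_at[OF this]
    have "frechet_derivative (f \<circ> chart_inv d) (at (chart_map d x)) (v d) = ?p \<bullet> transition_derivative d c x (v d)"
      by metis
    also have "transition_derivative d c x (v d) = v c" using True c d by (intro tangent_space_component)
    finally show ?thesis using True by (simp add: differential_def covec_of_apply Let_def o_def flip: d_def)
  qed (simp add: differential_def covec_of_def)
qed

lemma differential_tangent_param:
  assumes "f \<in> C1_functions A" "c \<in> A" "z \<in> chart_img c \<times> UNIV"
  shows "(case tangent_param c z of (x, v) \<Rightarrow> differential A f x v) = chart_gradient c f (fst z) \<bullet> snd z"
  using assms by (auto simp: tangent_param_def differential_eq_covec_of[of c] covec_of_apply
      coord_vector_in_tangent_space coord_vector_self)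

lemma cotangent_param_chart_gradient:
  assumes "f \<in> C1_functions A" "c \<in> A" "y \<in> chart_img c"
  shows "cotangent_param c (y, chart_gradient c f y) = (chart_inv c y, differential A f (chart_inv c y))"
  using assms by (simp add: cotangent_param_def differential_eq_covec_of[of c])

lemma C1_const: "(\<lambda>x. k) \<in> C1_functions A"
  unfolding C1_functions_def o_def using Ck_on_1_const by blast

lemma C1_combination:
  assumes "f \<in> C1_functions A" "g \<in> C1_functions A"
  shows "(\<lambda>x. a * f x + b * g x) \<in> C1_functions A"
  unfolding C1_functions_def using Ck_on_1_combination[OF Ck_on_1_chart[OF assms(1)] Ck_on_1_chart[OF assms(2)]]
  by (simp add: o_def del: Ck_on.simps)

lemma chart_gradient_combination:
  assumes "f \<in> C1_functions A" "g \<in> C1_functions A" "c \<in> A" "y \<in> chart_img c"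
  shows "chart_gradient c (\<lambda>x. a * f x + b * g x) y = a *\<^sub>R chart_gradient c f y + b *\<^sub>R chart_gradient c g y"
  using gradient_combination[OF differentiable_in_chart[OF assms(1,3,4)] differentiable_in_chart[OF assms(2-4)]]
  by (simp add: o_def)

lemma continuous_on_C1:
  assumes f: "f \<in> C1_functions A"
  shows "continuous_on UNIV f"
proof -
  have "continuous_on (chart_dom c) f" if c: "c \<in> A" for c
  proof -
    have "continuous_on (chart_dom c) (\<lambda>x. (f \<circ> chart_inv c) (chart_map c x))"
      by (rule continuous_on_compose2[OF Ck_on_1_imp_continuous_on[OF Ck_on_1_chart[OF f c]] continuous_on_chart_map[OF c]])
        (use c in auto)
    then show ?thesis by (rule continuous_on_eq) (use c in auto)
  qed
  then have "continuous_on (\<Union>c\<in>A. chart_dom c) f"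
    by (intro continuous_on_open_UN open_chart_dom)
  moreover have "(\<Union>c\<in>A. chart_dom c) = UNIV" using atlas by (simp add: smooth_atlas_def)
  ultimately show ?thesis by (simp only:)
qed

text \<open>Compactness of \<open>K\<close> makes its image closed in the manifold; this is where the Hausdorff property enters.\<close>

lemma C1_extension_by_zero:
  fixes f :: "'e \<Rightarrow> real"
  assumes c: "c \<in> A" and f: "Ck_on 1 (chart_img c) f"
    and K: "compact K" "K \<subseteq> chart_img c" and support: "\<And>y. y \<in> chart_img c - K \<Longrightarrow> f y = 0"
  shows "(\<lambda>x. if x \<in> chart_dom c then f (chart_map c x) else 0) \<in> C1_functions A"
    (is "?F \<in> _")
proof -
  have "compact (chart_inv c ` K)"
    by (rule compact_continuous_image[OF continuous_on_subset[OF continuous_on_chart_inv[OF c] K(2)] K(1)])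
  then have closed: "closed (chart_inv c ` K)" by (rule compact_imp_closed)
  have zero: "?F x = 0" if "x \<notin> chart_inv c ` K" for x
  proof (cases "x \<in> chart_dom c")
    case True
    then have "chart_map c x \<in> chart_img c - K" using that c by (metis Diff_iff chart_inv_map chart_map_img image_eqI)
    then show ?thesis by (simp add: support)
  qed simp
  show ?thesis
    unfolding C1_functions_def
  proof (intro CollectI ballI Ck_on_1_locally)
    fix d y assume d: "d \<in> A" and y: "y \<in> chart_img d"
    show "\<exists>U. open U \<and> y \<in> U \<and> Ck_on 1 U (?F \<circ> chart_inv d)"
    proof (cases "chart_inv d y \<in> chart_dom c")
      case True
      have "transition d c ` overlap d c \<subseteq> chart_img c"
        using transition_in_overlap[OF d c] c by (auto simp: mem_overlap_iff)
      then have "Ck_on 1 (overlap d c) (\<lambda>y. f (transition d c y))"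
        by (rule Ck_on_1_compose[OF f Ck_on_1_transition[OF d c]])
      then have "Ck_on 1 (overlap d c) (?F \<circ> chart_inv d)"
        by (rule Ck_on_1_cong[OF _ open_overlap[OF d c]]) (auto simp: transition_def mem_overlap_iff[OF d])
      then show ?thesis using open_overlap[OF d c] True y d mem_overlap_iff by blast
    next
      case False
      let ?U = "{y \<in> chart_img d. chart_inv d y \<in> - chart_inv c ` K}"
      have U: "open ?U" using closed d by (intro open_chart_vimage) auto
      have "Ck_on 1 ?U (?F \<circ> chart_inv d)"
        by (rule Ck_on_1_cong[OF Ck_on_1_const U]) (auto simp: zero simp del: if_split)
      moreover have "y \<in> ?U" using False y c K(2) by (auto dest: subsetD)
      ultimately show ?thesis using U by blast
    qed
  qed
qed

lemma C1_local_extension: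
  fixes f :: "'e \<Rightarrow> real"
  assumes c: "c \<in> A" "y \<in> chart_img c" and f: "Ck_on 1 (chart_img c) f"
  obtains F where "F \<in> C1_functions A" "\<forall>\<^sub>F x in nhds y. F (chart_inv c x) = f x"
    "chart_gradient c F y = gradient f y"
proof -
  obtain e where e: "e > 0" "cball y e \<subseteq> chart_img c"
    using open_chart_img[OF c(1)] c(2) open_contains_cball by blast
  obtain \<eta> :: "'e \<Rightarrow> real" where \<eta>: "Ck_on 1 UNIV \<eta>" "\<And>x. dist x y \<le> e / 2 \<Longrightarrow> \<eta> x = 1"
    "\<And>x. 2 * (e / 2) \<le> dist x y \<Longrightarrow> \<eta> x = 0"
    using C1_bump_function[of "e / 2" y] e(1) by auto
  let ?F = "\<lambda>x. if x \<in> chart_dom c then \<eta> (chart_map c x) * f (chart_map c x) else 0"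
  have agree: "?F (chart_inv c x) = f x" if "x \<in> ball y (e / 2)" for x
  proof -
    have "x \<in> chart_img c" using that e by (auto simp: dist_commute)
    then show ?thesis using c(1) \<eta>(2)[of x] that by (simp add: dist_commute)
  qed
  have y: "y \<in> ball y (e / 2)" using e(1) by simp
  show ?thesis
  proof (rule that)
    have "Ck_on 1 (chart_img c) \<eta>" by (rule Ck_on_1_subset[OF \<eta>(1) subset_UNIV])
    then have "Ck_on 1 (chart_img c) (\<lambda>x. \<eta> x * f x)" using f by (rule Ck_on_1_mult)
    then show "?F \<in> C1_functions A"
      by (rule C1_extension_by_zero[OF c(1) _ compact_cball e(2)]) (simp add: \<eta>(3) dist_commute)
    show "\<forall>\<^sub>F x in nhds y. ?F (chart_inv c x) = f x"
      using eventually_nhds_in_open[OF open_ball y] agree by (rule eventually_mono)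
    have "(f has_derivative (\<lambda>h. gradient f y \<bullet> h)) (at y)" by (rule Ck_on_1_has_gradient[OF f c(2)])
    then have "(?F \<circ> chart_inv c has_derivative (\<lambda>h. gradient f y \<bullet> h)) (at y)"
      by (rule has_derivative_transform_within_open[OF _ open_ball y]) (simp only: agree o_apply)
    then show "chart_gradient c ?F y = gradient f y" by (rule gradient_eqI)
  qed
qed

lemma viscosity_solution_in_chart:
  assumes u: "viscosity_solution A G k u" and c: "c \<in> A"
  shows "viscosity_subsolution_on (chart_img c) (\<lambda>y p. G (cotangent_param c (y, p))) k (\<lambda>y. u (chart_inv c y))"
    and "viscosity_supersolution_on (chart_img c) (\<lambda>y p. G (cotangent_param c (y, p))) k (\<lambda>y. u (chart_inv c y))"
proof -
  show "viscosity_subsolution_on (chart_img c) (\<lambda>y p. G (cotangent_param c (y, p))) k (\<lambda>y. u (chart_inv c y))"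
    unfolding viscosity_subsolution_on_def
  proof (intro allI impI ballI)
    fix f y assume f: "Ck_on 1 (chart_img c) f" and y: "y \<in> chart_img c"
      and touch: "\<forall>\<^sub>F x in nhds y. u (chart_inv c x) - f x \<le> u (chart_inv c y) - f y"
    obtain F where F: "F \<in> C1_functions A" and agree: "\<forall>\<^sub>F x in nhds y. F (chart_inv c x) = f x"
      and grad: "chart_gradient c F y = gradient f y" by (rule C1_local_extension[OF c y f])
    have "\<forall>\<^sub>F x in nhds y. u (chart_inv c x) - F (chart_inv c x) \<le> u (chart_inv c y) - F (chart_inv c y)"
      using touch agree by eventually_elim (simp add: eventually_nhds_x_imp_x[OF agree])
    then have "\<forall>\<^sub>F x in nhds (chart_inv c y). u x - F x \<le> u (chart_inv c y) - F (chart_inv c y)"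
      by (rule eventually_nhds_chart_inv[OF c y])
    then have "G (chart_inv c y, differential A F (chart_inv c y)) \<le> k"
      using u F unfolding viscosity_solution_def by blast
    then show "G (cotangent_param c (y, gradient f y)) \<le> k"
      by (simp only: cotangent_param_chart_gradient[OF F c y] flip: grad)
  qed
  show "viscosity_supersolution_on (chart_img c) (\<lambda>y p. G (cotangent_param c (y, p))) k (\<lambda>y. u (chart_inv c y))"
    unfolding viscosity_supersolution_on_def
  proof (intro allI impI ballI)
    fix f y assume f: "Ck_on 1 (chart_img c) f" and y: "y \<in> chart_img c"
      and touch: "\<forall>\<^sub>F x in nhds y. u (chart_inv c y) - f y \<le> u (chart_inv c x) - f x"
    obtain F where F: "F \<in> C1_functions A" and agree: "\<forall>\<^sub>F x in nhds y. F (chart_inv c x) = f x"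
      and grad: "chart_gradient c F y = gradient f y" by (rule C1_local_extension[OF c y f])
    have "\<forall>\<^sub>F x in nhds y. u (chart_inv c y) - F (chart_inv c y) \<le> u (chart_inv c x) - F (chart_inv c x)"
      using touch agree by eventually_elim (simp add: eventually_nhds_x_imp_x[OF agree])
    then have "\<forall>\<^sub>F x in nhds (chart_inv c y). u (chart_inv c y) - F (chart_inv c y) \<le> u x - F x"
      by (rule eventually_nhds_chart_inv[OF c y])
    then have "k \<le> G (chart_inv c y, differential A F (chart_inv c y))"
      using u F unfolding viscosity_solution_def by blast
    then show "k \<le> G (cotangent_param c (y, gradient f y))"
      by (simp only: cotangent_param_chart_gradient[OF F c y] flip: grad)
  qed
qed

subsection \<open>Measurability on the tangent bundle\<close>

lemma openin_tangent_subset: "openin (tangent_topology A) W \<Longrightarrow> W \<subseteq> tangent_bundle A"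
  by (drule openin_subset) (auto simp: tangent_topology_def topology_generated_by_topspace)

lemma space_tangent_borel: "space (tangent_borel A) = tangent_bundle A"
  unfolding tangent_borel_def by (rule space_measure_of) (use openin_tangent_subset in blast)

lemma sets_tangent_borelI: "openin (tangent_topology A) W \<Longrightarrow> W \<in> sets (tangent_borel A)"
  unfolding tangent_borel_def
  by (subst sets_measure_of) (use openin_tangent_subset in \<open>auto intro: sigma_sets.Basic\<close>)

lemma openin_tangent_chart:
  assumes "c \<in> A" "open W"
  shows "openin (tangent_topology A) {(x, v) \<in> tangent_bundle A. x \<in> chart_dom c \<and> (chart_map c x, v c) \<in> W}"
  unfolding tangent_topology_def by (rule topology_generated_by_Basis) (use assms in blast)

lemma borel_measurable_tangent_borelI:
  fixes f :: "'m \<times> ('m, 'e) tvec \<Rightarrow> 'b::topological_space"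
  assumes f: "\<And>c. c \<in> A \<Longrightarrow> continuous_on (chart_img c \<times> UNIV) (\<lambda>z. f (tangent_param c z))"
  shows "f \<in> borel_measurable (tangent_borel A)"
proof (rule borel_measurableI)
  fix U :: "'b set" assume U: "open U"
  define W where "W c = (chart_img c \<times> UNIV) \<inter> (\<lambda>z. f (tangent_param c z)) -` U" for c
  define V where "V c = {(x, v) \<in> tangent_bundle A. x \<in> chart_dom c \<and> (chart_map c x, v c) \<in> W c}" for c
  have "open (W c)" if "c \<in> A" for c
    unfolding W_def using U that by (intro continuous_open_preimage f open_Times open_chart_img) auto
  then have "openin (tangent_topology A) (\<Union>c\<in>A. V c)"
    unfolding V_def using openin_tangent_chart by (intro openin_Union) auto
  moreover have "(\<Union>c\<in>A. V c) = f -` U \<inter> space (tangent_borel A)"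
  proof -
    have mem_V: "z \<in> V c \<longleftrightarrow> f z \<in> U \<and> fst z \<in> chart_dom c" if "z \<in> tangent_bundle A" "c \<in> A" for z c
      using that by (cases z) (auto simp: V_def W_def tangent_param_component)
    have "z \<in> (\<Union>c\<in>A. V c) \<longleftrightarrow> f z \<in> U" if z: "z \<in> tangent_bundle A" for z
      using mem_V[OF z] chart_cover[of "fst z"] by (simp add: Bex_def)
    moreover have "(\<Union>c\<in>A. V c) \<subseteq> tangent_bundle A" by (auto simp: V_def)
    ultimately show ?thesis unfolding space_tangent_borel by blast
  qed
  ultimately show "f -` U \<inter> space (tangent_borel A) \<in> sets (tangent_borel A)"
    by (intro sets_tangent_borelI) (simp only:)
qed

lemma borel_measurable_fst_tangent_borel: "fst \<in> borel_measurable (tangent_borel A)"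
  by (intro borel_measurable_tangent_borelI)
    (auto simp: fst_tangent_param intro!: continuous_intros continuous_on_compose2[OF continuous_on_chart_inv])

lemma borel_measurable_differential:
  assumes f: "f \<in> C1_functions A"
  shows "(\<lambda>(x, v). differential A f x v) \<in> borel_measurable (tangent_borel A)"
proof (rule borel_measurable_tangent_borelI)
  fix c assume c: "c \<in> A"
  have "continuous_on (chart_img c \<times> UNIV) (\<lambda>z. chart_gradient c f (fst z) \<bullet> snd z)"
    by (intro continuous_intros continuous_on_compose2[OF continuous_on_gradient[OF Ck_on_1_chart[OF f c]]]) auto
  then show "continuous_on (chart_img c \<times> UNIV) (\<lambda>z. case tangent_param c z of (x, v) \<Rightarrow> differential A f x v)"
    by (rule continuous_on_eq) (rule differential_tangent_param[OF f c, symmetric])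
qed

lemma measurable_tangent_borelI:
  fixes \<theta> :: "'b::topological_space \<Rightarrow> 'm \<times> ('m, 'e) tvec"
  assumes \<theta>: "continuous_map (top_of_set K) (tangent_topology A) \<theta>"
  shows "\<theta> \<in> measurable (restrict_space borel K) (tangent_borel A)"
  unfolding tangent_borel_def
proof (rule measurable_measure_of)
  show "{W. openin (tangent_topology A) W} \<subseteq> Pow (tangent_bundle A)" using openin_tangent_subset by blast
  have "topspace (tangent_topology A) \<subseteq> tangent_bundle A" by (rule openin_tangent_subset[OF openin_topspace])
  then show "\<theta> \<in> space (restrict_space borel K) \<rightarrow> tangent_bundle A"
    using continuous_map_image_subset_topspace[OF \<theta>] by (auto simp: space_restrict_space)
  fix W assume "W \<in> {W. openin (tangent_topology A) W}"
  then have "openin (top_of_set K) {z \<in> K. \<theta> z \<in> W}" using openin_continuous_map_preimage[OF \<theta>] by simp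
  then obtain T where "open T" "{z \<in> K. \<theta> z \<in> W} = K \<inter> T" by (auto simp: openin_open)
  moreover have "\<theta> -` W \<inter> space (restrict_space borel K) = {z \<in> K. \<theta> z \<in> W}"
    by (auto simp: space_restrict_space)
  ultimately show "\<theta> -` W \<inter> space (restrict_space borel K) \<in> sets (restrict_space borel K)"
    by (auto simp: sets_restrict_space)
qed

end

section \<open>Riemannian metrics in charts\<close>

locale riemannian_atlas = atlas A for A :: "('m::t2_space, 'e::euclidean_space) chart set" +
  fixes g :: "'m \<Rightarrow> ('m, 'e) tvec \<Rightarrow> ('m, 'e) tvec \<Rightarrow> real"
  assumes metric: "riemannian_metric A g"
begin

definition chart_metric :: "('m, 'e) chart \<Rightarrow> 'e \<Rightarrow> 'e \<Rightarrow> 'e \<Rightarrow> real" where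
  "chart_metric c y v w = g (chart_inv c y) (coord_vector A c (chart_inv c y) v) (coord_vector A c (chart_inv c y) w)"

definition chart_norm :: "('m, 'e) chart \<Rightarrow> 'e \<Rightarrow> 'e \<Rightarrow> real" where
  "chart_norm c y w = tnorm g (chart_inv c y) (coord_vector A c (chart_inv c y) w)"

lemma chart_norm_eq_sqrt: "chart_norm c y w = sqrt (chart_metric c y w w)"
  by (simp add: chart_norm_def tnorm_def chart_metric_def)

lemma bilinear_chart_metric:
  assumes c: "c \<in> A" "y \<in> chart_img c"
  shows "bilinear (chart_metric c y)"
proof -
  have x: "chart_inv c y \<in> chart_dom c" using c by simp
  note tangent = coord_vector_in_tangent_space[OF c(1) x]
  have left: "chart_metric c y (a *\<^sub>R u + b *\<^sub>R v) w = a * chart_metric c y u w + b * chart_metric c y v w" for a b u v w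
    using metric tangent unfolding riemannian_metric_def chart_metric_def by (simp add: coord_vector_combination[OF c(1) x])
  have linear_left: "linear (\<lambda>v. chart_metric c y v w)" for w
    using left[of 1 _ 1] left[of _ _ 0 0] by (intro linearI) auto
  have symmetric: "chart_metric c y v w = chart_metric c y w v" for v w
    using metric tangent unfolding riemannian_metric_def chart_metric_def by blast
  have "linear (chart_metric c y v)" for v
    using linear_left[of v] by (simp only: symmetric[of _ v])
  with linear_left show ?thesis by (simp add: bilinear_def)
qed

lemma chart_metric_eq_sum:
  assumes c: "c \<in> A" "y \<in> chart_img c"
  shows "chart_metric c y v w = (\<Sum>i\<in>Basis. \<Sum>j\<in>Basis. (v \<bullet> i) * (w \<bullet> j) * chart_metric c y i j)"
proof -
  have lin: "linear (\<lambda>v. chart_metric c y v w)" "linear (chart_metric c y v)" for v w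
    using bilinear_chart_metric[OF c] by (simp_all add: bilinear_def)
  have right: "chart_metric c y i w = (\<Sum>j\<in>Basis. (w \<bullet> j) * chart_metric c y i j)" for i
    using linear_eq_sum_Basis[OF lin(2)[of i], of w] by simp
  have "chart_metric c y v w = (\<Sum>i\<in>Basis. (v \<bullet> i) * chart_metric c y i w)"
    using linear_eq_sum_Basis[OF lin(1)[of w], of v] by simp
  also have "\<dots> = (\<Sum>i\<in>Basis. (v \<bullet> i) * (\<Sum>j\<in>Basis. (w \<bullet> j) * chart_metric c y i j))"
    by (simp only: right)
  finally show ?thesis by (simp add: sum_distrib_left mult.assoc)
qed

lemma continuous_on_chart_norm:
  assumes c: "c \<in> A"
  shows "continuous_on (chart_img c \<times> UNIV) (\<lambda>z. chart_norm c (fst z) (snd z))"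
proof -
  have "continuous_on (chart_img c) (\<lambda>y. chart_metric c y i j)" for i j
  proof -
    have "smooth_on (chart_img c) (\<lambda>y. chart_metric c y i j)"
      using metric c unfolding riemannian_metric_def chart_metric_def by blast
    then have "Ck_on 0 (chart_img c) (\<lambda>y. chart_metric c y i j)" unfolding smooth_on_def by blast
    then show ?thesis by simp
  qed
  then have "continuous_on (chart_img c \<times> UNIV) (\<lambda>z :: 'e \<times> 'e. chart_metric c (fst z) i j)" for i j
    by (rule continuous_on_compose2) (auto intro!: continuous_intros)
  then have "continuous_on (chart_img c \<times> UNIV)
      (\<lambda>z. sqrt (\<Sum>i\<in>Basis. \<Sum>j\<in>Basis. (snd z \<bullet> i) * (snd z \<bullet> j) * chart_metric c (fst z) i j))"
    by (intro continuous_intros)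
  then show ?thesis
    by (rule continuous_on_eq) (use chart_metric_eq_sum[OF c] in \<open>auto simp: chart_norm_eq_sqrt\<close>)
qed

lemma chart_norm_scaleR:
  assumes "c \<in> A" "y \<in> chart_img c"
  shows "chart_norm c y (s *\<^sub>R w) = \<bar>s\<bar> * chart_norm c y w"
proof -
  have "chart_metric c y (s *\<^sub>R w) (s *\<^sub>R w) = s\<^sup>2 * chart_metric c y w w"
    using bilinear_chart_metric[OF assms] by (simp add: bilinear_lmul bilinear_rmul power2_eq_square)
  then show ?thesis by (simp add: chart_norm_eq_sqrt real_sqrt_mult)
qed

lemma chart_norm_pos:
  assumes c: "c \<in> A" "y \<in> chart_img c" and w: "w \<noteq> 0"
  shows "0 < chart_norm c y w"
proof -
  have x: "chart_inv c y \<in> chart_dom c" using c by simp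
  have "coord_vector A c (chart_inv c y) w \<noteq> (\<lambda>c. 0)"
    using coord_vector_self[OF c(1) x, of w] w by metis
  then have "0 < chart_metric c y w w"
    using metric coord_vector_in_tangent_space[OF c(1) x]
    unfolding riemannian_metric_def chart_metric_def by blast
  then show ?thesis by (simp add: chart_norm_eq_sqrt)
qed

lemma chart_norm_nonneg: "c \<in> A \<Longrightarrow> y \<in> chart_img c \<Longrightarrow> 0 \<le> chart_norm c y w"
  using chart_norm_pos[of c y w] chart_norm_scaleR[of c y 0 0] by (cases "w = 0") auto

lemma tnorm_tangent_param: "(case tangent_param c z of (x, v) \<Rightarrow> tnorm g x v) = chart_norm c (fst z) (snd z)"
  by (simp add: tangent_param_def chart_norm_def case_prod_beta)

lemma tnorm_nonneg:
  assumes v: "(x, v) \<in> tangent_bundle A"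
  shows "0 \<le> tnorm g x v"
proof -
  obtain c where c: "c \<in> A" "x \<in> chart_dom c" using chart_cover by blast
  then show ?thesis
    using chart_norm_nonneg[of c "chart_map c x" "v c"] tnorm_tangent_param[of c "(chart_map c x, v c)"]
    by (simp add: tangent_param_component[OF v c])
qed

lemma borel_measurable_tnorm: "(\<lambda>(x, v). tnorm g x v) \<in> borel_measurable (tangent_borel A)"
  by (rule borel_measurable_tangent_borelI) (simp only: tnorm_tangent_param continuous_on_chart_norm)

lemma chart_norm_lower_bound:
  assumes c: "c \<in> A" and Q: "compact Q" "Q \<subseteq> chart_img c"
  shows "\<exists>m>0. \<forall>y\<in>Q. \<forall>w. m * norm w \<le> chart_norm c y w"
proof -
  let ?K = "Q \<times> sphere (0::'e) 1"
  have "\<exists>m>0. \<forall>(y, e)\<in>?K. m \<le> chart_norm c y e"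
  proof (cases "?K = {}")
    case False
    have "compact ?K" using Q(1) by (intro compact_Times compact_sphere)
    moreover have "continuous_on ?K (\<lambda>z. chart_norm c (fst z) (snd z))"
      by (rule continuous_on_subset[OF continuous_on_chart_norm[OF c]]) (use Q(2) in auto)
    ultimately obtain z where z: "z \<in> ?K" "\<forall>z'\<in>?K. chart_norm c (fst z) (snd z) \<le> chart_norm c (fst z') (snd z')"
      using continuous_attains_inf[OF _ False] by blast
    moreover have "0 < chart_norm c (fst z) (snd z)" using z(1) Q(2) by (intro chart_norm_pos c) auto
    ultimately show ?thesis by (intro exI[of _ "chart_norm c (fst z) (snd z)"]) auto
  qed (auto intro!: exI[of _ 1])
  then obtain m where m: "m > 0" "\<And>y e. y \<in> Q \<Longrightarrow> norm e = 1 \<Longrightarrow> m \<le> chart_norm c y e" by force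
  have "m * norm w \<le> chart_norm c y w" if y: "y \<in> Q" for y w
  proof -
    have "m * norm w \<le> norm w * chart_norm c y (sgn w)"
      using m(2)[OF y, of "sgn w"] by (cases "w = 0") (simp_all add: norm_sgn mult.commute)
    also have "\<dots> = chart_norm c y (norm w *\<^sub>R sgn w)"
      using y Q(2) by (subst chart_norm_scaleR[OF c]) auto
    also have "norm w *\<^sub>R sgn w = w" by (cases "w = 0") (simp_all add: sgn_div_norm)
    finally show ?thesis .
  qed
  with m(1) show ?thesis by blast
qed

lemma inner_le_conorm:
  assumes c: "c \<in> A" "y \<in> chart_img c" and w: "chart_norm c y w \<le> 1"
  shows "p \<bullet> w \<le> conorm A g (chart_inv c y) (covec_of A c (chart_inv c y) p)"
proof -
  let ?x = "chart_inv c y" and ?V = "{v \<in> tangent_space A (chart_inv c y). tnorm g (chart_inv c y) v \<le> 1}"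
  have x: "?x \<in> chart_dom c" using c by simp
  obtain m where m: "m > 0" "\<And>w. m * norm w \<le> chart_norm c y w"
    using chart_norm_lower_bound[OF c(1), of "{y}"] c(2) by auto
  have "covec_of A c ?x p v \<le> norm p * (1 / m)" if v: "v \<in> ?V" for v
  proof -
    have "chart_norm c y (v c) \<le> 1" using v c x by (simp add: chart_norm_def coord_vector_component)
    then have "norm (v c) \<le> 1 / m" using m(2)[of "v c"] m(1) by (simp add: field_simps)
    then have "norm p * norm (v c) \<le> norm p * (1 / m)" by (intro mult_left_mono) auto
    moreover have "p \<bullet> v c \<le> norm p * norm (v c)" by (rule norm_cauchy_schwarz)
    ultimately show ?thesis using v by (simp add: covec_of_apply)
  qed
  then have bdd: "bdd_above (covec_of A c ?x p ` ?V)" by (intro bdd_aboveI[of _ "norm p * (1 / m)"]) auto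
  have tangent: "coord_vector A c ?x w \<in> tangent_space A ?x" by (rule coord_vector_in_tangent_space[OF c(1) x])
  then have "covec_of A c ?x p (coord_vector A c ?x w) \<le> conorm A g ?x (covec_of A c ?x p)"
    unfolding conorm_def using w by (intro cSUP_upper[OF _ bdd]) (simp add: chart_norm_def)
  then show ?thesis using tangent by (simp add: covec_of_apply coord_vector_self[OF c(1) x])
qed

end

section \<open>Hamiltonians in charts\<close>

locale hamiltonian = riemannian_atlas A g
  for A :: "('m::t2_space, 'e::euclidean_space) chart set"
    and g :: "'m \<Rightarrow> ('m, 'e) tvec \<Rightarrow> ('m, 'e) tvec \<Rightarrow> real" +
  fixes G :: "'m \<times> ('m, 'e) covec \<Rightarrow> real"
  assumes compact_manifold: "compact (UNIV :: 'm set)"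
    and continuous_G: "continuous_map (cotangent_topology A) euclideanreal G"
    and convex_G: "convex_in_p A G"
    and superlinear_G: "superlinear_in_p A g G"
begin

definition chart_hamiltonian :: "('m, 'e) chart \<Rightarrow> 'e \<Rightarrow> 'e \<Rightarrow> real" where
  "chart_hamiltonian c y p = G (cotangent_param c (y, p))"

lemma continuous_on_chart_hamiltonian:
  assumes "c \<in> A"
  shows "continuous_on (chart_img c \<times> UNIV) (\<lambda>(y, p). chart_hamiltonian c y p)"
  using continuous_map_compose[OF continuous_map_cotangent_param[OF assms] continuous_G]
  by (simp add: o_def chart_hamiltonian_def case_prod_beta)

lemma continuous_chart_hamiltonian:
  assumes "c \<in> A" "y \<in> chart_img c"
  shows "continuous_on UNIV (chart_hamiltonian c y)"
proof -
  have "continuous_on UNIV (\<lambda>p. case (y, p) of (y, p) \<Rightarrow> chart_hamiltonian c y p)"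
    by (rule continuous_on_compose2[OF continuous_on_chart_hamiltonian[OF assms(1)]])
      (use assms(2) in \<open>auto intro!: continuous_intros\<close>)
  then show ?thesis by simp
qed

lemma convex_on_chart_hamiltonian: "convex_on UNIV (chart_hamiltonian c y)"
proof (rule convex_onI)
  fix t :: real and p q :: 'e assume t: "0 < t" "t < 1"
  let ?x = "chart_inv c y"
  have "G (?x, \<lambda>v. (1 - t) * covec_of A c ?x p v + t * covec_of A c ?x q v)
      \<le> (1 - t) * G (?x, covec_of A c ?x p) + t * G (?x, covec_of A c ?x q)"
    using convex_G t covec_of_in_cotangent_space[of c ?x] unfolding convex_in_p_def by auto
  then show "chart_hamiltonian c y ((1 - t) *\<^sub>R p + t *\<^sub>R q)
      \<le> (1 - t) * chart_hamiltonian c y p + t * chart_hamiltonian c y q"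
    by (simp add: chart_hamiltonian_def cotangent_param_def covec_of_combination)
qed simp

lemma ray_superlinear_chart_hamiltonian:
  assumes c: "c \<in> A" "y \<in> chart_img c"
  shows "ray_superlinear (chart_hamiltonian c y)"
  unfolding ray_superlinear_def
proof (intro allI impI)
  fix q :: 'e and C :: real assume q: "q \<noteq> 0"
  let ?x = "chart_inv c y" and ?P = "\<lambda>t. covec_of A c (chart_inv c y) (t *\<^sub>R q)"
  let ?norm = "\<lambda>t. conorm A g ?x (?P t)"
  define n where "n = q \<bullet> (q /\<^sub>R chart_norm c y q)"
  have n: "n > 0" using q chart_norm_pos[OF c q] by (simp add: n_def)
  have norm_ge: "t * n \<le> ?norm t" for t
    using inner_le_conorm[OF c, of "q /\<^sub>R chart_norm c y q" "t *\<^sub>R q"] chart_norm_pos[OF c q]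
    by (simp add: chart_norm_scaleR[OF c] n_def mult.left_commute)
  define Z where "Z = (\<bar>C\<bar> + 1) / n"
  have "\<forall>\<^sub>F P in inf (filtercomap (conorm A g ?x) at_top) (principal (cotangent_space A ?x)).
      Z \<le> G (?x, P) / conorm A g ?x P"
    using superlinear_G unfolding superlinear_in_p_def filterlim_at_top by blast
  then obtain K where K: "\<And>P. K \<le> conorm A g ?x P \<Longrightarrow> P \<in> cotangent_space A ?x \<Longrightarrow> Z \<le> G (?x, P) / conorm A g ?x P"
    unfolding eventually_inf_principal eventually_filtercomap_at_top_linorder by blast
  define t where "t = max 1 (K / n)"
  have t: "t \<ge> 1" "K \<le> t * n" "0 < t * n" using n by (auto simp: t_def max_def field_simps)
  have "C * t < (\<bar>C\<bar> + 1) * t" using t by (intro mult_strict_right_mono) auto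
  also have "\<dots> = Z * (t * n)" using n by (simp add: Z_def)
  also have "\<dots> \<le> Z * ?norm t" using norm_ge[of t] n by (intro mult_left_mono) (auto simp: Z_def)
  also have "\<dots> \<le> G (?x, ?P t)"
    using K[OF _ covec_of_in_cotangent_space, of c "t *\<^sub>R q"] norm_ge[of t] t by (simp add: field_simps)
  finally show "\<exists>t\<ge>1. C * t < chart_hamiltonian c y (t *\<^sub>R q)"
    using t(1) by (auto simp: chart_hamiltonian_def cotangent_param_def)
qed

lemma chart_hamiltonian_coercive:
  assumes c: "c \<in> A" and Q: "compact Q" "Q \<subseteq> chart_img c"
  shows "\<exists>B. \<forall>y\<in>Q. \<forall>p. chart_hamiltonian c y p \<le> a \<longrightarrow> norm p \<le> B"
  using Q(1) continuous_on_subset[OF continuous_on_chart_hamiltonian[OF c]]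
proof (rule ray_superlinear_sublevels_bounded)
  show "Q \<times> UNIV \<subseteq> chart_img c \<times> UNIV" using Q(2) by auto
  show "ray_superlinear (chart_hamiltonian c y)" if "y \<in> Q" for y
    using that Q(2) by (intro ray_superlinear_chart_hamiltonian c) auto
qed (rule convex_on_chart_hamiltonian)

lemma fenchel_young_chart:
  assumes "c \<in> A" "y \<in> chart_img c"
  shows "p \<bullet> w - chart_hamiltonian c y p \<le> fenchel_conjugate (chart_hamiltonian c y) w"
  by (intro fenchel_young continuous_chart_hamiltonian convex_on_chart_hamiltonian
      ray_superlinear_chart_hamiltonian assms)

lemma Lagrangian_tangent_param:
  assumes c: "c \<in> A" and z: "z \<in> chart_img c \<times> UNIV"
  shows "Lagrangian A G (tangent_param c z) = fenchel_conjugate (chart_hamiltonian c (fst z)) (snd z)"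
proof -
  obtain y w where z_eq: "z = (y, w)" and y: "y \<in> chart_img c" using z by auto
  have x: "chart_inv c y \<in> chart_dom c" using c y by simp
  show ?thesis
    using coord_vector_in_tangent_space[OF c x, of w] coord_vector_self[OF c x, of w]
    by (simp add: z_eq tangent_param_def Lagrangian_def cotangent_space_eq_range_covec_of[OF c x] image_image
        covec_of_apply fenchel_conjugate_def chart_hamiltonian_def cotangent_param_def)
qed

lemma continuous_on_fenchel_conjugate_chart:
  assumes c: "c \<in> A"
  shows "continuous_on (chart_img c \<times> UNIV) (\<lambda>(y, w). fenchel_conjugate (chart_hamiltonian c y) w)"
proof (intro continuous_at_imp_continuous_on ballI)
  fix z :: "'e \<times> 'e" assume z: "z \<in> chart_img c \<times> UNIV"
  obtain r where r: "r > 0" "cball (fst z) r \<subseteq> chart_img c"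
    using open_chart_img[OF c] z open_contains_cball by (metis mem_Times_iff)
  let ?B = "cball (fst z) r" and ?W = "cball (snd z) 1"
  have "continuous_on (?B \<times> ?W) (\<lambda>(y, w). fenchel_conjugate (chart_hamiltonian c y) w)"
  proof (rule continuous_on_fenchel_conjugate)
    show "continuous_on (?B \<times> UNIV) (\<lambda>(y, p). chart_hamiltonian c y p)"
      by (rule continuous_on_subset[OF continuous_on_chart_hamiltonian[OF c]]) (use r(2) in auto)
    show "ray_superlinear (chart_hamiltonian c y)" if "y \<in> ?B" for y
      using that r(2) by (intro ray_superlinear_chart_hamiltonian c) auto
  qed (auto intro: convex_on_chart_hamiltonian)
  moreover have "z \<in> interior (?B \<times> ?W)" using r(1) by (simp add: interior_Times mem_Times_iff)
  ultimately show "isCont (\<lambda>(y, w). fenchel_conjugate (chart_hamiltonian c y) w) z"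
    by (rule continuous_on_interior)
qed

lemma borel_measurable_Lagrangian: "Lagrangian A G \<in> borel_measurable (tangent_borel A)"
proof (rule borel_measurable_tangent_borelI)
  fix c assume c: "c \<in> A"
  show "continuous_on (chart_img c \<times> UNIV) (\<lambda>z. Lagrangian A G (tangent_param c z))"
    using continuous_on_fenchel_conjugate_chart[OF c]
    by (rule continuous_on_eq) (simp add: Lagrangian_tangent_param[OF c] case_prod_beta)
qed

lemma ex_contact_covector:
  assumes u1: "viscosity_solution A G k u1" and u2: "viscosity_solution A G k u2" and \<phi>: "\<phi> \<in> C1_functions A"
    and s: "0 < s" "s < 1" and c: "c \<in> A" "y \<in> chart_img c"
    and max: "\<And>x. (1 - s) * u1 x + s * \<phi> x - u2 x
      \<le> (1 - s) * u1 (chart_inv c y) + s * \<phi> (chart_inv c y) - u2 (chart_inv c y)"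
  shows "\<exists>q. chart_hamiltonian c y q \<le> k \<and> k \<le> chart_hamiltonian c y ((1 - s) *\<^sub>R q + s *\<^sub>R chart_gradient c \<phi> y)"
proof (rule doubling_of_variables[OF open_chart_img[OF c(1)] c(2) s])
  show "viscosity_subsolution_on (chart_img c) (chart_hamiltonian c) k (\<lambda>y. u1 (chart_inv c y))"
    "viscosity_supersolution_on (chart_img c) (chart_hamiltonian c) k (\<lambda>y. u2 (chart_inv c y))"
    using viscosity_solution_in_chart[OF u1 c(1)] viscosity_solution_in_chart[OF u2 c(1)]
    by (simp_all add: chart_hamiltonian_def[abs_def])
  show "continuous_on (chart_img c) (\<lambda>y. u1 (chart_inv c y))" "continuous_on (chart_img c) (\<lambda>y. u2 (chart_inv c y))"
    using u1 u2 by (auto simp: viscosity_solution_def intro!: continuous_on_in_chart c)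
qed (use max in \<open>auto intro!: Ck_on_1_chart[OF \<phi> c(1)] continuous_on_chart_hamiltonian[OF c(1)]
      chart_hamiltonian_coercive[OF c(1)] simp del: Ck_on.simps One_nat_def\<close>)

lemma finite_compact_chart_cover:
  obtains I :: "'m set" and cs :: "'m \<Rightarrow> ('m, 'e) chart" and Q :: "'m \<Rightarrow> 'e set"
  where "finite I" "\<And>i. cs i \<in> A" "\<And>i. compact (Q i)" "\<And>i. Q i \<subseteq> chart_img (cs i)"
    "\<And>x. \<exists>i\<in>I. x \<in> chart_dom (cs i) \<and> chart_map (cs i) x \<in> Q i"
proof -
  have "\<exists>c r. c \<in> A \<and> x \<in> chart_dom c \<and> r > 0 \<and> cball (chart_map c x) r \<subseteq> chart_img c" for x
  proof -
    obtain c where c: "c \<in> A" "x \<in> chart_dom c" using chart_cover by blast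
    obtain r where "r > 0" "cball (chart_map c x) r \<subseteq> chart_img c"
      using open_chart_img[OF c(1), unfolded open_contains_cball] chart_map_img[OF c] by blast
    with c show ?thesis by blast
  qed
  then obtain c r where c: "\<And>x. c x \<in> A" "\<And>x. x \<in> chart_dom (c x)" and r: "\<And>x. r x > (0::real)"
    "\<And>x. cball (chart_map (c x) x) (r x) \<subseteq> chart_img (c x)" by metis
  define U where "U x = chart_dom (c x) \<inter> chart_map (c x) -` ball (chart_map (c x) x) (r x)" for x
  have "open (U x)" for x unfolding U_def
    by (intro continuous_open_preimage continuous_on_chart_map open_chart_dom c open_ball)
  moreover have "UNIV \<subseteq> (\<Union>x\<in>UNIV. U x)" using c r by (auto simp: U_def)
  ultimately obtain I where I: "finite I" "UNIV \<subseteq> (\<Union>x\<in>I. U x)"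
    using compactE_image[OF compact_manifold, of UNIV U] by metis
  show ?thesis
  proof (rule that[of I c "\<lambda>i. cball (chart_map (c i) i) (r i)"])
    fix x
    obtain i where "i \<in> I" "x \<in> U i" using I(2) by blast
    then show "\<exists>i\<in>I. x \<in> chart_dom (c i) \<and> chart_map (c i) x \<in> cball (chart_map (c i) i) (r i)"
      by (auto simp: U_def less_imp_le)
  qed (use I(1) c r in auto)
qed

end

section \<open>A compact parameter space for the manifold\<close>

text \<open>A point of the manifold is labelled by the index of a chart and by its coordinates in that chart.
  The discrete metric on the indices makes the set of labels a compact metric space.\<close>

locale hamiltonian_cover = hamiltonian A g G
  for A :: "('m::t2_space, 'e::euclidean_space) chart set"
    and g :: "'m \<Rightarrow> ('m, 'e) tvec \<Rightarrow> ('m, 'e) tvec \<Rightarrow> real"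
    and G :: "'m \<times> ('m, 'e) covec \<Rightarrow> real" +
  fixes I :: "'i discrete set" and cs :: "'i discrete \<Rightarrow> ('m, 'e) chart" and Q :: "'i discrete \<Rightarrow> 'e set"
  assumes finite_indices: "finite I"
    and chart_in_atlas: "\<And>i. i \<in> I \<Longrightarrow> cs i \<in> A"
    and compact_piece: "\<And>i. i \<in> I \<Longrightarrow> compact (Q i)"
    and piece_subset: "\<And>i. i \<in> I \<Longrightarrow> Q i \<subseteq> chart_img (cs i)"
    and pieces_cover: "\<And>x. \<exists>i\<in>I. x \<in> chart_dom (cs i) \<and> chart_map (cs i) x \<in> Q i"
begin

definition labels :: "('i discrete \<times> 'e) set" where
  "labels = Sigma I Q"

definition base_point :: "'i discrete \<times> 'e \<Rightarrow> 'm" where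
  "base_point z = chart_inv (cs (fst z)) (snd z)"

definition label_hamiltonian :: "'i discrete \<times> 'e \<Rightarrow> 'e \<Rightarrow> real" where
  "label_hamiltonian z = chart_hamiltonian (cs (fst z)) (snd z)"

definition label_gradient :: "('m \<Rightarrow> real) \<Rightarrow> 'i discrete \<times> 'e \<Rightarrow> 'e" where
  "label_gradient \<phi> z = chart_gradient (cs (fst z)) \<phi> (snd z)"

definition label_tangent :: "('i discrete \<times> 'e) \<times> 'e \<Rightarrow> 'm \<times> ('m, 'e) tvec" where
  "label_tangent w = tangent_param (cs (fst (fst w))) (snd (fst w), snd w)"

lemma compact_labels: "compact labels"
proof -
  have "labels = (\<Union>i\<in>I. {i} \<times> Q i)" by (auto simp: labels_def)
  then show ?thesis by (auto intro!: compact_UN compact_Times compact_piece finite_indices)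
qed

lemma label_in_chart:
  assumes "z \<in> labels"
  shows "cs (fst z) \<in> A" "snd z \<in> chart_img (cs (fst z))"
proof -
  have "fst z \<in> I" "snd z \<in> Q (fst z)" using assms by (auto simp: labels_def)
  then show "cs (fst z) \<in> A" "snd z \<in> chart_img (cs (fst z))" using chart_in_atlas piece_subset by blast+
qed

lemma ex_label:
  obtains z where "z \<in> labels" "base_point z = x"
proof -
  obtain i where i: "i \<in> I" "x \<in> chart_dom (cs i)" "chart_map (cs i) x \<in> Q i" using pieces_cover by blast
  then show ?thesis by (intro that[of "(i, chart_map (cs i) x)"]) (simp_all add: labels_def base_point_def chart_in_atlas)
qed

lemma continuous_map_labels_Times:
  assumes F: "\<And>i. i \<in> I \<Longrightarrow> continuous_map (top_of_set (chart_img (cs i) \<times> UNIV)) Y (F i)"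
  shows "continuous_map (top_of_set (labels \<times> UNIV)) Y (\<lambda>w. F (fst (fst w)) (snd (fst w), snd w))"
proof (rule pasting_lemma[where I = I and T = "\<lambda>i. (labels \<times> UNIV) \<inter> ({i} \<times> UNIV) \<times> UNIV"
      and f = "\<lambda>i w. F i (snd (fst w), snd w)"])
  fix i assume i: "i \<in> I"
  show "openin (top_of_set (labels \<times> UNIV)) ((labels \<times> UNIV) \<inter> ({i} \<times> UNIV) \<times> UNIV)"
    by (intro openin_open_Int open_Times open_UNIV open_discrete)
  have "continuous_map (top_of_set ((labels \<times> UNIV) \<inter> ({i} \<times> UNIV) \<times> UNIV))
      (top_of_set (chart_img (cs i) \<times> UNIV)) (\<lambda>w. (snd (fst w), snd w))"
    using piece_subset[OF i]
    by (intro continuous_map_into_subtopology) (auto simp: labels_def intro!: continuous_intros)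
  from continuous_map_compose[OF this F[OF i]]
  show "continuous_map (subtopology (top_of_set (labels \<times> UNIV)) ((labels \<times> UNIV) \<inter> ({i} \<times> UNIV) \<times> UNIV)) Y
      (\<lambda>w. F i (snd (fst w), snd w))"
    by (simp add: o_def subtopology_subtopology Int_absorb1)
qed (auto simp: labels_def)

lemma continuous_on_labels:
  fixes f :: "'i discrete \<Rightarrow> 'e \<Rightarrow> 'c::topological_space"
  assumes f: "\<And>i. i \<in> I \<Longrightarrow> continuous_on (chart_img (cs i)) (f i)"
  shows "continuous_on labels (\<lambda>z. f (fst z) (snd z))"
proof -
  have "continuous_map (top_of_set (chart_img (cs i) \<times> UNIV)) euclidean (\<lambda>w :: 'e \<times> 'e. f i (fst w))"
    if "i \<in> I" for i
    by (auto intro!: continuous_on_compose2[OF f[OF that]] continuous_intros)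
  from continuous_map_labels_Times[OF this]
  have "continuous_on (labels \<times> (UNIV :: 'e set)) (\<lambda>w. f (fst (fst w)) (snd (fst w)))" by simp
  then have "continuous_on labels (\<lambda>z. f (fst (fst (z, 0 :: 'e))) (snd (fst (z, 0 :: 'e))))"
    by (rule continuous_on_compose2) (auto intro!: continuous_intros)
  then show ?thesis by simp
qed

lemma continuous_on_comp_base_point:
  "continuous_on UNIV u \<Longrightarrow> continuous_on labels (\<lambda>z. u (base_point z))"
  unfolding base_point_def by (intro continuous_on_labels continuous_on_in_chart chart_in_atlas)

lemma continuous_on_label_gradient: "\<phi> \<in> C1_functions A \<Longrightarrow> continuous_on labels (label_gradient \<phi>)"
  unfolding label_gradient_def[abs_def] by (intro continuous_on_labels continuous_on_gradient Ck_on_1_chart chart_in_atlas)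

lemma continuous_on_label_hamiltonian: "continuous_on (labels \<times> UNIV) (\<lambda>(z, p). label_hamiltonian z p)"
proof -
  have "continuous_map (top_of_set (chart_img (cs i) \<times> UNIV)) euclidean (\<lambda>(y, p). chart_hamiltonian (cs i) y p)"
    if "i \<in> I" for i
    using continuous_on_chart_hamiltonian[OF chart_in_atlas[OF that]] by simp
  from continuous_map_labels_Times[OF this] show ?thesis
    by (simp add: label_hamiltonian_def case_prod_beta)
qed

lemma convex_on_label_hamiltonian: "convex_on UNIV (label_hamiltonian z)"
  unfolding label_hamiltonian_def by (rule convex_on_chart_hamiltonian)

lemma ray_superlinear_label_hamiltonian: "z \<in> labels \<Longrightarrow> ray_superlinear (label_hamiltonian z)"
  unfolding label_hamiltonian_def by (intro ray_superlinear_chart_hamiltonian label_in_chart)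

lemma continuous_map_label_tangent: "continuous_map (top_of_set (labels \<times> UNIV)) (tangent_topology A) label_tangent"
  unfolding label_tangent_def[abs_def]
  by (intro continuous_map_labels_Times continuous_map_tangent_param chart_in_atlas)

lemma fst_label_tangent: "fst (label_tangent w) = base_point (fst w)"
  by (simp add: label_tangent_def fst_tangent_param base_point_def)

lemma Lagrangian_label_tangent:
  "w \<in> labels \<times> UNIV \<Longrightarrow> Lagrangian A G (label_tangent w) = fenchel_conjugate (label_hamiltonian (fst w)) (snd w)"
  using label_in_chart[of "fst w"] by (auto simp: label_tangent_def label_hamiltonian_def Lagrangian_tangent_param)

lemma differential_label_tangent:
  "w \<in> labels \<times> UNIV \<Longrightarrow> \<phi> \<in> C1_functions A \<Longrightarrow>
    (case label_tangent w of (x, v) \<Rightarrow> differential A \<phi> x v) = label_gradient \<phi> (fst w) \<bullet> snd w"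
  using label_in_chart[of "fst w"] by (auto simp: label_tangent_def label_gradient_def differential_tangent_param)

lemma tangent_bundle_cases:
  assumes "(x, v) \<in> tangent_bundle A"
  obtains w where "w \<in> labels \<times> UNIV" "label_tangent w = (x, v)"
proof -
  obtain z where z: "z \<in> labels" "base_point z = x" by (rule ex_label)
  have c: "cs (fst z) \<in> A" "snd z \<in> chart_img (cs (fst z))" by (rule label_in_chart[OF z(1)])+
  then have x: "x \<in> chart_dom (cs (fst z))" "chart_map (cs (fst z)) x = snd z"
    using z(2) by (auto simp: base_point_def)
  show ?thesis
    using z(1) tangent_param_component[OF assms c(1) x(1)]
    by (intro that[of "(z, v (cs (fst z)))"]) (simp_all add: label_tangent_def x(2))
qed

section \<open>Closed measures\<close>

lemma bdd_above_G_differential: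
  assumes \<phi>: "\<phi> \<in> C1_functions A"
  shows "bdd_above (range (\<lambda>x. G (x, differential A \<phi> x)))"
proof -
  let ?h = "\<lambda>z. label_hamiltonian z (label_gradient \<phi> z)"
  have "continuous_on labels (\<lambda>z. case (z, label_gradient \<phi> z) of (z, p) \<Rightarrow> label_hamiltonian z p)"
    by (rule continuous_on_compose2[OF continuous_on_label_hamiltonian])
      (auto intro!: continuous_intros continuous_on_label_gradient \<phi>)
  then have "bdd_above (?h ` labels)"
    by (intro bounded_imp_bdd_above compact_imp_bounded compact_continuous_image compact_labels) simp
  moreover have "range (\<lambda>x. G (x, differential A \<phi> x)) \<subseteq> ?h ` labels"
  proof
    fix r assume "r \<in> range (\<lambda>x. G (x, differential A \<phi> x))"
    then obtain x where r: "r = G (x, differential A \<phi> x)" by blast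
    obtain z where z: "z \<in> labels" "base_point z = x" by (rule ex_label)
    have "r = ?h z"
      using cotangent_param_chart_gradient[OF \<phi> label_in_chart[OF z(1)]] z(2)
      by (simp add: r label_hamiltonian_def label_gradient_def chart_hamiltonian_def base_point_def)
    with z(1) show "r \<in> ?h ` labels" by blast
  qed
  ultimately show ?thesis by (rule bdd_above_mono)
qed

lemma differential_le_Lagrangian:
  assumes \<phi>: "\<phi> \<in> C1_functions A" and v: "(x, v) \<in> tangent_bundle A"
  shows "differential A \<phi> x v - (SUP x. G (x, differential A \<phi> x)) \<le> Lagrangian A G (x, v)"
proof -
  obtain z w where zw: "(z, w) \<in> labels \<times> UNIV" "label_tangent (z, w) = (x, v)"
    using tangent_bundle_cases[OF v] by (metis surj_pair)
  then have z: "z \<in> labels" and x: "base_point z = x" using fst_label_tangent[of "(z, w)"] by auto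
  let ?p = "label_gradient \<phi> z"
  have "label_hamiltonian z ?p = G (x, differential A \<phi> x)"
    using cotangent_param_chart_gradient[OF \<phi> label_in_chart[OF z]] x
    by (simp add: label_hamiltonian_def label_gradient_def chart_hamiltonian_def base_point_def)
  also have "\<dots> \<le> (SUP x. G (x, differential A \<phi> x))"
    by (rule cSUP_upper[OF UNIV_I bdd_above_G_differential[OF \<phi>]])
  finally have "?p \<bullet> w - (SUP x. G (x, differential A \<phi> x)) \<le> ?p \<bullet> w - label_hamiltonian z ?p" by simp
  also have "\<dots> \<le> fenchel_conjugate (label_hamiltonian z) w"
    unfolding label_hamiltonian_def by (rule fenchel_young_chart[OF label_in_chart[OF z]])
  finally show ?thesis
    using differential_label_tangent[OF zw(1) \<phi>] Lagrangian_label_tangent[OF zw(1)] by (simp add: zw(2))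
qed

lemma differential_le_tnorm:
  assumes \<phi>: "\<phi> \<in> C1_functions A"
  shows "\<exists>C. \<forall>(x, v)\<in>tangent_bundle A. \<bar>differential A \<phi> x v\<bar> \<le> C * tnorm g x v"
proof -
  obtain B where B: "0 \<le> B" "\<And>z. z \<in> labels \<Longrightarrow> norm (label_gradient \<phi> z) \<le> B"
    using continuous_on_compact_bounded[OF compact_labels continuous_on_label_gradient[OF \<phi>]] by blast
  have "\<exists>m>0. \<forall>y\<in>Q i. \<forall>w. m * norm w \<le> chart_norm (cs i) y w" if "i \<in> I" for i
    by (rule chart_norm_lower_bound[OF chart_in_atlas compact_piece piece_subset, OF that that that])
  then obtain m where m: "\<And>i. i \<in> I \<Longrightarrow> m i > 0"
    "\<And>i y w. i \<in> I \<Longrightarrow> y \<in> Q i \<Longrightarrow> m i * norm w \<le> chart_norm (cs i) y w" by metis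
  define C where "C = (\<Sum>i\<in>I. B / m i)"
  have "\<bar>differential A \<phi> x v\<bar> \<le> C * tnorm g x v" if v: "(x, v) \<in> tangent_bundle A" for x v
  proof -
    obtain i y w where iyw: "((i, y), w) \<in> labels \<times> UNIV" "label_tangent ((i, y), w) = (x, v)"
      using tangent_bundle_cases[OF v] by (metis surj_pair)
    then have i: "i \<in> I" "y \<in> Q i" by (auto simp: labels_def)
    have tnorm: "tnorm g x v = chart_norm (cs i) y w"
      using iyw(2) tnorm_tangent_param[of "cs i" "(y, w)"] by (simp add: label_tangent_def)
    have "\<bar>differential A \<phi> x v\<bar> = \<bar>label_gradient \<phi> (i, y) \<bullet> w\<bar>"
      using differential_label_tangent[OF iyw(1) \<phi>] by (simp add: iyw(2))
    also have "\<dots> \<le> norm (label_gradient \<phi> (i, y)) * norm w" by (rule Cauchy_Schwarz_ineq2)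
    also have "\<dots> \<le> B * norm w" using iyw(1) by (intro mult_right_mono B) auto
    also have "\<dots> = B / m i * (m i * norm w)" using m(1)[OF i(1)] by simp
    also have "\<dots> \<le> B / m i * chart_norm (cs i) y w"
      using m(1)[OF i(1)] B(1) by (intro mult_left_mono m(2) i) auto
    also have "\<dots> \<le> C * chart_norm (cs i) y w"
    proof (rule mult_right_mono)
      show "B / m i \<le> C"
        unfolding C_def using finite_indices i(1) B(1) m(1) by (intro member_le_sum) (auto intro: divide_nonneg_pos)
      have "0 \<le> m i * norm w" using m(1)[OF i(1)] by simp
      then show "0 \<le> chart_norm (cs i) y w" using m(2)[OF i, of w] by linarith
    qed
    finally show ?thesis by (simp add: tnorm)
  qed
  then show ?thesis by blast
qed

lemma space_closed_prob_measure: "closed_prob_measure A g \<nu> \<Longrightarrow> space \<nu> = tangent_bundle A"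
  unfolding closed_prob_measure_def using sets_eq_imp_space_eq space_tangent_borel by metis

lemma integrable_differential:
  assumes \<nu>: "closed_prob_measure A g \<nu>" and \<phi>: "\<phi> \<in> C1_functions A"
  shows "integrable \<nu> (\<lambda>(x, v). differential A \<phi> x v)"
proof (rule integrableI_bounded)
  have sets: "sets \<nu> = sets (tangent_borel A)"
    and finite: "(\<integral>\<^sup>+ (x, v). ennreal (tnorm g x v) \<partial>\<nu>) < \<infinity>"
    using \<nu> by (auto simp: closed_prob_measure_def)
  show "(\<lambda>(x, v). differential A \<phi> x v) \<in> borel_measurable \<nu>"
    using borel_measurable_differential[OF \<phi>] by (simp cong: measurable_cong_sets add: sets)
  have tnorm_meas: "(\<lambda>z. ennreal (case z of (x, v) \<Rightarrow> tnorm g x v)) \<in> borel_measurable \<nu>"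
    using measurable_compose[OF borel_measurable_tnorm measurable_ennreal] by (simp cong: measurable_cong_sets add: sets)
  obtain C where C: "\<And>x v. (x, v) \<in> tangent_bundle A \<Longrightarrow> \<bar>differential A \<phi> x v\<bar> \<le> C * tnorm g x v"
    using differential_le_tnorm[OF \<phi>] by blast
  have "(\<integral>\<^sup>+ z. ennreal (norm (case z of (x, v) \<Rightarrow> differential A \<phi> x v)) \<partial>\<nu>)
      \<le> (\<integral>\<^sup>+ z. ennreal \<bar>C\<bar> * ennreal (case z of (x, v) \<Rightarrow> tnorm g x v) \<partial>\<nu>)"
  proof (rule nn_integral_mono)
    fix z assume "z \<in> space \<nu>"
    then obtain x v where z: "z = (x, v)" "(x, v) \<in> tangent_bundle A"
      using space_closed_prob_measure[OF \<nu>] by (cases z) auto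
    note nonneg = tnorm_nonneg[OF z(2)]
    have "\<bar>differential A \<phi> x v\<bar> \<le> \<bar>C\<bar> * tnorm g x v"
      using C[OF z(2)] mult_right_mono[OF abs_ge_self nonneg, of C] by linarith
    then show "ennreal (norm (case z of (x, v) \<Rightarrow> differential A \<phi> x v))
        \<le> ennreal \<bar>C\<bar> * ennreal (case z of (x, v) \<Rightarrow> tnorm g x v)"
      using nonneg by (simp add: z(1) ennreal_leI flip: ennreal_mult)
  qed
  also have "\<dots> = ennreal \<bar>C\<bar> * (\<integral>\<^sup>+ (x, v). ennreal (tnorm g x v) \<partial>\<nu>)"
    using nn_integral_cmult[OF tnorm_meas] by (simp add: case_prod_unfold)
  also have "\<dots> < \<infinity>" using finite by (simp add: ennreal_mult_less_top)
  finally show "(\<integral>\<^sup>+ z. ennreal (norm (case z of (x, v) \<Rightarrow> differential A \<phi> x v)) \<partial>\<nu>) < \<infinity>" .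
qed

lemma minus_critical_value_le_integral_Lagrangian:
  assumes \<nu>: "closed_prob_measure A g \<nu>" and L: "integrable \<nu> (Lagrangian A G)"
  shows "- critical_value A G \<le> (\<integral>z. Lagrangian A G z \<partial>\<nu>)"
proof -
  interpret prob_space \<nu> using \<nu> by (simp add: closed_prob_measure_def)
  have "- (\<integral>z. Lagrangian A G z \<partial>\<nu>) \<le> (SUP x. G (x, differential A \<phi> x))" if \<phi>: "\<phi> \<in> C1_functions A" for \<phi>
  proof -
    let ?s = "SUP x. G (x, differential A \<phi> x)"
    note d\<phi> = integrable_differential[OF \<nu> \<phi>]
    have "(\<integral>z. (case z of (x, v) \<Rightarrow> differential A \<phi> x v) - ?s \<partial>\<nu>) \<le> (\<integral>z. Lagrangian A G z \<partial>\<nu>)"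
    proof (rule integral_mono)
      show "integrable \<nu> (\<lambda>z. (case z of (x, v) \<Rightarrow> differential A \<phi> x v) - ?s)"
        by (intro Bochner_Integration.integrable_diff d\<phi>) simp
      show "(case z of (x, v) \<Rightarrow> differential A \<phi> x v) - ?s \<le> Lagrangian A G z" if "z \<in> space \<nu>" for z
        using that differential_le_Lagrangian[OF \<phi>] space_closed_prob_measure[OF \<nu>] by (cases z) auto
    qed (rule L)
    moreover have "(\<integral>z. (case z of (x, v) \<Rightarrow> differential A \<phi> x v) - ?s \<partial>\<nu>) = - ?s"
      using \<nu> \<phi> d\<phi> by (simp add: closed_prob_measure_def prob_space)
    ultimately show ?thesis by simp
  qed
  then have "- (\<integral>z. Lagrangian A G z \<partial>\<nu>) \<le> critical_value A G"
    unfolding critical_value_def using C1_const by (intro cINF_greatest) auto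
  then show ?thesis by simp
qed

section \<open>Mather measures over closed sets\<close>

lemma continuous_on_label_conjugate:
  "continuous_on (labels \<times> cball 0 R) (\<lambda>w. fenchel_conjugate (label_hamiltonian (fst w)) (snd w))"
proof -
  have "continuous_on (labels \<times> cball 0 R) (\<lambda>(z, v). fenchel_conjugate (label_hamiltonian z) v)"
    by (intro continuous_on_fenchel_conjugate compact_labels compact_cball continuous_on_label_hamiltonian
        convex_on_label_hamiltonian ray_superlinear_label_hamiltonian)
  then show ?thesis by (simp add: case_prod_unfold)
qed

lemma continuous_on_label_gradient_inner:
  "\<phi> \<in> C1_functions A \<Longrightarrow> continuous_on (labels \<times> UNIV) (\<lambda>w. label_gradient \<phi> (fst w) \<bullet> snd w)"
  by (intro continuous_intros continuous_on_compose2[OF continuous_on_label_gradient]) auto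

lemma measurable_label_tangent:
  assumes \<nu>: "borel_probability_on K \<nu>" and K: "K \<subseteq> labels \<times> UNIV"
  shows "label_tangent \<in> measurable \<nu> (tangent_borel A)"
  using measurable_tangent_borelI[OF continuous_map_from_subtopology_mono[OF continuous_map_label_tangent K]]
    sets_borel_probability_on[OF \<nu>] by (simp cong: measurable_cong_sets)

lemma closed_prob_measure_distr_label_tangent:
  assumes \<nu>: "borel_probability_on K \<nu>" and K: "compact K" "K \<subseteq> labels \<times> UNIV"
    and closed: "\<And>\<phi>. \<phi> \<in> C1_functions A \<Longrightarrow> (\<integral>w. label_gradient \<phi> (fst w) \<bullet> snd w \<partial>\<nu>) = 0"
  shows "closed_prob_measure A g (distr \<nu> (tangent_borel A) label_tangent)"
  unfolding closed_prob_measure_def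
proof (intro conjI ballI)
  interpret prob_space \<nu> by (rule prob_space_borel_probability_on[OF \<nu>])
  let ?\<mu> = "distr \<nu> (tangent_borel A) label_tangent"
  note meas = measurable_label_tangent[OF \<nu> K(2)] and space = space_borel_probability_on[OF \<nu>]
  show "prob_space ?\<mu>" by (rule prob_space_distr[OF meas])
  show "sets ?\<mu> = sets (tangent_borel A)" by simp
  show "(\<integral>(x, v). differential A \<phi> x v \<partial>?\<mu>) = 0" if \<phi>: "\<phi> \<in> C1_functions A" for \<phi>
  proof -
    have "(\<integral>(x, v). differential A \<phi> x v \<partial>?\<mu>) = (\<integral>w. (case label_tangent w of (x, v) \<Rightarrow> differential A \<phi> x v) \<partial>\<nu>)"
      by (rule integral_distr[OF meas borel_measurable_differential[OF \<phi>]])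
    also have "\<dots> = (\<integral>w. label_gradient \<phi> (fst w) \<bullet> snd w \<partial>\<nu>)"
      using space K(2) by (intro Bochner_Integration.integral_cong differential_label_tangent \<phi>) auto
    finally show ?thesis using closed[OF \<phi>] by simp
  qed
  have "continuous_on (labels \<times> UNIV) (\<lambda>w. case label_tangent w of (x, v) \<Rightarrow> tnorm g x v)"
  proof -
    have "continuous_map (top_of_set (chart_img (cs i) \<times> UNIV)) euclidean (\<lambda>w. chart_norm (cs i) (fst w) (snd w))"
      if "i \<in> I" for i
      using continuous_on_chart_norm[OF chart_in_atlas[OF that]] by simp
    from continuous_map_labels_Times[OF this] show ?thesis
      by (simp add: label_tangent_def tnorm_tangent_param)
  qed
  from continuous_on_compact_bounded[OF K(1) continuous_on_subset[OF this K(2)]]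
  obtain B where B: "\<And>w. w \<in> K \<Longrightarrow> norm (case label_tangent w of (x, v) \<Rightarrow> tnorm g x v) \<le> B" by metis
  have "(\<integral>\<^sup>+ (x, v). ennreal (tnorm g x v) \<partial>?\<mu>)
      = (\<integral>\<^sup>+ w. (case label_tangent w of (x, v) \<Rightarrow> ennreal (tnorm g x v)) \<partial>\<nu>)"
    using measurable_compose[OF borel_measurable_tnorm measurable_ennreal]
    by (intro nn_integral_distr[OF meas]) (simp add: case_prod_unfold)
  also have "\<dots> \<le> (\<integral>\<^sup>+ w. ennreal B \<partial>\<nu>)"
    using B space by (intro nn_integral_mono) (auto simp: case_prod_unfold abs_le_iff intro!: ennreal_leI)
  also have "\<dots> < \<infinity>" by (simp add: emeasure_space_1)
  finally show "(\<integral>\<^sup>+ (x, v). ennreal (tnorm g x v) \<partial>?\<mu>) < \<infinity>" .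
qed

definition label_vectors_over :: "'m set \<Rightarrow> real \<Rightarrow> (('i discrete \<times> 'e) \<times> 'e) set" where
  "label_vectors_over Z R = {z \<in> labels. base_point z \<in> Z} \<times> cball 0 R"

lemma label_vectors_over_subset: "label_vectors_over Z R \<subseteq> labels \<times> cball 0 R" "label_vectors_over Z R \<subseteq> labels \<times> UNIV"
  by (auto simp: label_vectors_over_def)

lemma compact_label_vectors_over:
  assumes "closed Z"
  shows "compact (label_vectors_over Z R)"
proof -
  have "closedin (top_of_set labels) (labels \<inter> base_point -` Z)"
    using continuous_on_comp_base_point[OF continuous_on_id] assms by (intro continuous_closedin_preimage) simp_all
  from closedin_compact[OF compact_labels this] show ?thesis
    unfolding label_vectors_over_def by (intro compact_Times compact_cball) (simp add: vimage_def Int_def)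
qed

lemma ex_minimizing_label_probability:
  assumes Z: "closed Z" and contact: "\<And>\<phi>. \<phi> \<in> C1_functions A \<Longrightarrow> \<exists>z\<in>labels. \<exists>v. base_point z \<in> Z \<and> norm v \<le> R \<and>
      fenchel_conjugate (label_hamiltonian z) v + c \<le> label_gradient \<phi> z \<bullet> v"
  obtains \<nu> where "borel_probability_on (label_vectors_over Z R) \<nu>"
    "\<And>\<phi>. \<phi> \<in> C1_functions A \<Longrightarrow> (\<integral>w. label_gradient \<phi> (fst w) \<bullet> snd w \<partial>\<nu>) = 0"
    "(\<integral>w. fenchel_conjugate (label_hamiltonian (fst w)) (snd w) + c \<partial>\<nu>) \<le> 0"
proof -
  let ?K = "label_vectors_over Z R" and ?d = "\<lambda>\<phi> w. label_gradient \<phi> (fst w) \<bullet> snd w"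
  let ?h = "\<lambda>w. fenchel_conjugate (label_hamiltonian (fst w)) (snd w) + c"
  obtain \<nu> where "borel_probability_on ?K \<nu>" "\<And>f. f \<in> ?d ` C1_functions A \<Longrightarrow> (\<integral>w. f w \<partial>\<nu>) = 0"
    "(\<integral>w. ?h w \<partial>\<nu>) \<le> 0"
  proof (rule annihilating_probability[OF compact_label_vectors_over[OF Z], of "?d ` C1_functions A" R ?h])
    show "?d ` C1_functions A \<noteq> {}" using C1_const by blast
    show "continuous_on ?K f" if "f \<in> ?d ` C1_functions A" for f
      using that continuous_on_subset[OF continuous_on_label_gradient_inner label_vectors_over_subset(2)] by blast
    show "continuous_on ?K ?h"
      by (intro continuous_intros continuous_on_subset[OF continuous_on_label_conjugate label_vectors_over_subset(1)])
    show "\<exists>k\<in>?d ` C1_functions A. \<forall>w\<in>?K. k w = a * f w + b * f' w"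
      if ff': "f \<in> ?d ` C1_functions A" "f' \<in> ?d ` C1_functions A" for f f' a b
    proof -
      obtain \<phi> \<psi> where \<phi>\<psi>: "\<phi> \<in> C1_functions A" "\<psi> \<in> C1_functions A" "f = ?d \<phi>" "f' = ?d \<psi>" using ff' by blast
      have "?d (\<lambda>x. a * \<phi> x + b * \<psi> x) w = a * f w + b * f' w" if "w \<in> ?K" for w
        using that \<phi>\<psi> label_in_chart[of "fst w"]
        by (auto simp: label_vectors_over_def label_gradient_def chart_gradient_combination inner_add_left)
      then show ?thesis by (intro bexI[OF _ imageI[OF C1_combination[OF \<phi>\<psi>(1,2)]]] ballI)
    qed
    show "\<exists>w\<in>?K. ?h w \<le> f w" if "f \<in> ?d ` C1_functions A" for f
    proof -
      obtain \<phi> where \<phi>: "\<phi> \<in> C1_functions A" "f = ?d \<phi>" using \<open>f \<in> _\<close> by blast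
      from contact[OF \<phi>(1)] obtain z v where "z \<in> labels" "base_point z \<in> Z" "norm v \<le> R"
        "?h (z, v) \<le> ?d \<phi> (z, v)" by auto
      then show ?thesis by (intro bexI[of _ "(z, v)"]) (simp_all add: label_vectors_over_def \<phi>(2))
    qed
  qed (rule that)
  then show ?thesis by (intro that[of \<nu>]) blast+
qed

lemma mather_measure_distr_label_tangent:
  assumes \<nu>: "borel_probability_on K \<nu>" and K: "compact K" "K \<subseteq> labels \<times> cball 0 R"
    and closed: "\<And>\<phi>. \<phi> \<in> C1_functions A \<Longrightarrow> (\<integral>w. label_gradient \<phi> (fst w) \<bullet> snd w \<partial>\<nu>) = 0"
    and minimizing: "(\<integral>w. fenchel_conjugate (label_hamiltonian (fst w)) (snd w) + critical_value A G \<partial>\<nu>) \<le> 0"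
  shows "mather_measure A g G (distr \<nu> (tangent_borel A) label_tangent)"
proof -
  interpret prob_space \<nu> by (rule prob_space_borel_probability_on[OF \<nu>])
  let ?L = "\<lambda>w. fenchel_conjugate (label_hamiltonian (fst w)) (snd w)" and ?\<mu> = "distr \<nu> (tangent_borel A) label_tangent"
  have K': "K \<subseteq> labels \<times> UNIV" using K(2) by auto
  note meas = measurable_label_tangent[OF \<nu> K']
  have closed_\<mu>: "closed_prob_measure A g ?\<mu>" by (rule closed_prob_measure_distr_label_tangent[OF \<nu> K(1) K' closed])
  have L_eq: "Lagrangian A G (label_tangent w) = ?L w" if "w \<in> space \<nu>" for w
    using that space_borel_probability_on[OF \<nu>] K' by (intro Lagrangian_label_tangent) auto
  have integrable_L: "integrable \<nu> ?L"
    by (rule integrable_borel_probability_on[OF \<nu> K(1) continuous_on_subset[OF continuous_on_label_conjugate K(2)]])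
  then have "integrable \<nu> (\<lambda>w. Lagrangian A G (label_tangent w))"
    by (simp add: L_eq cong: Bochner_Integration.integrable_cong)
  then have integrable: "integrable ?\<mu> (Lagrangian A G)"
    by (simp add: integrable_distr_eq[OF meas borel_measurable_Lagrangian])
  have "(\<integral>z. Lagrangian A G z \<partial>?\<mu>) = (\<integral>w. ?L w \<partial>\<nu>)"
    using L_eq by (simp add: integral_distr[OF meas borel_measurable_Lagrangian] cong: Bochner_Integration.integral_cong)
  then have "(\<integral>z. Lagrangian A G z \<partial>?\<mu>) \<le> - critical_value A G"
    using minimizing integrable_L by (simp add: prob_space)
  then show ?thesis
    unfolding mather_measure_def
    using closed_\<mu> integrable minus_critical_value_le_integral_Lagrangian[OF closed_\<mu> integrable] by simp
qed

lemma mather_measure_over_closed_set: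
  assumes Z: "closed Z" and contact: "\<And>\<phi>. \<phi> \<in> C1_functions A \<Longrightarrow> \<exists>z\<in>labels. \<exists>v. base_point z \<in> Z \<and> norm v \<le> R \<and>
      fenchel_conjugate (label_hamiltonian z) v + critical_value A G \<le> label_gradient \<phi> z \<bullet> v"
  obtains \<mu> where "mather_measure A g G \<mu>" "AE w in \<mu>. fst w \<in> Z"
proof -
  obtain \<nu> where \<nu>: "borel_probability_on (label_vectors_over Z R) \<nu>"
    and closed: "\<And>\<phi>. \<phi> \<in> C1_functions A \<Longrightarrow> (\<integral>w. label_gradient \<phi> (fst w) \<bullet> snd w \<partial>\<nu>) = 0"
    and minimizing: "(\<integral>w. fenchel_conjugate (label_hamiltonian (fst w)) (snd w) + critical_value A G \<partial>\<nu>) \<le> 0"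
    by (rule ex_minimizing_label_probability[OF Z contact]) (assumption | rule that)+
  let ?\<mu> = "distr \<nu> (tangent_borel A) label_tangent"
  have "mather_measure A g G ?\<mu>"
    by (rule mather_measure_distr_label_tangent[OF \<nu> compact_label_vectors_over[OF Z]
          label_vectors_over_subset(1) closed minimizing])
  moreover have "AE w in ?\<mu>. fst w \<in> Z"
  proof (subst AE_distr_iff[OF measurable_label_tangent[OF \<nu> label_vectors_over_subset(2)]])
    show "{w \<in> space (tangent_borel A). fst w \<in> Z} \<in> sets (tangent_borel A)"
      using measurable_sets[OF borel_measurable_fst_tangent_borel borel_closed[OF Z]]
      by (simp add: vimage_def Int_def conj_commute)
    show "AE w in \<nu>. fst (label_tangent w) \<in> Z"
      using space_borel_probability_on[OF \<nu>] by (intro AE_I2) (auto simp: fst_label_tangent label_vectors_over_def)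
  qed
  ultimately show ?thesis by (rule that)
qed

lemma contact_vector:
  assumes u1: "viscosity_solution A G k u1" and u2: "viscosity_solution A G k u2" and \<phi>: "\<phi> \<in> C1_functions A"
    and R: "\<And>z q v. z \<in> labels \<Longrightarrow> label_hamiltonian z q \<le> k \<Longrightarrow>
      \<forall>p. k + v \<bullet> (p - q) \<le> label_hamiltonian z p \<Longrightarrow> norm v \<le> R"
  obtains z v where "z \<in> labels" "\<And>x. u1 x - u2 x \<le> u1 (base_point z) - u2 (base_point z)" "norm v \<le> R"
    "fenchel_conjugate (label_hamiltonian z) v + k \<le> label_gradient \<phi> z \<bullet> v"
proof -
  have cont: "continuous_on UNIV u1" "continuous_on UNIV u2" "continuous_on UNIV \<phi>"
    using u1 u2 continuous_on_C1[OF \<phi>] by (auto simp: viscosity_solution_def)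
  let ?\<alpha> = "\<lambda>z. u1 (base_point z) - u2 (base_point z)" and ?\<beta> = "\<lambda>z. \<phi> (base_point z) - u1 (base_point z)"
  have contact: "\<exists>z\<in>labels. \<exists>q. (\<forall>y\<in>labels. ?\<alpha> y + s * ?\<beta> y \<le> ?\<alpha> z + s * ?\<beta> z) \<and>
      label_hamiltonian z q \<le> k \<and> k \<le> label_hamiltonian z ((1 - s) *\<^sub>R q + s *\<^sub>R label_gradient \<phi> z)"
    if s: "0 < s" "s < 1" for s
  proof -
    have "continuous_on UNIV (\<lambda>x. (1 - s) * u1 x + s * \<phi> x - u2 x)" by (intro continuous_intros cont)
    then obtain x where x: "\<And>x'. (1 - s) * u1 x' + s * \<phi> x' - u2 x' \<le> (1 - s) * u1 x + s * \<phi> x - u2 x"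
      using continuous_attains_sup[OF compact_manifold] by auto
    obtain z where z: "z \<in> labels" "base_point z = x" by (rule ex_label)
    have "\<exists>q. label_hamiltonian z q \<le> k \<and> k \<le> label_hamiltonian z ((1 - s) *\<^sub>R q + s *\<^sub>R label_gradient \<phi> z)"
      using x ex_contact_covector[OF u1 u2 \<phi> s label_in_chart[OF z(1)]] z(2)
      by (simp add: label_hamiltonian_def label_gradient_def base_point_def)
    moreover have "?\<alpha> y + s * ?\<beta> y \<le> ?\<alpha> z + s * ?\<beta> z" for y
      using x[of "base_point y"] z(2) by (simp add: algebra_simps)
    ultimately show ?thesis using z(1) by blast
  qed
  have "continuous_on labels ?\<alpha>" "continuous_on labels ?\<beta>"
    by (intro continuous_intros continuous_on_comp_base_point cont)+
  from contact_segment_limit[OF compact_labels continuous_on_label_hamiltonian convex_on_label_hamiltonian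
      ray_superlinear_label_hamiltonian this continuous_on_label_gradient[OF \<phi>] contact]
  obtain z q where z: "z \<in> labels" "\<And>y. y \<in> labels \<Longrightarrow> ?\<alpha> y \<le> ?\<alpha> z" and q: "label_hamiltonian z q \<le> k"
    and segment: "\<And>t. 0 \<le> t \<Longrightarrow> t \<le> 1 \<Longrightarrow> k \<le> label_hamiltonian z ((1 - t) *\<^sub>R q + t *\<^sub>R label_gradient \<phi> z)"
    by metis
  obtain v where v: "0 \<le> v \<bullet> (label_gradient \<phi> z - q)" "\<And>p. k + v \<bullet> (p - q) \<le> label_hamiltonian z p"
    by (rule subgradient_along_segment[OF convex_on_label_hamiltonian q segment]) (assumption | rule that)+
  have "u1 x - u2 x \<le> ?\<alpha> z" for x
  proof -
    obtain y where "y \<in> labels" "base_point y = x" by (rule ex_label)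
    then show ?thesis using z(2) by blast
  qed
  moreover have "fenchel_conjugate (label_hamiltonian z) v + k \<le> label_gradient \<phi> z \<bullet> v"
    using fenchel_conjugate_le_if_subgradient[of k v q "label_hamiltonian z", OF v(2)] v(1)
    by (simp add: inner_diff_right inner_commute)
  moreover have "norm v \<le> R" using R[OF z(1) q] v(2) by blast
  ultimately show ?thesis using that[OF z(1)] by blast
qed

lemma mather_measure_over_maximizers:
  assumes u1: "viscosity_solution A G (critical_value A G) u1" and u2: "viscosity_solution A G (critical_value A G) u2"
  obtains \<mu> where "mather_measure A g G \<mu>" "AE w in \<mu>. \<forall>x. u1 x - u2 x \<le> u1 (fst w) - u2 (fst w)"
proof -
  let ?Z = "{y. \<forall>x. u1 x - u2 x \<le> u1 y - u2 y}"
  have "continuous_on UNIV (\<lambda>y. u1 y - u2 y)"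
    using u1 u2 by (auto simp: viscosity_solution_def intro!: continuous_intros)
  then have "closed {y. u1 x - u2 x \<le> u1 y - u2 y}" for x
    by (intro closed_Collect_le continuous_on_const)
  then have Z: "closed ?Z" by (intro closed_Collect_all)
  have "\<exists>R. \<forall>z\<in>labels. \<forall>q v. label_hamiltonian z q \<le> critical_value A G \<longrightarrow>
      (\<forall>p. critical_value A G + v \<bullet> (p - q) \<le> label_hamiltonian z p) \<longrightarrow> norm v \<le> R"
    by (intro subgradients_uniformly_bounded compact_labels continuous_on_label_hamiltonian
        convex_on_label_hamiltonian ray_superlinear_label_hamiltonian)
  then obtain R where R: "\<And>z q v. z \<in> labels \<Longrightarrow> label_hamiltonian z q \<le> critical_value A G \<Longrightarrow>
      \<forall>p. critical_value A G + v \<bullet> (p - q) \<le> label_hamiltonian z p \<Longrightarrow> norm v \<le> R"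
    by blast
  have "\<exists>z\<in>labels. \<exists>v. base_point z \<in> ?Z \<and> norm v \<le> R \<and>
      fenchel_conjugate (label_hamiltonian z) v + critical_value A G \<le> label_gradient \<phi> z \<bullet> v"
    if \<phi>: "\<phi> \<in> C1_functions A" for \<phi>
    by (rule contact_vector[OF u1 u2 \<phi> R]) (assumption | blast)+
  from mather_measure_over_closed_set[OF Z this] that show ?thesis by auto
qed

end

context hamiltonian
begin

lemma projected_mather_measure_over_maximizers:
  assumes u1: "viscosity_solution A G (critical_value A G) u1" and u2: "viscosity_solution A G (critical_value A G) u2"
  obtains \<mu> where "projected_mather_measure A g G \<mu>" "\<And>x. u1 x - u2 x \<le> (\<integral>y. u1 y \<partial>\<mu>) - (\<integral>y. u2 y \<partial>\<mu>)"
proof -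
  obtain I :: "'m set" and cs :: "'m \<Rightarrow> ('m, 'e) chart" and Q :: "'m \<Rightarrow> 'e set"
    where "finite I" "\<And>i. cs i \<in> A" "\<And>i. compact (Q i)" "\<And>i. Q i \<subseteq> chart_img (cs i)"
      "\<And>x. \<exists>i\<in>I. x \<in> chart_dom (cs i) \<and> chart_map (cs i) x \<in> Q i"
    by (rule finite_compact_chart_cover) (rule that)
  then interpret hamiltonian_cover A g G "discrete ` I" "\<lambda>i. cs (of_discrete i)" "\<lambda>i. Q (of_discrete i)"
    by unfold_locales (auto simp: discrete_inverse)
  obtain \<nu> where \<nu>: "mather_measure A g G \<nu>" and AE_\<nu>: "AE w in \<nu>. \<forall>x. u1 x - u2 x \<le> u1 (fst w) - u2 (fst w)"
    by (rule mather_measure_over_maximizers[OF u1 u2])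
  have cont: "continuous_on UNIV u1" "continuous_on UNIV u2"
    using u1 u2 by (auto simp: viscosity_solution_def)
  let ?\<mu> = "distr \<nu> borel fst"
  have sets: "sets \<nu> = sets (tangent_borel A)" and "prob_space \<nu>"
    using \<nu> by (auto simp: mather_measure_def closed_prob_measure_def)
  then have fst_meas: "fst \<in> borel_measurable \<nu>"
    using borel_measurable_fst_tangent_borel by (simp cong: measurable_cong_sets)
  then have \<mu>: "borel_probability_on UNIV ?\<mu>"
    using prob_space.prob_space_distr[OF \<open>prob_space \<nu>\<close> fst_meas] by (simp add: borel_probability_on_def)
  interpret \<mu>: prob_space ?\<mu> by (rule prob_space_borel_probability_on[OF \<mu>])
  note integrable = integrable_borel_probability_on[OF \<mu> compact_manifold]
  have "u1 x - u2 x \<le> (\<integral>y. u1 y \<partial>?\<mu>) - (\<integral>y. u2 y \<partial>?\<mu>)" for x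
  proof -
    have "closed {y. u1 x - u2 x \<le> u1 y - u2 y}" by (intro closed_Collect_le continuous_intros cont)
    then have "AE y in ?\<mu>. u1 x - u2 x \<le> u1 y - u2 y"
      using AE_\<nu> by (subst AE_distr_iff[OF fst_meas]) (auto simp: borel_closed)
    then have "u1 x - u2 x \<le> (\<integral>y. u1 y - u2 y \<partial>?\<mu>)"
      by (intro \<mu>.integral_ge_const integrable continuous_intros cont)
    also have "\<dots> = (\<integral>y. u1 y \<partial>?\<mu>) - (\<integral>y. u2 y \<partial>?\<mu>)"
      by (intro Bochner_Integration.integral_diff integrable cont)
    finally show ?thesis .
  qed
  moreover have "projected_mather_measure A g G ?\<mu>" using \<nu> by (auto simp: projected_mather_measure_def)
  ultimately show ?thesis by (rule that[rotated])
qed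

end

theorem corollary6:
  fixes A :: "('m::t2_space, 'e::euclidean_space) chart set"
    and g :: "'m \<Rightarrow> ('m, 'e) tvec \<Rightarrow> ('m, 'e) tvec \<Rightarrow> real"
    and G :: "'m \<times> ('m, 'e) covec \<Rightarrow> real"
    and u1 u2 :: "'m \<Rightarrow> real"
  assumes "closed_connected_riemannian_manifold A g"
    and "continuous_map (cotangent_topology A) euclideanreal G"
    and "convex_in_p A G"
    and "superlinear_in_p A g G"
    and "viscosity_solution A G (critical_value A G) u1"
    and "viscosity_solution A G (critical_value A G) u2"
    and "\<And>\<mu>. projected_mather_measure A g G \<mu> \<Longrightarrow> (\<integral>y. u1 y \<partial>\<mu>) \<le> (\<integral>y. u2 y \<partial>\<mu>)"
  shows "\<forall>x. u1 x \<le> u2 x"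
proof
  fix x
  interpret hamiltonian A g G
    using assms(1-4) by unfold_locales (auto simp: closed_connected_riemannian_manifold_def)
  obtain \<mu> where \<mu>: "projected_mather_measure A g G \<mu>"
    and difference: "\<And>x. u1 x - u2 x \<le> (\<integral>y. u1 y \<partial>\<mu>) - (\<integral>y. u2 y \<partial>\<mu>)"
    using projected_mather_measure_over_maximizers[OF assms(5,6)] by blast
  from assms(7)[OF \<mu>] difference[of x] show "u1 x \<le> u2 x" by simp
qed

end
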